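(* Let $m,n\in\mathbb{N}$ and let $G\colon \mathbb{R}^n\to\mathbb{C}^{m\times m}$ be bounded and continuous. Consider the linear operator $$ G(-i\nabla)\big|_{C_0^\infty(\mathbb{R}^n)^m}\colon \begin{cases} C_0^\infty(\mathbb{R}^n)^m\to C_\infty(\mathbb{R}^n)^m,\\ (f_1,\dots,f_m)^\top\mapsto \Big(G\,\big(f_1^\wedge,\dots,f_m^\wedge\big)^\top\Big)^\vee . \end{cases} \tag{$*$} $$ Then the following items (i)--(iv) are equivalent: (i) For all $1\le j,k\le m$, the entry $G_{j,k}\colon\mathbb{R}^n\to\mathbb{C}$ is positive semidefinite. (ii) The operator $( * )$ extends boundedly to $G(-i\nabla)\in\mathcal{B}\big(L^1(\mathbb{R}^n)^m\big)$ satisfying $G(-i\nabla)\big(L^1(\mathbb{R}^n)_+^m\big)\subseteq L^1(\mathbb{R}^n)_+^m$. (iii) There exists $p\in(1,\infty)$ such that the operator $( * )$ extends boundedly to $G(-i\nabla)\in\mathcal{B}\big(L^p(\mathbb{R}^n)^m\big)$ satisfying $G(-i\nabla)\big(L^p(\mathbb{R}^n)_+^m\big)\subseteq L^p(\mathbb{R}^n)_+^m$. (iv) For all $p\in(1,\infty)$, the operator $( * )$ extends boundedly to $G(-i\nabla)\in\mathcal{B}\big(L^p(\mathbb{R}^n)^m\big)$ satisfying $G(-i\nabla)\big(L^p(\mathbb{R}^n)_+^m\big)\subseteq L^p(\mathbb{R}^n)_+^m$.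
   Context: A function $F\colon\mathbb{R}^n\to\mathbb{C}$ is called positive semidefinite if for all $N\in\mathbb{N}$ and all $x_1,\dots,x_N\in\mathbb{R}^n$ the matrix $A=(F(x_p-x_q))_{1\le p,q\le N}\in\mathbb{C}^{N\times N}$ is positive semidefinite, i.e. $\sum_{p,q=1}^N\overline{c_p}A_{p,q}c_q\ge 0$ for all $c\in\mathbb{C}^N$. All function spaces consist of complex-valued functions. $C_0^\infty(\mathbb{R}^n)$ is the space of smooth compactly supported functions; $C_\infty(\mathbb{R}^n)$ is the space of continuous functions vanishing at infinity. For a set $Y$, $Y^m$ denotes column vectors of length $m$ with entries in $Y$. $L^p(\mathbb{R}^n)$ is with respect to Lebesgue measure, and $L^p(\mathbb{R}^n)^m$ carries the norm $\|f\|_{L^p(\mathbb{R}^n)^m}=\sum_{j=1}^m\|f_j\|_{L^p(\mathbb{R}^n)}$. $L^p(\mathbb{R}^n)_+^m$ is the set of $f=(f_1,\dots,f_m)^\top\in L^p(\mathbb{R}^n)^m$ with $f_k\ge0$ a.e. for every $1\le k\le m$. $\mathcal{B}(X)$ is the space of bounded linear operators on the Banach space $X$. Fourier transforms: $f^\wedge(y)=(2\pi)^{-n/2}\int_{\mathbb{R}^n}e^{-iy\cdot x}f(x)\,d^nx$ and $g^\vee(x)=(2\pi)^{-n/2}\int_{\mathbb{R}^n}e^{ix\cdot y}g(y)\,d^ny$, applied componentwise to vectors. In $( * )$, $G(f_1^\wedge,\dots,f_m^\wedge)^\top$ is the pointwise matrix-vector product. "Extends boundedly to an operator in $\mathcal{B}(L^p(\mathbb{R}^n)^m)$"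 means that there is a bounded linear operator on $L^p(\mathbb{R}^n)^m$ that agrees with $( * )$ on $C_0^\infty(\mathbb{R}^n)^m$; this operator is again denoted $G(-i\nabla)$. *)

theory Defs
  imports "HOL-Analysis.Analysis"
begin

text \<open>
  The dimensions are types: \<open>CARD('n)\<close> is the dimension of the domain, \<open>CARD('m)\<close> the number of
  components. Both are positive. \<open>\<real>\<^sub>\<ge>\<^sub>0 :: complex set\<close> is the set of nonnegative real numbers inside
  the complex numbers.
\<close>

subsection \<open>Positive semidefinite matrices and functions\<close>

definition psd_matrix :: "nat \<Rightarrow> (nat \<Rightarrow> nat \<Rightarrow> complex) \<Rightarrow> bool" where
  "psd_matrix N A \<longleftrightarrow>
     (\<forall>c :: nat \<Rightarrow> complex. (\<Sum>p<N. \<Sum>q<N. cnj (c p) * A p q * c q) \<in> \<real>\<^sub>\<ge>\<^sub>0)"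

definition psd_function :: "(real ^ 'n \<Rightarrow> complex) \<Rightarrow> bool" where
  "psd_function F \<longleftrightarrow> (\<forall>N. \<forall>x :: nat \<Rightarrow> real ^ 'n. psd_matrix N (\<lambda>p q. F (x p - x q)))"

subsection \<open>Function spaces\<close>

text \<open>Differentiability is meant over the reals; \<open>axis i 1\<close> is the i-th standard unit vector, so
  \<open>frechet_derivative f (at x) (axis i 1)\<close> is the i-th partial derivative.\<close>

primrec C_k :: "nat \<Rightarrow> (real ^ 'n \<Rightarrow> complex) \<Rightarrow> bool" where
  "C_k 0 f \<longleftrightarrow> continuous_on UNIV f"
| "C_k (Suc k) f \<longleftrightarrow>
     (\<forall>x. f differentiable (at x)) \<and>
     (\<forall>i. C_k k (\<lambda>x. frechet_derivative f (at x) (axis i 1)))"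

definition test_functions :: "(real ^ 'n \<Rightarrow> complex) set" where
  "test_functions = {f. (\<forall>k. C_k k f) \<and> compact (closure {x. f x \<noteq> 0})}"

definition C_vanishing :: "(real ^ 'n \<Rightarrow> complex) set" where
  "C_vanishing = {f. continuous_on UNIV f \<and> (f \<longlongrightarrow> 0) at_infinity}"

definition Lp :: "real \<Rightarrow> (real ^ 'n \<Rightarrow> complex) set" where
  "Lp p = {f \<in> borel_measurable lebesgue. integrable lebesgue (\<lambda>x. norm (f x) powr p)}"

definition Lp_norm :: "real \<Rightarrow> (real ^ 'n \<Rightarrow> complex) \<Rightarrow> real" where
  "Lp_norm p f = (LINT x|lebesgue. norm (f x) powr p) powr (1 / p)"

definition column_vectors :: "(real ^ 'n \<Rightarrow> complex) set \<Rightarrow> (real ^ 'n \<Rightarrow> complex ^ 'm) set" where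
  "column_vectors Y = {f. \<forall>j. (\<lambda>x. f x $ j) \<in> Y}"

definition Lp_vec_norm :: "real \<Rightarrow> (real ^ 'n \<Rightarrow> complex ^ 'm) \<Rightarrow> real" where
  "Lp_vec_norm p f = (\<Sum>j\<in>UNIV. Lp_norm p (\<lambda>x. f x $ j))"

definition Lp_vec_nonneg :: "real \<Rightarrow> (real ^ 'n \<Rightarrow> complex ^ 'm) set" where
  "Lp_vec_nonneg p = {f \<in> column_vectors (Lp p). \<forall>k. AE x in lebesgue. f x $ k \<in> \<real>\<^sub>\<ge>\<^sub>0}"

text \<open>Elements of the Lebesgue spaces are represented by functions, and equality in these spaces is
  equality almost everywhere. An operator acts on representatives; that it respects equality almost
  everywhere follows from linearity and boundedness, since
  \<open>\<parallel>T f - T g\<parallel> = \<parallel>T (f - g)\<parallel> \<le> C * \<parallel>f - g\<parallel> = 0\<close> whenever f and g agree almost everywhere.\<close>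

definition bounded_Lp_operator ::
    "real \<Rightarrow> ((real ^ 'n \<Rightarrow> complex ^ 'm) \<Rightarrow> (real ^ 'n \<Rightarrow> complex ^ 'm)) \<Rightarrow> bool" where
  "bounded_Lp_operator p T \<longleftrightarrow>
     (\<forall>f \<in> column_vectors (Lp p). T f \<in> column_vectors (Lp p)) \<and>
     (\<forall>f \<in> column_vectors (Lp p). \<forall>g \<in> column_vectors (Lp p).
        AE x in lebesgue. T (\<lambda>y. f y + g y) x = T f x + T g x) \<and>
     (\<forall>a. \<forall>f \<in> column_vectors (Lp p). AE x in lebesgue. T (\<lambda>y. a *s f y) x = a *s T f x) \<and>
     (\<exists>C. \<forall>f \<in> column_vectors (Lp p). Lp_vec_norm p (T f) \<le> C * Lp_vec_norm p f)"

subsection \<open>Fourier transforms and multiplier operators\<close>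

definition fourier :: "(real ^ 'n \<Rightarrow> complex) \<Rightarrow> real ^ 'n \<Rightarrow> complex" where
  "fourier f y = of_real ((2 * pi) powr (- real CARD('n) / 2)) *
     (LINT x|lebesgue. exp (- \<i> * of_real (y \<bullet> x)) * f x)"

definition inverse_fourier :: "(real ^ 'n \<Rightarrow> complex) \<Rightarrow> real ^ 'n \<Rightarrow> complex" where
  "inverse_fourier g x = of_real ((2 * pi) powr (- real CARD('n) / 2)) *
     (LINT y|lebesgue. exp (\<i> * of_real (x \<bullet> y)) * g y)"

definition fourier_vec :: "(real ^ 'n \<Rightarrow> complex ^ 'm) \<Rightarrow> real ^ 'n \<Rightarrow> complex ^ 'm" where
  "fourier_vec f y = (\<chi> j. fourier (\<lambda>x. f x $ j) y)"

definition inverse_fourier_vec :: "(real ^ 'n \<Rightarrow> complex ^ 'm) \<Rightarrow> real ^ 'n \<Rightarrow> complex ^ 'm" where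
  "inverse_fourier_vec g x = (\<chi> j. inverse_fourier (\<lambda>y. g y $ j) x)"

definition multiplier_op ::
    "(real ^ 'n \<Rightarrow> complex ^ 'm ^ 'm) \<Rightarrow> (real ^ 'n \<Rightarrow> complex ^ 'm) \<Rightarrow> real ^ 'n \<Rightarrow> complex ^ 'm" where
  "multiplier_op G f = inverse_fourier_vec (\<lambda>y. G y *v fourier_vec f y)"

definition extends_to_positive_Lp_operator :: "real \<Rightarrow> (real ^ 'n \<Rightarrow> complex ^ 'm ^ 'm) \<Rightarrow> bool" where
  "extends_to_positive_Lp_operator p G \<longleftrightarrow>
     (\<exists>T. bounded_Lp_operator p T \<and>
          (\<forall>f \<in> column_vectors test_functions. AE x in lebesgue. T f x = multiplier_op G f x) \<and>
          T ` Lp_vec_nonneg p \<subseteq> Lp_vec_nonneg p)"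

end

(* Only two implications need work: (i) gives the extension property for every p >= 1, and the
   extension property for a single p >= 1 gives (i). Both reduce to scalar multipliers F, the
   entries of G.

   For (i) no Bochner measure is needed. If F is positive semidefinite, averaging the defining
   sums over independent Gaussian samples shows that the inverse Fourier transform of F times a
   Gaussian is nonnegative, with total mass at most (2 pi)^n sup |F|. The regularized operators are
   therefore convolutions with nonnegative kernels of bounded mass; they preserve positivity and are
   bounded on all L^p, and Fatou's lemma passes this on to F itself on test functions. Density of
   test functions, nonnegative ones for nonnegative limits, extends the operator to L^p.

   Conversely, positivity on test functions f >= 0 says that F times the transform of f has a
   nonnegative inverse transform, hence is a limit of transforms of nonnegative integrable functions
   and so positive semidefinite. Letting f run through bumps shrinking to the origin gives F. *)
theory Submission
  imports Defs "HOL-Probability.Probability"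
begin

section \<open>Test functions\<close>

text \<open>A bounded continuous \<open>F\<close> need not be integrable, so its inverse transform
  cannot be evaluated directly. Test functions have integrable transforms, hence
  \<open>F * ft f\<close> is integrable and the integrals of the reduction converge absolutely; a
  Gaussian factor takes over where no test function is present. Gaussians fit because the difference
  of two independent samples is again Gaussian, which turns the sums over finitely many points into
  one integral; because their transforms are Gaussian, which makes masses computable; and because
  they increase to 1 as they widen, which suits Fatou's lemma and dominated convergence. Estimates
  are made for p-th powers of norms, at the price of factors \<open>2 powr p\<close>. Boundedness
  asks only for some constant, so these are harmless, and p = 1 is treated like every other
  exponent. Operators act on functions, so the extended operator is additive and homogeneous only
  almost everywhere.\<close>

lemma frechet_derivative_unique:
  "(f has_derivative f') (at x) \<Longrightarrow> frechet_derivative f (at x) v = f' v"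
  using frechet_derivative_at by metis

lemma C_k_Suc_imp: "C_k (Suc k) f \<Longrightarrow> C_k k f"
proof (induction k arbitrary: f)
  case 0
  then show ?case
    by (auto simp: differentiable_imp_continuous_within continuous_on_eq_continuous_within)
next
  case (Suc k)
  then show ?case by (metis C_k.simps(2))
qed

lemma C_k_const: "C_k k (\<lambda>x. c)"
  by (induction k arbitrary: c) auto

lemma C_k_add:
  assumes "C_k k f" "C_k k g"
  shows "C_k k (\<lambda>x. f x + g x)"
  using assms
proof (induction k arbitrary: f g)
  case 0
  then show ?case by (auto intro: continuous_intros)
next
  case (Suc k)
  have "frechet_derivative (\<lambda>x. f x + g x) (at x) v =
      frechet_derivative f (at x) v + frechet_derivative g (at x) v" for x v
    using Suc.prems
    by (intro frechet_derivative_unique has_derivative_add) (auto simp: frechet_derivative_works[symmetric])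
  then show ?case using Suc by auto
qed

lemma C_k_mult:
  assumes "C_k k f" "C_k k g"
  shows "C_k k (\<lambda>x. f x * g x)"
  using assms
proof (induction k arbitrary: f g)
  case 0
  then show ?case by (auto intro: continuous_intros)
next
  case (Suc k)
  have "frechet_derivative (\<lambda>x. f x * g x) (at x) v =
      f x * frechet_derivative g (at x) v + frechet_derivative f (at x) v * g x" for x v
    using Suc.prems
    by (intro frechet_derivative_unique has_derivative_mult) (auto simp: frechet_derivative_works[symmetric])
  \<comment> \<open>Each term of the product rule keeps an undifferentiated factor, so one order of
    smoothness has to be given up before the induction hypothesis applies.\<close>
  moreover have "C_k k f" "C_k k g"
    using Suc.prems C_k_Suc_imp by blast+
  ultimately show ?case using Suc by (auto intro!: C_k_add)
qed

lemma C_k_prod: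
  assumes "finite A" "\<And>i. i \<in> A \<Longrightarrow> C_k k (f i)"
  shows "C_k k (\<lambda>x. \<Prod>i\<in>A. f i x)"
  using assms by (induction A rule: finite_induct) (auto intro: C_k_const C_k_mult)

text \<open>The family \<open>t\<^sup>-\<^sup>j exp (-1/t)\<close> is closed under differentiation up to linear
  combinations, which makes all its members smooth at once.\<close>

definition flat :: "nat \<Rightarrow> real \<Rightarrow> real" where
  "flat j t = (if t > 0 then inverse t ^ j * exp (- inverse t) else 0)"

text \<open>From the right, u = 1/t turns the claim into u^j / e^u -> 0 as u -> \<infinity>; from
  the left the function vanishes.\<close>

lemma flat_at_0: "(flat j \<longlongrightarrow> 0) (at 0)"
proof -
  have "((\<lambda>t. inverse t ^ j / exp (inverse t)) \<longlongrightarrow> (0::real)) (at_right 0)"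
    by (rule filterlim_compose[OF tendsto_power_div_exp_0 filterlim_inverse_at_top_right])
  moreover have "\<forall>\<^sub>F t in at_right 0. inverse t ^ j / exp (inverse t) = flat j t"
    by (auto simp: flat_def exp_minus divide_inverse eventually_at_right_less
        intro!: eventually_mono[OF eventually_at_right_less[of 0]])
  ultimately have "(flat j \<longlongrightarrow> 0) (at_right 0)"
    by (rule Lim_transform_eventually)
  moreover have "(flat j \<longlongrightarrow> 0) (at_left 0)"
  proof (rule Lim_transform_eventually[OF tendsto_const])
    show "\<forall>\<^sub>F t in at_left 0. 0 = flat j t"
      by (auto simp: flat_def eventually_at_filter)
  qed
  ultimately show ?thesis
    by (simp add: filterlim_split_at)
qed

lemma flat_has_derivative:
  "(flat j has_real_derivative (flat (j + 2) t - of_nat j * flat (j + 1) t)) (at t)"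
proof -
  consider "t > 0" | "t < 0" | "t = 0" by linarith
  then show ?thesis
  proof cases
    case 1
    have "((\<lambda>t. inverse t ^ j * exp (- inverse t)) has_real_derivative
        (flat (j + 2) t - of_nat j * flat (j + 1) t)) (at t)"
    proof -
      have "i * i ^ (m - Suc 0) = i ^ m" if "m \<noteq> 0" for i :: real and m
        using that by (cases m) auto
      then have "((\<lambda>t. inverse t ^ j) has_real_derivative - of_nat j * inverse t ^ (j + 1)) (at t)"
        using 1 by (cases j) (auto intro!: derivative_eq_intros simp: algebra_simps, metis neq0_conv)
      moreover have "((\<lambda>t. exp (- inverse t)) has_real_derivative exp (- inverse t) * inverse t ^ 2) (at t)"
        using 1 by (auto intro!: derivative_eq_intros simp: power2_eq_square)
      ultimately show ?thesis
        by (rule DERIV_cong[OF DERIV_mult])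
          (use 1 in \<open>simp add: flat_def algebra_simps power2_eq_square\<close>)
    qed
    then show ?thesis
      by (rule has_field_derivative_transform_within_open[where S="{0<..}"])
        (use 1 in \<open>auto simp: flat_def\<close>)
  next
    case 2
    have "((\<lambda>t::real. 0::real) has_real_derivative 0) (at t)" by simp
    then have "(flat j has_real_derivative 0) (at t)"
      by (rule has_field_derivative_transform_within_open[where S="{..<0}"])
        (use 2 in \<open>auto simp: flat_def\<close>)
    then show ?thesis using 2 by (simp add: flat_def)
  next
    case 3
    \<comment> \<open>Division by h raises the exponent by one, so differentiability at 0 is again a
      limit statement about the same family.\<close>
    have "(flat j h - flat j 0) / (h - 0) = flat (Suc j) h" for h
      by (auto simp: flat_def divide_inverse)
    then have "(flat j has_real_derivative 0) (at 0)"
      unfolding has_field_derivative_iff using flat_at_0[of "Suc j"] by simp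
    moreover have "flat i 0 = 0" for i by (simp add: flat_def)
    ultimately show ?thesis using 3 by simp
  qed
qed

lemma flat_nonneg: "0 \<le> flat j t"
  by (simp add: flat_def)

lemma flat_le_1: "flat 0 t \<le> 1"
  by (simp add: flat_def)

lemma flat_pos_iff: "0 < flat j t \<longleftrightarrow> 0 < t"
  by (simp add: flat_def)

text \<open>With free \<open>c\<close> and \<open>j\<close>, each partial derivative is a sum of two
  functions of the same form, so one induction on the order of differentiability covers the whole
  class. The sign of \<open>s\<close> selects the side on which the cutoff acts.\<close>

lemma C_k_flat:
  "C_k k (\<lambda>x::real^'n. of_real (c * flat j (s * x $ i + d)))"
proof (induction k arbitrary: c j)
  case 0
  have "continuous_on UNIV (flat j)"
    by (meson DERIV_isCont continuous_at_imp_continuous_on flat_has_derivative)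
  then have "continuous_on UNIV (\<lambda>x::real^'n. flat j (s * x $ i + d))"
    by (rule continuous_on_compose2) (auto intro!: continuous_intros)
  then show ?case by (auto intro!: continuous_intros)
next
  case (Suc k)
  have D: "((\<lambda>x::real^'n. complex_of_real (c * flat j (s * x $ i + d))) has_derivative
     (\<lambda>v. of_real (c * ((flat (j + 2) (s * x $ i + d) - of_nat j * flat (j + 1) (s * x $ i + d)) * (s * v $ i)))))
     (at x)" for x
  proof -
    have "((\<lambda>x::real^'n. s * x $ i + d) has_derivative (\<lambda>v. s * v $ i)) (at x)"
      by (auto intro!: derivative_eq_intros bounded_linear_imp_has_derivative bounded_linear_vec_nth)
    then have "((\<lambda>x::real^'n. flat j (s * x $ i + d)) has_derivative
        (\<lambda>v. (s * v $ i) * (flat (j + 2) (s * x $ i + d) - of_nat j * flat (j + 1) (s * x $ i + d)))) (at x)"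
      by (rule DERIV_compose_FDERIV[OF flat_has_derivative])
    then show ?thesis
      by (auto intro!: derivative_eq_intros simp: mult_ac)
  qed
  have "C_k k (\<lambda>x. frechet_derivative (\<lambda>x::real^'n. complex_of_real (c * flat j (s * x $ i + d))) (at x) (axis i' 1))" for i'
  proof -
    have "frechet_derivative (\<lambda>x::real^'n. complex_of_real (c * flat j (s * x $ i + d))) (at x) (axis i' 1) =
      of_real (c * s * axis i' 1 $ i * flat (j + 2) (s * x $ i + d)) +
      of_real (- c * s * axis i' 1 $ i * of_nat j * flat (j + 1) (s * x $ i + d))" for x
      using frechet_derivative_unique[OF D[of x], of "axis i' 1"]
      by (simp add: algebra_simps)
    then show ?thesis
      using Suc.IH[of "c * s * axis i' 1 $ i" "j + 2"] Suc.IH[of "- c * s * axis i' 1 $ i * of_nat j" "j + 1"]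
      by (simp only: ) (rule C_k_add)
  qed
  then show ?case using D by (auto simp: differentiable_def)
qed

text \<open>A product over coordinates rather than a radial bump: smoothness reduces to one
  variable, and positivity holds exactly on an open box, the shape into which open sets
  decompose.\<close>

definition box_bump :: "real ^ 'n \<Rightarrow> real ^ 'n \<Rightarrow> real ^ 'n \<Rightarrow> real" where
  "box_bump a b x = (\<Prod>i\<in>UNIV. flat 0 (x $ i - a $ i) * flat 0 (b $ i - x $ i))"

lemma box_bump_nonneg: "0 \<le> box_bump a b x"
  by (simp add: box_bump_def flat_nonneg prod_nonneg)

lemma box_bump_le_1: "box_bump a b x \<le> 1"
  unfolding box_bump_def
  by (intro prod_le_1) (auto simp: flat_nonneg flat_le_1 mult_le_one)

lemma box_bump_pos_iff: "0 < box_bump a b x \<longleftrightarrow> x \<in> box a b"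
proof
  assume "0 < box_bump a b x"
  then have "flat 0 (x $ i - a $ i) * flat 0 (b $ i - x $ i) \<noteq> 0" for i
    unfolding box_bump_def by (metis (no_types, lifting) UNIV_I finite less_irrefl prod_zero)
  then have "0 < x $ i - a $ i \<and> 0 < b $ i - x $ i" for i
    by (metis flat_def mult_zero_left mult_zero_right)
  then show "x \<in> box a b" by (simp add: mem_box_cart)
next
  assume "x \<in> box a b"
  then show "0 < box_bump a b x"
    unfolding box_bump_def by (intro prod_pos) (auto simp: flat_pos_iff mem_box_cart)
qed

lemma C_k_box_bump: "C_k k (\<lambda>x. of_real (box_bump a b x))"
proof -
  have "C_k k (\<lambda>x. complex_of_real (1 * flat 0 (1 * x $ i + - a $ i)) *
      of_real (1 * flat 0 (-1 * x $ i + b $ i)))" for i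
    by (intro C_k_mult C_k_flat)
  then show ?thesis
    unfolding box_bump_def of_real_prod
    by (intro C_k_prod) (auto simp: algebra_simps)
qed

section \<open>Closure properties of the space of test functions\<close>

lemma test_functionsI:
  assumes "\<And>k. C_k k f" "bounded {x. f x \<noteq> 0}"
  shows "f \<in> test_functions"
  using assms by (auto simp: test_functions_def compact_closure)

lemma test_functionsD:
  assumes "f \<in> test_functions"
  shows "C_k k f" "bounded {x. f x \<noteq> 0}" "continuous_on UNIV f" "\<And>x. f differentiable (at x)"
proof -
  have *: "C_k k f" for k using assms by (simp add: test_functions_def)
  show "C_k k f" by (rule *)
  show "bounded {x. f x \<noteq> 0}"
    using assms by (auto simp: test_functions_def compact_closure)
  show "continuous_on UNIV f" using *[of 0] by simp
  show "f differentiable (at x)" for x using *[of 1] by simp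
qed

lemma test_functions_add:
  assumes "f \<in> test_functions" "g \<in> test_functions"
  shows "(\<lambda>x. f x + g x) \<in> test_functions"
proof (rule test_functionsI)
  show "bounded {x. f x + g x \<noteq> 0}"
    by (rule bounded_subset[where T="{x. f x \<noteq> 0} \<union> {x. g x \<noteq> 0}"])
       (use assms[THEN test_functionsD(2)] in auto)
qed (use assms in \<open>auto intro: C_k_add test_functionsD\<close>)

lemma test_functions_cmult:
  assumes "f \<in> test_functions"
  shows "(\<lambda>x. c * f x) \<in> test_functions"
proof (rule test_functionsI)
  show "bounded {x. c * f x \<noteq> 0}"
    by (rule bounded_subset[OF test_functionsD(2)[OF assms]]) auto
qed (use assms in \<open>auto intro: C_k_mult C_k_const test_functionsD\<close>)

lemma test_functions_0: "(\<lambda>x. 0) \<in> test_functions"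
  by (rule test_functionsI) (auto intro: C_k_const)

lemma box_bump_test_function: "(\<lambda>x. of_real (box_bump a b x)) \<in> test_functions"
proof (rule test_functionsI)
  have "{x. complex_of_real (box_bump a b x) \<noteq> 0} \<subseteq> box a b"
    using box_bump_pos_iff box_bump_nonneg by (force simp: less_le)
  then show "bounded {x. complex_of_real (box_bump a b x) \<noteq> 0}"
    using bounded_box bounded_subset by blast
qed (rule C_k_box_bump)

lemma test_functions_partial:
  fixes f :: "real ^ 'n \<Rightarrow> complex"
  assumes "f \<in> test_functions"
  shows "(\<lambda>x. frechet_derivative f (at x) (axis i 1)) \<in> test_functions"
proof (rule test_functionsI)
  show "C_k k (\<lambda>x. frechet_derivative f (at x) (axis i 1))" for k
    using test_functionsD(1)[OF assms, of "Suc k"] by simp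
  \<comment> \<open>Off the closure of the set where \<open>f\<close> is nonzero, \<open>f\<close>
    vanishes on a whole neighbourhood; a mere zero of \<open>f\<close> would not force the
    derivative to vanish.\<close>
  have "frechet_derivative f (at x) (axis i 1) = 0" if "x \<notin> closure {x. f x \<noteq> 0}" for x
  proof -
    have "((\<lambda>x. 0) has_derivative (\<lambda>v. 0)) (at x)" by simp
    then have "(f has_derivative (\<lambda>v. 0)) (at x)"
      by (rule has_derivative_transform_within_open[where s="- closure {x. f x \<noteq> 0}"])
        (use that closure_subset[of "{x. f x \<noteq> 0}"] in auto)
    then show ?thesis by (simp add: frechet_derivative_unique)
  qed
  then have "{x. frechet_derivative f (at x) (axis i 1) \<noteq> 0} \<subseteq> closure {x. f x \<noteq> 0}"
    by auto
  then show "bounded {x. frechet_derivative f (at x) (axis i 1) \<noteq> 0}"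
    using test_functionsD(2)[OF assms] bounded_closure bounded_subset by blast
qed

lemma test_functions_bounded:
  assumes "f \<in> test_functions"
  obtains B where "\<And>x. norm (f x) \<le> B" "B \<ge> 0"
proof -
  have "compact (f ` closure {x. f x \<noteq> 0})"
    using assms test_functionsD(3)[OF assms]
    by (intro compact_continuous_image) (auto simp: test_functions_def intro: continuous_on_subset)
  then obtain B where B: "\<And>x. x \<in> closure {x. f x \<noteq> 0} \<Longrightarrow> norm (f x) \<le> B"
    using compact_imp_bounded bounded_iff by (metis imageI)
  have "norm (f x) \<le> max B 0" for x
    using B[of x] closure_subset[of "{x. f x \<noteq> 0}"] by (cases "f x = 0") force+
  then show thesis using that by (meson max.cobounded2)
qed

text \<open>An open set is a countable union of open boxes; \<open>1 - (1 - b)\<^sup>N\<close> tends to 1 wherever the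
  bump \<open>b\<close> of one of these boxes is positive.\<close>

lemma open_indicator_limit_test_functions:
  fixes U :: "(real ^ 'n) set"
  assumes "open U"
  obtains f :: "nat \<Rightarrow> real ^ 'n \<Rightarrow> real"
  where "\<And>N. (\<lambda>x. of_real (f N x)) \<in> test_functions" "\<And>N x. 0 \<le> f N x"
    "\<And>N x. f N x \<le> indicator U x" "\<And>x. (\<lambda>N. f N x) \<longlonglongrightarrow> indicator U x"
proof -
  obtain \<D> :: "(real^'n) set set" where D: "countable \<D>" "\<D> \<subseteq> Pow U" "\<And>X. X \<in> \<D> \<Longrightarrow> \<exists>a b. X = box a b" "\<Union>\<D> = U"
    using open_countable_Union_open_box[OF assms] by metis
  \<comment> \<open>The empty box is added so that the enumeration makes sense even for empty
    \<open>U\<close>.\<close>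
  define X where "X = from_nat_into (insert {} \<D>)"
  have rX: "range X = insert {} \<D>" unfolding X_def using D(1) by (intro range_from_nat_into) auto
  have "\<exists>a b. X k = box a b" for k
  proof (cases "X k = {}")
    case True
    then have "X k = box 0 0" by simp
    then show ?thesis by blast
  next
    case False
    then have "X k \<in> \<D>" using rX by blast
    then show ?thesis using D(3) by blast
  qed
  then obtain a b where ab: "\<And>k. X k = box (a k) (b k)" by metis
  have UX: "(\<Union>k. box (a k) (b k)) = U" using rX D(4) ab by auto
  define h where "h k x = box_bump (a k) (b k) x" for k x
  have h01: "0 \<le> h k x" "h k x \<le> 1" for k x
    by (auto simp: h_def box_bump_nonneg box_bump_le_1)
  have h0: "h k x = 0 \<longleftrightarrow> x \<notin> box (a k) (b k)" for k x
    using box_bump_pos_iff[of "a k" "b k" x] h01(1)[of k x] unfolding h_def by linarith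
  \<comment> \<open>\<open>N\<close> is both the number of boxes and the exponent, so a single limit
    exhausts the boxes and drives every positive bump value to 1.\<close>
  define f where "f N x = 1 - (\<Prod>k<N. (1 - h k x) ^ N)" for N x
  have p01: "0 \<le> (\<Prod>k<N. (1 - h k x) ^ N)" "(\<Prod>k<N. (1 - h k x) ^ N) \<le> 1" for N x
    using h01 by (auto intro!: prod_nonneg prod_le_1 power_le_one)
  have out: "f N x = 0" if "\<And>k. k < N \<Longrightarrow> x \<notin> box (a k) (b k)" for N x
  proof -
    have "\<And>k. k < N \<Longrightarrow> h k x = 0" using that h0 by blast
    then show ?thesis by (simp add: f_def)
  qed
  show thesis
  proof (rule that[of f])
    fix N
    show "(\<lambda>x. complex_of_real (f N x)) \<in> test_functions"
    proof (rule test_functionsI)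
      fix k
      have e: "complex_of_real (f N x) =
          1 + (-1) * (\<Prod>i<N. (\<Prod>l<N. (1 + (-1) * complex_of_real (h i x))))" for x
        by (simp add: f_def)
      show "C_k k (\<lambda>x. complex_of_real (f N x))"
        unfolding e by (intro C_k_add C_k_mult C_k_const C_k_prod finite_lessThan)
          (auto simp: h_def C_k_box_bump)
    next
      have "{x. complex_of_real (f N x) \<noteq> 0} \<subseteq> (\<Union>k<N. box (a k) (b k))"
        using out by (auto simp: lessThan_iff)
      then show "bounded {x. complex_of_real (f N x) \<noteq> 0}"
        by (rule bounded_subset[rotated]) auto
    qed
  next
    fix N x
    show "0 \<le> f N x" using p01(2)[where N=N and x=x] by (simp add: f_def)
    show "f N x \<le> indicator U x"
    proof (cases "x \<in> U")
      case True
      then show ?thesis using p01(1)[where N=N and x=x] by (simp add: f_def)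
    next
      case False
      then show ?thesis using out[of N x] UX by auto
    qed
  next
    fix x
    show "(\<lambda>N. f N x) \<longlonglongrightarrow> indicator U x"
    proof (cases "x \<in> U")
      case False
      then have "f N x = 0" for N using out[of N x] UX by auto
      then show ?thesis using False by simp
    next
      case True
      then obtain k where k: "x \<in> box (a k) (b k)" using UX by blast
      then have "h k x > 0" using h0 h01(1)[of k x] by (metis less_le)
      then have lim: "(\<lambda>N. (1 - h k x) ^ N) \<longlonglongrightarrow> 0"
        using h01(2)[of k x] by (intro LIMSEQ_realpow_zero) auto
      have le: "(\<Prod>i<N. (1 - h i x) ^ N) \<le> (1 - h k x) ^ N" if "k < N" for N
      proof -
        have "(\<Prod>i<N. (1 - h i x) ^ N) = (1 - h k x) ^ N * (\<Prod>i\<in>{..<N}-{k}. (1 - h i x) ^ N)"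
          using that by (subst prod.remove[of _ k]) auto
        also have "\<dots> \<le> (1 - h k x) ^ N * 1"
          using h01 by (intro mult_left_mono prod_le_1) (auto intro!: power_le_one)
        finally show ?thesis by simp
      qed
      have "(\<lambda>N. (\<Prod>i<N. (1 - h i x) ^ N)) \<longlonglongrightarrow> 0"
      proof (rule tendsto_sandwich[OF _ _ tendsto_const lim])
        show "\<forall>\<^sub>F N in sequentially. 0 \<le> (\<Prod>i<N. (1 - h i x) ^ N)"
          using p01(1) by simp
        show "\<forall>\<^sub>F N in sequentially. (\<Prod>i<N. (1 - h i x) ^ N) \<le> (1 - h k x) ^ N"
          using le by (rule eventually_mono[OF eventually_gt_at_top[of k]])
      qed
      from tendsto_diff[OF tendsto_const[of 1] this] show ?thesis
        using True by (simp add: f_def[abs_def])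
    qed
  qed
qed

section \<open>Density of test functions and extension of operators\<close>

text \<open>The p-th power of the norm, with the root omitted, which makes it compatible with
  pointwise estimates of \<open>norm (f x) powr p\<close>. The codomain is general so that real and
  complex functions share the lemmas.\<close>

definition pint :: "real \<Rightarrow> (real ^ 'n \<Rightarrow> 'b::real_normed_vector) \<Rightarrow> real" where
  "pint p f = (LINT x|lebesgue. norm (f x) powr p)"

definition pintegrable ::
    "real \<Rightarrow> (real ^ 'n \<Rightarrow> 'b::{real_normed_vector, second_countable_topology}) \<Rightarrow> bool" where
  "pintegrable p f \<longleftrightarrow> f \<in> borel_measurable lebesgue \<and> integrable lebesgue (\<lambda>x. norm (f x) powr p)"

lemma Lp_iff: "f \<in> Lp p \<longleftrightarrow> pintegrable p f"
  by (simp add: Lp_def pintegrable_def)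

lemma Lp_norm_pint: "Lp_norm p f = pint p f powr (1 / p)"
  by (simp add: Lp_norm_def pint_def)

lemma pint_nonneg: "0 \<le> pint p f"
  by (simp add: pint_def)

lemma pintegrable_of_real:
  "u \<in> borel_measurable lebesgue \<Longrightarrow> pintegrable p (\<lambda>x. complex_of_real (u x)) \<longleftrightarrow> pintegrable p u"
  by (simp add: pintegrable_def)

lemma continuous_borel_measurable_lebesgue:
  fixes f :: "real ^ 'n \<Rightarrow> 'b::topological_space"
  assumes "continuous_on UNIV f"
  shows "f \<in> borel_measurable lebesgue"
  using borel_measurable_continuous_onI[OF assms] by (simp add: measurable_completion)

text \<open>\<open>norm (a + b)\<close> is at most twice the larger of the two norms. The resulting
  inequality plays the part of the triangle inequality for \<open>pint\<close>.\<close>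

lemma norm_add_powr_le:
  fixes a b :: "'b::real_normed_vector"
  assumes "0 \<le> p"
  shows "norm (a + b) powr p \<le> 2 powr p * (norm a powr p + norm b powr p)"
proof -
  have "norm (a + b) \<le> 2 * max (norm a) (norm b)"
    using norm_triangle_ineq[of a b] by linarith
  then have "norm (a + b) powr p \<le> (2 * max (norm a) (norm b)) powr p"
    using assms by (intro powr_mono2) auto
  also have "\<dots> = 2 powr p * max (norm a) (norm b) powr p"
    by (simp add: powr_mult)
  also have "max (norm a) (norm b) powr p \<le> norm a powr p + norm b powr p"
    by (cases "norm a \<le> norm b") (auto simp: max_def)
  finally show ?thesis by simp
qed

lemma pintegrable_bound:
  assumes "pintegrable p g" "f \<in> borel_measurable lebesgue" "\<And>x. norm (f x) \<le> norm (g x)" "0 \<le> p"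
  shows "pintegrable p f"
  unfolding pintegrable_def
proof (intro conjI assms(2))
  show "integrable lebesgue (\<lambda>x. norm (f x) powr p)"
  proof (rule Bochner_Integration.integrable_bound)
    show "integrable lebesgue (\<lambda>x. norm (g x) powr p)"
      using assms(1) by (simp add: pintegrable_def)
    show "(\<lambda>x. norm (f x) powr p) \<in> borel_measurable lebesgue"
      using assms(2) by measurable
    show "AE x in lebesgue. norm (norm (f x) powr p) \<le> norm (norm (g x) powr p)"
      using assms(3,4) by (auto intro!: powr_mono2)
  qed
qed

lemma pintegrable_add:
  assumes "pintegrable p f" "pintegrable p g" "0 \<le> p"
  shows "pintegrable p (\<lambda>x. f x + g x)"
  unfolding pintegrable_def
proof
  show [measurable]: "(\<lambda>x. f x + g x) \<in> borel_measurable lebesgue"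
    using assms(1,2) by (auto simp: pintegrable_def)
  show "integrable lebesgue (\<lambda>x. norm (f x + g x) powr p)"
  proof (rule Bochner_Integration.integrable_bound)
    show "integrable lebesgue (\<lambda>x. 2 powr p * (norm (f x) powr p + norm (g x) powr p))"
      using assms(1,2) by (auto simp: pintegrable_def)
    show "(\<lambda>x. norm (f x + g x) powr p) \<in> borel_measurable lebesgue"
      by measurable
    show "AE x in lebesgue. norm (norm (f x + g x) powr p)
        \<le> norm (2 powr p * (norm (f x) powr p + norm (g x) powr p))"
      using norm_add_powr_le[OF assms(3)] by (auto simp: abs_of_nonneg)
  qed
qed

lemma pintegrable_cmult:
  fixes f :: "real ^ 'n \<Rightarrow> 'b::{real_normed_algebra_1, real_normed_div_algebra, second_countable_topology}"
  assumes "pintegrable p f"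
  shows "pintegrable p (\<lambda>x. c * f x)"
  using assms by (auto simp: pintegrable_def norm_mult powr_mult)

lemma pint_cmult:
  fixes f :: "real ^ 'n \<Rightarrow> 'b::real_normed_div_algebra"
  shows "pint p (\<lambda>x. c * f x) = norm c powr p * pint p f"
  by (auto simp: pint_def norm_mult powr_mult)

lemma pintegrable_diff:
  assumes "pintegrable p f" "pintegrable p g" "0 \<le> p"
  shows "pintegrable p (\<lambda>x. f x - g x)"
proof -
  have "pintegrable p (\<lambda>x. - g x)"
    using assms(2) by (simp add: pintegrable_def)
  from pintegrable_add[OF assms(1) this assms(3)] show ?thesis by simp
qed

lemma pint_add_le:
  fixes f g :: "real ^ 'n \<Rightarrow> 'b::{real_normed_vector, second_countable_topology}"
  assumes "pintegrable p f" "pintegrable p g" "0 \<le> p"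
  shows "pint p (\<lambda>x. f x + g x) \<le> 2 powr p * (pint p f + pint p g)"
proof -
  have "pint p (\<lambda>x. f x + g x) \<le> (LINT x|lebesgue. 2 powr p * (norm (f x) powr p + norm (g x) powr p))"
    unfolding pint_def
    using norm_add_powr_le[OF assms(3)] pintegrable_add[OF assms] assms(1,2)
    by (intro integral_mono) (auto simp: pintegrable_def)
  also have "\<dots> = 2 powr p * (pint p f + pint p g)"
    unfolding pint_def using assms(1,2)
    by (subst integral_mult_right_zero, subst Bochner_Integration.integral_add) (auto simp: pintegrable_def)
  finally show ?thesis .
qed

lemma pint_diff_commute: "pint p (\<lambda>x. f x - g x) = pint p (\<lambda>x. g x - f x)"
  by (simp add: pint_def norm_minus_commute)

lemma pint_triangle:
  fixes f g :: "real ^ 'n \<Rightarrow> 'b::{real_normed_vector, second_countable_topology}"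
  assumes "pintegrable p f" "pintegrable p g" "pintegrable p h" "0 \<le> p"
  shows "pint p (\<lambda>x. f x - h x) \<le> 2 powr p * (pint p (\<lambda>x. f x - g x) + pint p (\<lambda>x. g x - h x))"
  using pint_add_le[OF pintegrable_diff[OF assms(1,2,4)] pintegrable_diff[OF assms(2,3,4)] assms(4)]
  by simp

text \<open>The third hypothesis makes \<open>norm (f x) powr p\<close> itself the dominating
  function; it holds in particular when \<open>0 \<le> u i \<le> f\<close>.\<close>

lemma pint_dominated_tendsto:
  fixes f :: "real ^ 'n \<Rightarrow> 'b::{real_normed_vector, second_countable_topology}"
  assumes "pintegrable p f" "\<And>i. u i \<in> borel_measurable lebesgue"
    "\<And>i x. norm (f x - u i x) \<le> norm (f x)" "\<And>x. (\<lambda>i. u i x) \<longlonglongrightarrow> f x" "0 < p"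
  shows "(\<lambda>i. pint p (\<lambda>x. f x - u i x)) \<longlonglongrightarrow> 0"
proof -
  have fm [measurable]: "f \<in> borel_measurable lebesgue"
    using assms(1) by (simp add: pintegrable_def)
  note assms(2) [measurable]
  have "(\<lambda>i. LINT x|lebesgue. norm (f x - u i x) powr p) \<longlonglongrightarrow> integral\<^sup>L lebesgue (\<lambda>x::real^'n. 0::real)"
  proof (rule integral_dominated_convergence[where w="\<lambda>x. norm (f x) powr p"])
    show "integrable lebesgue (\<lambda>x. norm (f x) powr p)"
      using assms(1) by (simp add: pintegrable_def)
    show "AE x in lebesgue. (\<lambda>i. norm (f x - u i x) powr p) \<longlonglongrightarrow> 0"
    proof (rule AE_I2)
      fix x
      have "(\<lambda>i. norm (f x - u i x)) \<longlonglongrightarrow> 0"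
        using tendsto_norm[OF tendsto_diff[OF tendsto_const assms(4)[of x]], of "f x"] by simp
      then show "(\<lambda>i. norm (f x - u i x) powr p) \<longlonglongrightarrow> 0"
        using assms(5) by (intro tendsto_zero_powrI[where b=p]) auto
    qed
    show "AE x in lebesgue. norm (norm (f x - u i x) powr p) \<le> norm (f x) powr p" for i
      using assms(3,5) by (auto intro!: powr_mono2)
  qed auto
  then show ?thesis by (simp add: pint_def)
qed

section \<open>Approximation of p-integrable functions by test functions\<close>

lemma pintegrable_test_function:
  fixes f :: "real ^ 'n \<Rightarrow> complex"
  assumes "f \<in> test_functions" "0 < p"
  shows "pintegrable p f"
  unfolding pintegrable_def
proof
  show [measurable]: "f \<in> borel_measurable lebesgue"
    using test_functionsD(3)[OF assms(1)] by (rule continuous_borel_measurable_lebesgue)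
  obtain B where B: "\<And>x. norm (f x) \<le> B" using test_functions_bounded[OF assms(1)] by metis
  obtain R where R: "{x. f x \<noteq> 0} \<subseteq> cball 0 R"
    using test_functionsD(2)[OF assms(1)] bounded_subset_ballD ball_subset_cball by (meson order_trans)
  show "integrable lebesgue (\<lambda>x. norm (f x) powr p)"
  proof (rule Bochner_Integration.integrable_bound)
    have "cball (0::real^'n) R \<in> lmeasurable" by simp
    then show "integrable lebesgue (\<lambda>x::real^'n. B powr p * indicator (cball 0 R) x)"
      by (intro integrable_mult_right) (simp add: fmeasurable_def integrable_indicator_iff)
    show "AE x in lebesgue. norm (norm (f x) powr p) \<le> norm (B powr p * indicator (cball 0 R) x)"
    proof (rule AE_I2)
      fix x
      show "norm (norm (f x) powr p) \<le> norm (B powr p * indicator (cball 0 R) x)"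
        using B[of x] R assms(2) by (cases "f x = 0") (auto simp: subset_iff intro!: powr_mono2)
    qed
  qed measurable
qed

text \<open>Approximation within the cone of nonnegative test functions: only such approximants
  carry positivity of an operator over to its extension.\<close>

definition test_approx :: "real \<Rightarrow> (real ^ 'n \<Rightarrow> real) \<Rightarrow> bool" where
  "test_approx p u \<longleftrightarrow> (\<forall>e>0. \<exists>\<phi>. (\<lambda>x. of_real (\<phi> x)) \<in> test_functions \<and> (\<forall>x. 0 \<le> \<phi> x) \<and>
     pint p (\<lambda>x. u x - \<phi> x) < e)"

lemma pintegrable_real_test_function:
  assumes "(\<lambda>x. of_real (\<phi> x)) \<in> test_functions" "0 < p"
  shows "pintegrable p \<phi>"
proof -
  have "continuous_on UNIV (\<lambda>x. Re (complex_of_real (\<phi> x)))"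
    by (intro continuous_on_Re test_functionsD(3)[OF assms(1)])
  then have "\<phi> \<in> borel_measurable lebesgue"
    by (intro continuous_borel_measurable_lebesgue) simp
  then show ?thesis
    using pintegrable_test_function[OF assms] by (simp add: pintegrable_of_real)
qed

lemma test_approx_closure:
  assumes "\<And>e. e > 0 \<Longrightarrow> \<exists>v. pintegrable p v \<and> test_approx p v \<and> pint p (\<lambda>x. u x - v x) < e"
    "pintegrable p u" "0 < p"
  shows "test_approx p u"
  unfolding test_approx_def
proof (intro allI impI)
  fix e :: real assume "e > 0"
  \<comment> \<open>Two errors below \<open>d\<close> combine to less than
    \<open>2 powr p * (d + d) = e\<close>.\<close>
  define d where "d = e / 2 powr p / 2"
  have d: "d > 0" using \<open>e > 0\<close> by (simp add: d_def)
  obtain v where v: "pintegrable p v" "test_approx p v" "pint p (\<lambda>x. u x - v x) < d"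
    using assms(1)[OF d] by blast
  obtain \<phi> where \<phi>: "(\<lambda>x. of_real (\<phi> x)) \<in> test_functions" "\<forall>x. 0 \<le> \<phi> x"
     "pint p (\<lambda>x. v x - \<phi> x) < d"
    using v(2) d unfolding test_approx_def by blast
  have "pint p (\<lambda>x. u x - \<phi> x) \<le> 2 powr p * (pint p (\<lambda>x. u x - v x) + pint p (\<lambda>x. v x - \<phi> x))"
    using assms(2,3) v(1) pintegrable_real_test_function[OF \<phi>(1)] by (intro pint_triangle) auto
  also have "\<dots> < 2 powr p * (d + d)"
    using v(3) \<phi>(3) by (intro mult_strict_left_mono) auto
  also have "\<dots> = e" by (simp add: d_def)
  finally show "\<exists>\<phi>. (\<lambda>x. of_real (\<phi> x)) \<in> test_functions \<and> (\<forall>x. 0 \<le> \<phi> x) \<and>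
     pint p (\<lambda>x. u x - \<phi> x) < e" using \<phi> by blast
qed

lemma test_approx_indicator_open:
  assumes "open U" "pintegrable p (indicator U :: _ \<Rightarrow> real)" "0 < p"
  shows "test_approx p (indicator U)"
  unfolding test_approx_def
proof (intro allI impI)
  fix e :: real assume "e > 0"
  obtain f where f: "\<And>N. (\<lambda>x. complex_of_real (f N x)) \<in> test_functions" "\<And>N x. 0 \<le> f N x"
    "\<And>N x. f N x \<le> indicator U x" "\<And>x. (\<lambda>N. f N x) \<longlonglongrightarrow> indicator U x"
    using open_indicator_limit_test_functions[OF assms(1)] by blast
  have "(\<lambda>N. pint p (\<lambda>x. indicator U x - f N x)) \<longlonglongrightarrow> 0"
  proof (rule pint_dominated_tendsto[OF assms(2)])
    show "f i \<in> borel_measurable lebesgue" for i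
      using pintegrable_real_test_function[OF f(1) assms(3)] by (simp add: pintegrable_def)
    show "norm (indicator U x - f i x) \<le> norm (indicator U x :: real)" for i x
      using f(2,3)[of i x] by auto
  qed (use f(4) assms(3) in auto)
  then have "\<forall>\<^sub>F N in sequentially. pint p (\<lambda>x. indicator U x - f N x) < e"
    using \<open>e > 0\<close> by (rule order_tendstoD(2))
  then obtain N where "pint p (\<lambda>x. indicator U x - f N x) < e"
    by (meson eventually_happens trivial_limit_sequentially)
  then show "\<exists>\<phi>. (\<lambda>x. of_real (\<phi> x)) \<in> test_functions \<and> (\<forall>x. 0 \<le> \<phi> x) \<and>
     pint p (\<lambda>x. indicator U x - \<phi> x) < e"
    using f(1,2) by blast
qed

lemma pint_indicator: "0 < p \<Longrightarrow> pint p (indicator A :: _ \<Rightarrow> real) = measure lebesgue (A::(real^'n) set)"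
proof -
  assume "0 < p"
  then have "norm (indicator A x :: real) powr p = indicator A x" for x
    by (auto simp: indicator_def)
  then show ?thesis by (simp add: pint_def)
qed

lemma pintegrable_indicator_iff:
  assumes "0 < p" "A \<in> sets lebesgue"
  shows "pintegrable p (indicator A :: _ \<Rightarrow> real) \<longleftrightarrow> A \<in> lmeasurable"
proof -
  have "norm (indicator A x :: real) powr p = indicator A x" for x
    using assms(1) by (auto simp: indicator_def)
  then show ?thesis
    using assms(2) by (simp add: pintegrable_def fmeasurable_def integrable_indicator_iff)
qed

text \<open>Outer regularity: for an open \<open>U\<close> around \<open>A\<close> the two
  indicators differ by that of \<open>U - A\<close>, so the error is the measure of
  \<open>U - A\<close>, independently of p.\<close>

lemma test_approx_indicator:
  assumes "A \<in> lmeasurable" "0 < p"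
  shows "test_approx p (indicator A)"
proof (rule test_approx_closure)
  fix e :: real assume "e > 0"
  obtain U where U: "open U" "A \<subseteq> U" "U - A \<in> lmeasurable" "emeasure lebesgue (U - A) < ennreal e"
    by (rule sets_lebesgue_outer_open[OF fmeasurableD[OF assms(1)] \<open>e > 0\<close>])
  have Um: "U \<in> lmeasurable"
    using fmeasurable.Un[OF assms(1) U(3)] U(2) by (simp add: Un_absorb1)
  have pU: "pintegrable p (indicator U :: _ \<Rightarrow> real)"
    using Um assms(2) by (simp add: pintegrable_indicator_iff fmeasurableD)
  have "(\<lambda>x. indicator A x - indicator U x :: real) = (\<lambda>x. - indicator (U - A) x)"
    using U(2) by (auto simp: indicator_def fun_eq_iff)
  then have "pint p (\<lambda>x. indicator A x - indicator U x :: real) = pint p (indicator (U - A) :: _ \<Rightarrow> real)"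
    by (simp add: pint_def)
  also have "\<dots> < e"
    using U(4) emeasure_eq_measure2[OF U(3)] pint_indicator[OF assms(2), of "U - A"] \<open>e > 0\<close>
    by (metis ennreal_less_iff measure_nonneg)
  finally show "\<exists>v. pintegrable p v \<and> test_approx p v \<and> pint p (\<lambda>x. indicator A x - v x) < e"
    using pU test_approx_indicator_open[OF U(1) pU assms(2)] by blast
qed (use assms in \<open>simp_all add: pintegrable_indicator_iff fmeasurableD\<close>)

lemma test_approx_nonneg:
  fixes u :: "real ^ 'n \<Rightarrow> real"
  assumes "u \<in> borel_measurable lebesgue" "\<And>x. 0 \<le> u x" "pintegrable p u" "0 < p"
  shows "test_approx p u"
  using assms(1-3)
proof (induction rule: borel_measurable_induct_real)
  case (set A)
  then show ?case using assms(4) by (simp add: test_approx_indicator pintegrable_indicator_iff)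
next
  case (mult u c)
  show ?case
  proof (cases "c = 0")
    case True
    then show ?thesis
      unfolding test_approx_def using test_functions_0
      by (auto simp: pint_def intro!: exI[of _ "\<lambda>x. 0"])
  next
    case False
    then have c: "c > 0" using mult by simp
    have "pintegrable p u"
      using pintegrable_cmult[OF mult.prems, of "inverse c"] c by (simp add: mult.assoc[symmetric])
    then have u: "test_approx p u" using mult.IH by blast
    show ?thesis
      unfolding test_approx_def
    proof (intro allI impI)
      fix e :: real assume "e > 0"
      then have "e / c powr p > 0" using c by simp
      then obtain \<phi> where \<phi>: "(\<lambda>x. of_real (\<phi> x)) \<in> test_functions" "\<forall>x. 0 \<le> \<phi> x"
         "pint p (\<lambda>x. u x - \<phi> x) < e / c powr p"
        using u unfolding test_approx_def by blast
      have "pint p (\<lambda>x. c * u x - c * \<phi> x) = c powr p * pint p (\<lambda>x. u x - \<phi> x)"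
        using pint_cmult[of p c "\<lambda>x. u x - \<phi> x"] c by (simp add: algebra_simps)
      also have "\<dots> < e" using \<phi>(3) c by (simp add: field_simps)
      finally show "\<exists>\<phi>. (\<lambda>x. of_real (\<phi> x)) \<in> test_functions \<and> (\<forall>x. 0 \<le> \<phi> x) \<and>
          pint p (\<lambda>x. c * u x - \<phi> x) < e"
        using test_functions_cmult[OF \<phi>(1), of "of_real c"] \<phi>(2) c
        by (intro exI[of _ "\<lambda>x. c * \<phi> x"]) auto
    qed
  qed
next
  case (add u v)
  \<comment> \<open>Both summands are nonnegative and therefore dominated by the sum, from which
    they inherit integrability.\<close>
  have pu: "pintegrable p u" "pintegrable p v"
    using add assms(4) by (auto intro!: pintegrable_bound[OF add.prems])
  then have u: "test_approx p u" "test_approx p v" using add by blast+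
  show ?case
    unfolding test_approx_def
  proof (intro allI impI)
    fix e :: real assume "e > 0"
    define d where "d = e / 2 powr p / 2"
    have d: "d > 0" using \<open>e > 0\<close> by (simp add: d_def)
    obtain \<phi> where \<phi>: "(\<lambda>x. of_real (\<phi> x)) \<in> test_functions" "\<forall>x. 0 \<le> \<phi> x"
       "pint p (\<lambda>x. u x - \<phi> x) < d"
      using u(1) d unfolding test_approx_def by blast
    obtain \<psi> where \<psi>: "(\<lambda>x. of_real (\<psi> x)) \<in> test_functions" "\<forall>x. 0 \<le> \<psi> x"
       "pint p (\<lambda>x. v x - \<psi> x) < d"
      using u(2) d unfolding test_approx_def by blast
    have "pint p (\<lambda>x. (v x - \<psi> x) + (u x - \<phi> x))
        \<le> 2 powr p * (pint p (\<lambda>x. v x - \<psi> x) + pint p (\<lambda>x. u x - \<phi> x))"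
      using assms(4) pu pintegrable_real_test_function[OF \<phi>(1)] pintegrable_real_test_function[OF \<psi>(1)]
      by (intro pint_add_le pintegrable_diff) auto
    also have "\<dots> < 2 powr p * (d + d)"
      using \<psi>(3) \<phi>(3) by (intro mult_strict_left_mono) auto
    also have "\<dots> = e" by (simp add: d_def)
    finally have "pint p (\<lambda>x. (v x + u x) - (\<psi> x + \<phi> x)) < e"
      by (simp add: algebra_simps)
    then show "\<exists>\<phi>. (\<lambda>x. of_real (\<phi> x)) \<in> test_functions \<and> (\<forall>x. 0 \<le> \<phi> x) \<and>
        pint p (\<lambda>x. v x + u x - \<phi> x) < e"
      using test_functions_add[OF \<psi>(1) \<phi>(1)] \<phi>(2) \<psi>(2)
      by (intro exI[of _ "\<lambda>x. \<psi> x + \<phi> x"]) auto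
  qed
next
  case (seq U)
  have lim: "\<And>x. (\<lambda>i. U i x) \<longlonglongrightarrow> u x" using seq.hyps by simp
  have le: "U i x \<le> u x" for i x
    using \<open>incseq U\<close> lim[of x] by (intro incseq_le) (auto simp: incseq_def le_fun_def)
  have pU: "pintegrable p (U i)" for i
    using le[of i] seq.hyps(1,2) assms(2,4) by (intro pintegrable_bound[OF seq.prems]) (auto intro: order_trans)
  have "(\<lambda>i. pint p (\<lambda>x. u x - U i x)) \<longlonglongrightarrow> 0"
  proof (rule pint_dominated_tendsto[OF seq.prems _ _ lim assms(4)])
    show "U i \<in> borel_measurable lebesgue" for i by (rule seq.hyps)
    show "norm (u x - U i x) \<le> norm (u x)" for i x
      using le[of i x] seq.hyps(2)[of i x] by simp
  qed
  show ?case
  proof (rule test_approx_closure)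
    fix e :: real assume "e > 0"
    then have "\<forall>\<^sub>F i in sequentially. pint p (\<lambda>x. u x - U i x) < e"
      using \<open>(\<lambda>i. pint p (\<lambda>x. u x - U i x)) \<longlonglongrightarrow> 0\<close> by (intro order_tendstoD(2))
    then obtain i where "pint p (\<lambda>x. u x - U i x) < e"
      by (meson eventually_happens trivial_limit_sequentially)
    then show "\<exists>v. pintegrable p v \<and> test_approx p v \<and> pint p (\<lambda>x. u x - v x) < e"
      using pU seq.IH by blast
  qed (use seq.prems assms(4) in auto)
qed

lemma Lp_approx_test_function_nonneg:
  fixes f :: "real ^ 'n \<Rightarrow> complex"
  assumes "f \<in> Lp p" "AE x in lebesgue. f x \<in> \<real>\<^sub>\<ge>\<^sub>0" "0 < p" "0 < e"
  obtains \<phi> where "\<phi> \<in> test_functions" "\<And>x. \<phi> x \<in> \<real>\<^sub>\<ge>\<^sub>0" "pint p (\<lambda>x. f x - \<phi> x) < e"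
proof -
  \<comment> \<open>\<open>f\<close> is nonnegative only almost everywhere; \<open>u\<close> agrees
    with it there and is nonnegative everywhere.\<close>
  define u where "u x = max 0 (Re (f x))" for x
  have fm [measurable]: "f \<in> borel_measurable lebesgue" and pf: "pintegrable p f"
    using assms(1) by (auto simp: Lp_iff pintegrable_def)
  have um [measurable]: "u \<in> borel_measurable lebesgue" unfolding u_def by measurable
  have pu: "pintegrable p u"
    using assms(3) complex_Re_le_cmod by (intro pintegrable_bound[OF pf um]) (auto simp: u_def max_def)
  obtain \<phi> where \<phi>: "(\<lambda>x. of_real (\<phi> x)) \<in> test_functions" "\<forall>x. 0 \<le> \<phi> x"
    "pint p (\<lambda>x. u x - \<phi> x) < e"
    using test_approx_nonneg[OF um _ pu assms(3)] assms(4) unfolding test_approx_def u_def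
    by (metis max.cobounded1)
  have [measurable]: "\<phi> \<in> borel_measurable lebesgue"
    using pintegrable_real_test_function[OF \<phi>(1) assms(3)] by (simp add: pintegrable_def)
  have "pint p (\<lambda>x. f x - complex_of_real (\<phi> x)) = pint p (\<lambda>x. u x - \<phi> x)"
    unfolding pint_def
  proof (rule integral_cong_AE)
    show "AE x in lebesgue. norm (f x - complex_of_real (\<phi> x)) powr p = norm (u x - \<phi> x) powr p"
      using assms(2)
    proof eventually_elim
      case (elim x)
      then have "f x = of_real (u x)"
        by (auto simp: u_def nonneg_Reals_def)
      then show ?case by (simp flip: of_real_diff)
    qed
  qed measurable
  then show thesis using \<phi> that by (metis nonneg_Reals_of_real_iff)
qed

lemma Lp_approx_test_function:
  fixes f :: "real ^ 'n \<Rightarrow> complex"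
  assumes "f \<in> Lp p" "0 < p" "0 < e"
  obtains \<phi> where "\<phi> \<in> test_functions" "pint p (\<lambda>x. f x - \<phi> x) < e"
proof -
  have fm [measurable]: "f \<in> borel_measurable lebesgue" and pf: "pintegrable p f"
    using assms(1) by (auto simp: Lp_iff pintegrable_def)
  define A where "A g \<longleftrightarrow> (\<forall>e>0. \<exists>\<phi>\<in>test_functions. pint p (\<lambda>x. g x - \<phi> x) < e)" for g :: "real^'n \<Rightarrow> complex"
  \<comment> \<open>Coefficients of modulus one are enough: -1, \<i> and -\<i> assemble a complex
    function from the positive and negative parts of its real and imaginary parts, and they leave
    \<open>pint\<close> unchanged.\<close>
  have Aadd: "A (\<lambda>x. g x + c * h x)"
    if g: "A g" "A h" "pintegrable p g" "pintegrable p h" and c: "norm c = 1" for g h c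
    unfolding A_def
  proof (intro allI impI)
    fix e :: real assume "e > 0"
    define d where "d = e / 2 powr p / 2"
    have d: "d > 0" using \<open>e > 0\<close> by (simp add: d_def)
    obtain \<phi> \<psi> where \<phi>: "\<phi> \<in> test_functions" "pint p (\<lambda>x. g x - \<phi> x) < d"
      and \<psi>: "\<psi> \<in> test_functions" "pint p (\<lambda>x. h x - \<psi> x) < d"
      using g d unfolding A_def by blast
    have "pint p (\<lambda>x. (g x - \<phi> x) + c * (h x - \<psi> x))
        \<le> 2 powr p * (pint p (\<lambda>x. g x - \<phi> x) + pint p (\<lambda>x. c * (h x - \<psi> x)))"
      using assms(2) g pintegrable_test_function[OF \<phi>(1)] pintegrable_test_function[OF \<psi>(1)]
      by (intro pint_add_le pintegrable_diff pintegrable_cmult) auto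
    also have "\<dots> = 2 powr p * (pint p (\<lambda>x. g x - \<phi> x) + pint p (\<lambda>x. h x - \<psi> x))"
      by (subst pint_cmult) (simp add: c)
    also have "\<dots> < 2 powr p * (d + d)"
      using \<psi>(2) \<phi>(2) by (intro mult_strict_left_mono) auto
    also have "\<dots> = e" by (simp add: d_def)
    finally have "pint p (\<lambda>x. (g x + c * h x) - (\<phi> x + c * \<psi> x)) < e"
      by (simp add: algebra_simps)
    then show "\<exists>\<phi>\<in>test_functions. pint p (\<lambda>x. g x + c * h x - \<phi> x) < e"
      using test_functions_add[OF \<phi>(1) test_functions_cmult[OF \<psi>(1), of c]] by (intro bexI)
  qed
  define P where "P v x = complex_of_real (max 0 (v x))" for v :: "real^'n \<Rightarrow> real" and x
  have pP: "pintegrable p (P v)" and AP: "A (P v)"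
    if [measurable]: "v \<in> borel_measurable lebesgue" and le: "\<And>x. \<bar>v x\<bar> \<le> norm (f x)" for v
  proof -
    have [measurable]: "P v \<in> borel_measurable lebesgue" unfolding P_def by measurable
    show "pintegrable p (P v)"
      using assms(2) le by (intro pintegrable_bound[OF pf]) (auto simp: P_def max_def abs_le_iff intro: order_trans)
    then have L: "P v \<in> Lp p" by (simp add: Lp_iff)
    have "\<exists>\<phi>\<in>test_functions. pint p (\<lambda>x. P v x - \<phi> x) < e" if "e > 0" for e
      using Lp_approx_test_function_nonneg[OF L _ assms(2) that] by (auto simp: P_def)
    then show "A (P v)" by (auto simp: A_def)
  qed
  have dec: "f = (\<lambda>x. ((P (\<lambda>x. Re (f x)) x + (-1) * P (\<lambda>x. - Re (f x)) x) + \<i> * P (\<lambda>x. Im (f x)) x)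
      + (-\<i>) * P (\<lambda>x. - Im (f x)) x)"
    by (auto simp: P_def complex_eq_iff max_def)
  have "A f"
    apply (subst dec)
    by (intro Aadd pintegrable_add pintegrable_cmult pP AP)
       (use assms(2) in \<open>auto simp: abs_Re_le_cmod abs_Im_le_cmod\<close>)
  then show thesis using that assms(3) by (auto simp: A_def)
qed

section \<open>Completeness for p-th power integrals\<close>

lemma geometric_increments_convergent:
  fixes g :: "nat \<Rightarrow> 'b::banach"
  assumes "\<And>k. norm (g (Suc k) - g k) \<le> (1/2) ^ k * A"
  shows "convergent g" "norm (lim g - g k) \<le> 2 * (1/2) ^ k * A"
proof -
  have "summable (\<lambda>k. g (Suc k) - g k)"
  proof (rule summable_comparison_test)
    show "\<exists>N. \<forall>n\<ge>N. norm (g (Suc n) - g n) \<le> (1/2) ^ n * A" using assms by blast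
    show "summable (\<lambda>n. (1/2) ^ n * A)" by (intro summable_mult2 summable_geometric) auto
  qed
  then have "(\<lambda>n. (\<Sum>k<n. g (Suc k) - g k) + g 0) \<longlonglongrightarrow> (\<Sum>k. g (Suc k) - g k) + g 0"
    by (intro tendsto_add tendsto_const summable_LIMSEQ)
  then have "g \<longlonglongrightarrow> (\<Sum>k. g (Suc k) - g k) + g 0"
    by (simp add: sum_lessThan_telescope)
  then show "convergent g" by (auto simp: convergent_def)
  then have lim: "(\<lambda>m. g (m + k)) \<longlonglongrightarrow> lim g"
    by (intro LIMSEQ_ignore_initial_segment) (simp add: convergent_LIMSEQ_iff)
  have A0: "0 \<le> A" using order_trans[OF norm_ge_zero assms[of 0]] by simp
  \<comment> \<open>The bracket is the exact value of the partial geometric sum, which lets the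
    induction close; the subtracted term is dropped afterwards.\<close>
  have "norm (g (m + k) - g k) \<le> (2 * (1/2) ^ k - 2 * (1/2) ^ (m + k)) * A" for m
  proof (induction m)
    case (Suc m)
    have "norm (g (Suc m + k) - g k) \<le> norm (g (Suc (m + k)) - g (m + k)) + norm (g (m + k) - g k)"
      using norm_triangle_ineq[of "g (Suc (m + k)) - g (m + k)" "g (m + k) - g k"] by simp
    also have "\<dots> \<le> (1/2) ^ (m + k) * A + (2 * (1/2) ^ k - 2 * (1/2) ^ (m + k)) * A"
      using assms[of "m + k"] Suc by (intro add_mono)
    also have "\<dots> = (2 * (1/2) ^ k - 2 * (1/2) ^ (Suc m + k)) * A"
      by (simp add: algebra_simps)
    finally show ?case .
  qed simp
  also have "(2 * (1/2) ^ k - 2 * (1/2) ^ (m + k)) * A \<le> 2 * (1/2) ^ k * A" for m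
    using A0 by (intro mult_right_mono) auto
  finally have le: "norm (g (m + k) - g k) \<le> 2 * (1/2) ^ k * A" for m .
  show "norm (lim g - g k) \<le> 2 * (1/2) ^ k * A"
    using tendsto_norm[OF tendsto_diff[OF lim tendsto_const[of "g k"]]] le
    by (intro tendsto_upperbound[where F=sequentially]) auto
qed

lemma pint_eq_0_AE:
  fixes f :: "real ^ 'n \<Rightarrow> 'b::{real_normed_vector, second_countable_topology}"
  assumes "pintegrable p f" "pint p f \<le> 0"
  shows "AE x in lebesgue. f x = 0"
proof -
  have "pint p f = 0" using assms(2) pint_nonneg[of p f] by simp
  then have "AE x in lebesgue. norm (f x) powr p = 0"
    using assms(1) by (subst integral_nonneg_eq_0_iff_AE[symmetric]) (auto simp: pint_def pintegrable_def)
  then show ?thesis by simp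
qed

lemma nn_integral_norm_powr:
  "pintegrable p f \<Longrightarrow> (\<integral>\<^sup>+x. ennreal (norm (f x) powr p) \<partial>lebesgue) = ennreal (pint p f)"
  unfolding pint_def pintegrable_def by (intro nn_integral_eq_integral) auto

text \<open>Completeness of the Lebesgue spaces without Minkowski's inequality: rapid decay of the
  increments makes the weighted sum \<open>S\<close> of their p-th powers integrable, and \<open>S\<close> controls
  all increments pointwise.\<close>

lemma pint_complete:
  fixes g :: "nat \<Rightarrow> real ^ 'n \<Rightarrow> complex"
  assumes p: "0 < p" and g: "\<And>k. pintegrable p (g k)"
    and inc: "\<And>k. pint p (\<lambda>x. g (Suc k) x - g k x) \<le> (1/2) ^ k * ((1/2) ^ k) powr p"
  obtains h where "pintegrable p h" "(\<lambda>k. pint p (\<lambda>x. h x - g k x)) \<longlonglongrightarrow> 0"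
proof -
  have gm [measurable]: "g k \<in> borel_measurable lebesgue" for k using g by (auto simp: pintegrable_def)
  \<comment> \<open>The weight cancels the factor \<open>((1/2) ^ k) powr p\<close> of the
    hypothesis and leaves integrals bounded by the summable \<open>(1/2) ^ k\<close>.\<close>
  define d where "d k x = (2 ^ k) powr p * norm (g (Suc k) x - g k x) powr p" for k x
  have d0: "0 \<le> d k x" for k x by (simp add: d_def)
  have dm [measurable]: "d k \<in> borel_measurable lebesgue" for k unfolding d_def by measurable
  define h where "h x = (\<Sum>k. ennreal (d k x))" for x
  have hm [measurable]: "h \<in> borel_measurable lebesgue" unfolding h_def by measurable
  have dint: "(\<integral>\<^sup>+x. ennreal (d k x) \<partial>lebesgue) \<le> ennreal ((1/2) ^ k)" for k
  proof -
    have "(\<integral>\<^sup>+x. ennreal (d k x) \<partial>lebesgue) =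
        ennreal ((2 ^ k) powr p) * (\<integral>\<^sup>+x. ennreal (norm (g (Suc k) x - g k x) powr p) \<partial>lebesgue)"
      unfolding d_def by (subst nn_integral_cmult[symmetric]) (auto simp: ennreal_mult)
    also have "\<dots> = ennreal ((2 ^ k) powr p * pint p (\<lambda>x. g (Suc k) x - g k x))"
      using g p by (subst nn_integral_norm_powr) (auto intro!: pintegrable_diff simp: ennreal_mult pint_nonneg)
    also have "\<dots> \<le> ennreal ((2 ^ k) powr p * ((1/2) ^ k * ((1/2) ^ k) powr p))"
      by (intro ennreal_leI mult_left_mono inc) auto
    also have "(2 ^ k) powr p * ((1/2) ^ k * ((1/2) ^ k) powr p) = (1/2::real) ^ k"
      using powr_mult[of "2^k" "(1/2)^k" p] by (simp flip: power_mult_distrib)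
    finally show ?thesis .
  qed
  have "(\<integral>\<^sup>+x. h x \<partial>lebesgue) = (\<Sum>k. \<integral>\<^sup>+x. ennreal (d k x) \<partial>lebesgue)"
    unfolding h_def by (rule nn_integral_suminf) measurable
  also have "\<dots> \<le> (\<Sum>k. ennreal ((1/2) ^ k))"
    by (intro suminf_le dint) auto
  also have "\<dots> = ennreal (\<Sum>k. (1/2) ^ k)"
    by (intro suminf_ennreal2) auto
  finally have hfin: "(\<integral>\<^sup>+x. h x \<partial>lebesgue) < \<infinity>"
    by (simp add: le_less_trans)
  then have AEh: "AE x in lebesgue. h x \<noteq> \<infinity>"
    by (intro nn_integral_PInf_AE) auto
  \<comment> \<open>On the null set where \<open>h\<close> is infinite, \<open>enn2real\<close>
    returns 0.\<close>
  define S where "S x = enn2real (h x)" for x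
  have S0: "0 \<le> S x" for x by (simp add: S_def)
  have Sm [measurable]: "S \<in> borel_measurable lebesgue" unfolding S_def by measurable
  have Sint: "integrable lebesgue S"
  proof (rule integrableI_nonneg)
    have "(\<integral>\<^sup>+x. ennreal (S x) \<partial>lebesgue) \<le> (\<integral>\<^sup>+x. h x \<partial>lebesgue)"
      by (intro nn_integral_mono) (auto simp: S_def ennreal_enn2real_if)
    then show "(\<integral>\<^sup>+x. ennreal (S x) \<partial>lebesgue) < \<infinity>" using hfin by (rule le_less_trans)
  qed (auto simp: S0)
  \<comment> \<open>\<open>G\<close> is a genuine limit wherever \<open>h\<close> is finite; on the
    remaining null set \<open>lim\<close> may be a meaningless value, which does not affect
    measurability.\<close>
  define G where "G x = lim (\<lambda>k. g k x)" for x
  have Gm [measurable]: "G \<in> borel_measurable lebesgue"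
    unfolding G_def by (rule borel_measurable_lim_metric) measurable
  have key: "AE x in lebesgue. \<forall>k. norm (G x - g k x) powr p \<le> (2 * (1/2) ^ k) powr p * S x"
    using AEh
  proof eventually_elim
    case (elim x)
    have dS: "d k x \<le> S x" for k
    proof -
      have "ennreal (d k x) \<le> h x"
        unfolding h_def using sum_le_suminf[of "\<lambda>k. ennreal (d k x)" "{k}"] by simp
      then show ?thesis using elim by (metis S_def d0 enn2real_ennreal enn2real_mono infinity_ennreal_def less_top)
    qed
    \<comment> \<open>Each weighted term is at most the whole sum \<open>S x\<close>. Taking p-th
      roots gives geometrically decreasing increments at this point.\<close>
    have "norm (g (Suc k) x - g k x) \<le> (1/2) ^ k * S x powr (1/p)" for k
    proof -
      have "2 ^ k * norm (g (Suc k) x - g k x) = d k x powr (1/p)"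
        using p by (simp add: d_def powr_mult powr_powr)
      also have "\<dots> \<le> S x powr (1/p)"
        using p dS d0 by (intro powr_mono2) auto
      finally show ?thesis by (simp add: field_simps)
    qed
    from geometric_increments_convergent(2)[OF this]
    have le: "norm (G x - g k x) \<le> 2 * (1/2) ^ k * S x powr (1/p)" for k
      by (simp add: G_def)
    show ?case
    proof
      fix k
      have "norm (G x - g k x) powr p \<le> (2 * (1/2) ^ k * S x powr (1/p)) powr p"
        using le p by (intro powr_mono2) auto
      also have "\<dots> = (2 * (1/2) ^ k) powr p * S x"
        using p S0[of x] by (simp add: powr_mult powr_powr)
      finally show "norm (G x - g k x) powr p \<le> (2 * (1/2) ^ k) powr p * S x" .
    qed
  qed
  have dif: "pintegrable p (\<lambda>x. G x - g k x)" for k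
    unfolding pintegrable_def
  proof
    show "integrable lebesgue (\<lambda>x. norm (G x - g k x) powr p)"
    proof (rule Bochner_Integration.integrable_bound)
      show "integrable lebesgue (\<lambda>x. (2 * (1/2) ^ k) powr p * S x)" using Sint by simp
      show "AE x in lebesgue. norm (norm (G x - g k x) powr p) \<le> norm ((2 * (1/2) ^ k) powr p * S x)"
        using key by eventually_elim (auto simp: S0)
    qed measurable
  qed measurable
  have le: "pint p (\<lambda>x. G x - g k x) \<le> (2 * (1/2) ^ k) powr p * (LINT x|lebesgue. S x)" for k
  proof -
    have "pint p (\<lambda>x. G x - g k x) \<le> (LINT x|lebesgue. (2 * (1/2) ^ k) powr p * S x)"
      unfolding pint_def
    proof (rule integral_mono_AE)
      show "AE x in lebesgue. norm (G x - g k x) powr p \<le> (2 * (1/2) ^ k) powr p * S x"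
        using key by eventually_elim auto
    qed (use dif Sint in \<open>auto simp: pintegrable_def\<close>)
    then show ?thesis by simp
  qed
  have "(\<lambda>k. (2 * (1/2) ^ k) powr p * (LINT x|lebesgue. S x)) \<longlonglongrightarrow> 0"
  proof -
    have "(\<lambda>k. 2 * (1/2) ^ k :: real) \<longlonglongrightarrow> 0"
      by (intro tendsto_mult_right_zero LIMSEQ_realpow_zero) auto
    then have "(\<lambda>k. (2 * (1/2) ^ k :: real) powr p) \<longlonglongrightarrow> 0"
      using p by (intro tendsto_zero_powrI[where b=p]) auto
    then show ?thesis by (rule tendsto_mult_left_zero)
  qed
  from tendsto_sandwich[where f="\<lambda>_. 0" and g="\<lambda>k. pint p (\<lambda>x. G x - g k x)", OF _ _ tendsto_const this] le
  have lim: "(\<lambda>k. pint p (\<lambda>x. G x - g k x)) \<longlonglongrightarrow> 0"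
    by (simp add: pint_nonneg)
  have "pintegrable p (\<lambda>x. (G x - g 0 x) + g 0 x)"
    using dif g p by (intro pintegrable_add) auto
  then show thesis using that lim by simp
qed

text \<open>Abstracts the properties of a scalar multiplier on test functions. Linearity and
  positivity are assumed at every point because the images there are concrete functions; the
  extension satisfies them only almost everywhere.\<close>

locale positive_test_operator =
  fixes T :: "(real ^ 'n \<Rightarrow> complex) \<Rightarrow> real ^ 'n \<Rightarrow> complex" and p M :: real
  assumes p: "0 < p" and M: "0 \<le> M"
    and add: "\<And>f g. f \<in> test_functions \<Longrightarrow> g \<in> test_functions \<Longrightarrow>
        T (\<lambda>x. f x + g x) = (\<lambda>x. T f x + T g x)"
    and cmult: "\<And>c f. f \<in> test_functions \<Longrightarrow> T (\<lambda>x. c * f x) = (\<lambda>x. c * T f x)"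
    and Lp: "\<And>f. f \<in> test_functions \<Longrightarrow> pintegrable p (T f)"
    and bound: "\<And>f. f \<in> test_functions \<Longrightarrow> pint p (T f) \<le> M * pint p f"
    and pos: "\<And>f x. f \<in> test_functions \<Longrightarrow> (\<And>x. f x \<in> \<real>\<^sub>\<ge>\<^sub>0) \<Longrightarrow> T f x \<in> \<real>\<^sub>\<ge>\<^sub>0"
begin

definition converges_to where
  "converges_to \<phi> f g \<longleftrightarrow> (\<forall>k. \<phi> k \<in> test_functions) \<and> pintegrable p f \<and> pintegrable p g \<and>
     (\<lambda>k. pint p (\<lambda>x. f x - \<phi> k x)) \<longlonglongrightarrow> 0 \<and> (\<lambda>k. pint p (\<lambda>x. g x - T (\<phi> k) x)) \<longlonglongrightarrow> 0"

text \<open>The closure of the graph of \<open>T\<close> with respect to p-th power convergence in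
  both components. Linearity and the bound are proved for this relation; uniqueness up to null sets
  then makes any choice of image an operator.\<close>

definition graph_closure where
  "graph_closure f g \<longleftrightarrow> (\<exists>\<phi>. converges_to \<phi> f g)"

text \<open>Two errors of this size, multiplied by the triangle factor \<open>2 powr p\<close> and
  by \<open>M + 1\<close>, add up to exactly the increment allowed by \<open>pint_complete\<close>.
  Using \<open>M + 1\<close> keeps the tolerance positive when \<open>M = 0\<close>.\<close>

definition tol :: "nat \<Rightarrow> real" where
  "tol k = (1/2) ^ k * ((1/2) ^ k) powr p / (2 powr p * (M + 1) * 2)"

definition extension where
  "extension f = (SOME g. graph_closure f g)"

lemma test: "f \<in> test_functions \<Longrightarrow> pintegrable p f"
  using p by (rule pintegrable_test_function[rotated])

lemma diff:
  assumes "f \<in> test_functions" "g \<in> test_functions"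
  shows "(\<lambda>x. f x - g x) \<in> test_functions" "T (\<lambda>x. f x - g x) = (\<lambda>x. T f x - T g x)"
  using test_functions_add[OF assms(1) test_functions_cmult[OF assms(2), of "-1"]]
    add[OF assms(1) test_functions_cmult[OF assms(2), of "-1"]] cmult[OF assms(2), of "-1"]
  by simp_all

lemma converges_to_add:
  assumes "converges_to \<phi> f g" "converges_to \<psi> f' g'"
  shows "converges_to (\<lambda>k x. \<phi> k x + \<psi> k x) (\<lambda>x. f x + f' x) (\<lambda>x. g x + g' x)"
proof -
  have lim: "(\<lambda>k. pint p (\<lambda>x. (a x + a' x) - (\<alpha> k x + \<alpha>' k x))) \<longlonglongrightarrow> 0"
    if a: "\<And>k. pintegrable p (\<alpha> k)" "\<And>k. pintegrable p (\<alpha>' k)" "pintegrable p a" "pintegrable p a'"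
      "(\<lambda>k. pint p (\<lambda>x. a x - \<alpha> k x)) \<longlonglongrightarrow> 0" "(\<lambda>k. pint p (\<lambda>x. a' x - \<alpha>' k x)) \<longlonglongrightarrow> 0"
    for a a' :: "real^'n \<Rightarrow> complex" and \<alpha> \<alpha>'
  proof (rule tendsto_sandwich[OF _ _ tendsto_const])
    show "(\<lambda>k. 2 powr p * (pint p (\<lambda>x. a x - \<alpha> k x) + pint p (\<lambda>x. a' x - \<alpha>' k x))) \<longlonglongrightarrow> 0"
      using tendsto_mult_right_zero[OF tendsto_add_zero[OF a(5,6)]] by simp
    have "pint p (\<lambda>x. (a x - \<alpha> k x) + (a' x - \<alpha>' k x)) \<le>
        2 powr p * (pint p (\<lambda>x. a x - \<alpha> k x) + pint p (\<lambda>x. a' x - \<alpha>' k x))" for k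
      using a p by (intro pint_add_le pintegrable_diff) auto
    then show "\<forall>\<^sub>F k in sequentially. pint p (\<lambda>x. (a x + a' x) - (\<alpha> k x + \<alpha>' k x)) \<le>
        2 powr p * (pint p (\<lambda>x. a x - \<alpha> k x) + pint p (\<lambda>x. a' x - \<alpha>' k x))"
      by (simp add: algebra_simps)
  qed (simp add: pint_nonneg)
  show ?thesis
    using assms p
    by (auto simp: converges_to_def add Lp test intro!: lim test_functions_add pintegrable_add)
qed

lemma converges_to_cmult:
  assumes "converges_to \<phi> f g"
  shows "converges_to (\<lambda>k x. c * \<phi> k x) (\<lambda>x. c * f x) (\<lambda>x. c * g x)"
proof -
  have lim: "(\<lambda>k. pint p (\<lambda>x. c * a x - c * \<alpha> k x)) \<longlonglongrightarrow> 0"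
    if "(\<lambda>k. pint p (\<lambda>x. a x - \<alpha> k x)) \<longlonglongrightarrow> 0" for a :: "real^'n \<Rightarrow> complex" and \<alpha>
    using tendsto_mult_right_zero[OF that, of "norm c powr p"]
    by (simp add: pint_cmult flip: right_diff_distrib)
  show ?thesis
    using assms by (auto simp: converges_to_def cmult intro!: lim test_functions_cmult pintegrable_cmult)
qed

lemma graph_closure_add:
  "graph_closure f g \<Longrightarrow> graph_closure f' g' \<Longrightarrow> graph_closure (\<lambda>x. f x + f' x) (\<lambda>x. g x + g' x)"
  unfolding graph_closure_def using converges_to_add by blast

lemma graph_closure_cmult:
  "graph_closure f g \<Longrightarrow> graph_closure (\<lambda>x. c * f x) (\<lambda>x. c * g x)"
  unfolding graph_closure_def using converges_to_cmult by blast

text \<open>Two triangle inequalities, one for \<open>g\<close> around \<open>T (\<phi> k)\<close>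
  and one for \<open>\<phi> k\<close> around \<open>f\<close>, contribute a factor
  \<open>2 powr p\<close> each; the error terms disappear in the limit.\<close>

lemma graph_closure_bound:
  assumes "graph_closure f g"
  shows "pint p g \<le> 2 powr p * (M * (2 powr p * pint p f))"
proof -
  obtain \<phi> where \<phi>: "\<And>k. \<phi> k \<in> test_functions" and pf: "pintegrable p f" and pg: "pintegrable p g"
    and lim: "(\<lambda>k. pint p (\<lambda>x. f x - \<phi> k x)) \<longlonglongrightarrow> 0" "(\<lambda>k. pint p (\<lambda>x. g x - T (\<phi> k) x)) \<longlonglongrightarrow> 0"
    using assms unfolding graph_closure_def converges_to_def by blast
  have le: "pint p g \<le> 2 powr p * (pint p (\<lambda>x. g x - T (\<phi> k) x) +
      M * (2 powr p * (pint p (\<lambda>x. f x - \<phi> k x) + pint p f)))" for k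
  proof -
    have "pint p (\<lambda>x. (g x - T (\<phi> k) x) + T (\<phi> k) x) \<le>
        2 powr p * (pint p (\<lambda>x. g x - T (\<phi> k) x) + pint p (T (\<phi> k)))"
      using pg Lp[OF \<phi>] p by (intro pint_add_le pintegrable_diff) auto
    moreover have "pint p (\<lambda>x. (\<phi> k x - f x) + f x) \<le>
        2 powr p * (pint p (\<lambda>x. \<phi> k x - f x) + pint p f)"
      using pf test[OF \<phi>] p by (intro pint_add_le pintegrable_diff) auto
    then have "pint p (\<phi> k) \<le> 2 powr p * (pint p (\<lambda>x. f x - \<phi> k x) + pint p f)"
      by (simp add: pint_diff_commute)
    then have "pint p (T (\<phi> k)) \<le> M * (2 powr p * (pint p (\<lambda>x. f x - \<phi> k x) + pint p f))"
      using bound[OF \<phi>, of k] M by (meson mult_left_mono order_trans)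
    then have "2 powr p * (pint p (\<lambda>x. g x - T (\<phi> k) x) + pint p (T (\<phi> k))) \<le>
       2 powr p * (pint p (\<lambda>x. g x - T (\<phi> k) x) +
      M * (2 powr p * (pint p (\<lambda>x. f x - \<phi> k x) + pint p f)))"
      by (intro mult_left_mono add_left_mono) auto
    ultimately show ?thesis
      unfolding diff_add_cancel by (rule order_trans)
  qed
  have "(\<lambda>k. 2 powr p * (pint p (\<lambda>x. g x - T (\<phi> k) x) +
      M * (2 powr p * (pint p (\<lambda>x. f x - \<phi> k x) + pint p f)))) \<longlonglongrightarrow>
      2 powr p * (0 + M * (2 powr p * (0 + pint p f)))"
    by (intro tendsto_intros lim)
  then have "pint p g \<le> 2 powr p * (0 + M * (2 powr p * (0 + pint p f)))"
    by (rule tendsto_lowerbound[OF _ always_eventually]) (use le in auto)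
  then show ?thesis by simp
qed

text \<open>By linearity of the relation, two images of \<open>f\<close> differ by an image of 0,
  which the bound forces to be a null function.\<close>

lemma graph_closure_unique:
  assumes "graph_closure f g" "graph_closure f h"
  shows "AE x in lebesgue. g x = h x"
proof -
  have "graph_closure (\<lambda>x. f x + (-1) * f x) (\<lambda>x. g x + (-1) * h x)"
    using assms by (intro graph_closure_add graph_closure_cmult)
  then have R: "graph_closure (\<lambda>x. 0) (\<lambda>x. g x - h x)" by simp
  have "AE x in lebesgue. g x - h x = 0"
  proof (rule pint_eq_0_AE)
    show "pintegrable p (\<lambda>x. g x - h x)"
      using R unfolding graph_closure_def converges_to_def by blast
    show "pint p (\<lambda>x. g x - h x) \<le> 0"
      using graph_closure_bound[OF R] by (simp add: pint_def)
  qed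
  then show ?thesis by simp
qed

text \<open>\<open>v\<close> is the pointwise nearest point to \<open>g\<close> on the nonnegative
  half line, so \<open>g\<close> is at least as close to \<open>v\<close> as to the nonnegative
  \<open>T (\<phi> k)\<close>. The distance from \<open>g\<close> to \<open>v\<close> is therefore
  zero, and the limit is handled without extracting an almost everywhere convergent
  subsequence.\<close>

lemma graph_closure_pos:
  assumes "converges_to \<phi> f g" "\<And>k x. \<phi> k x \<in> \<real>\<^sub>\<ge>\<^sub>0"
  shows "AE x in lebesgue. g x \<in> \<real>\<^sub>\<ge>\<^sub>0"
proof -
  define v where "v x = complex_of_real (max 0 (Re (g x)))" for x
  have \<phi>: "\<And>k. \<phi> k \<in> test_functions" and pg: "pintegrable p g"
    and lim: "(\<lambda>k. pint p (\<lambda>x. g x - T (\<phi> k) x)) \<longlonglongrightarrow> 0"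
    using assms unfolding converges_to_def by blast+
  have gm [measurable]: "g \<in> borel_measurable lebesgue" using pg by (simp add: pintegrable_def)
  have closest: "norm (g x - v x) \<le> norm (g x - T (\<phi> k) x)" for x k
  proof -
    obtain r where r: "r \<ge> 0" "T (\<phi> k) x = of_real r"
      using pos[OF \<phi> assms(2)] by (auto simp: nonneg_Reals_def)
    have "(Re (g x) - max 0 (Re (g x)))\<^sup>2 \<le> (Re (g x) - r)\<^sup>2"
      using r(1) by (auto simp: max_def simp flip: abs_le_square_iff)
    then show ?thesis unfolding v_def r(2) cmod_def by simp
  qed
  have vm: "(\<lambda>x. g x - v x) \<in> borel_measurable lebesgue" unfolding v_def by measurable
  have pgT: "pintegrable p (\<lambda>x. g x - T (\<phi> k) x)" for k
    using pg Lp[OF \<phi>] p by (intro pintegrable_diff) auto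
  have pv: "pintegrable p (\<lambda>x. g x - v x)"
    using p by (intro pintegrable_bound[OF pgT vm closest]) auto
  have "pint p (\<lambda>x. g x - v x) \<le> pint p (\<lambda>x. g x - T (\<phi> k) x)" for k
    unfolding pint_def using pv pgT[of k] closest p
    by (intro integral_mono) (auto simp: pintegrable_def intro!: powr_mono2)
  then have "pint p (\<lambda>x. g x - v x) \<le> 0"
    by (intro tendsto_lowerbound[OF lim]) auto
  from pint_eq_0_AE[OF pv this] show ?thesis
    by eventually_elim (metis eq_iff_diff_eq_0 max.cobounded1 nonneg_Reals_of_real_iff v_def)
qed

text \<open>The approximating sequence is prescribed, so that a nonnegative \<open>f\<close> can be
  reached along nonnegative test functions. Sequences within \<open>tol\<close> have images with
  increments small enough for completeness.\<close>

lemma graph_closure_total: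
  assumes \<phi>: "\<And>k. \<phi> k \<in> test_functions" and pf: "pintegrable p f"
    and le: "\<And>k. pint p (\<lambda>x. f x - \<phi> k x) < tol k"
  shows "\<exists>g. converges_to \<phi> f g"
proof -
  have toldec: "tol (Suc k) \<le> tol k" for k
    unfolding tol_def using M p
    by (intro divide_right_mono mult_mono powr_mono2) auto
  have le': "pint p (\<lambda>x. f x - \<phi> k x) \<le> tol k" for k
    using le[of k] by simp
  have "pint p (\<lambda>x. T (\<phi> (Suc k)) x - T (\<phi> k) x) \<le> (1/2) ^ k * ((1/2) ^ k) powr p" for k
  proof -
    have "pint p (\<lambda>x. T (\<phi> (Suc k)) x - T (\<phi> k) x) \<le> M * pint p (\<lambda>x. \<phi> (Suc k) x - \<phi> k x)"
      using bound[OF diff(1)[OF \<phi> \<phi>]] by (simp add: diff(2)[OF \<phi> \<phi>])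
    also have "\<dots> \<le> (M + 1) * (2 powr p * (pint p (\<lambda>x. \<phi> (Suc k) x - f x) + pint p (\<lambda>x. f x - \<phi> k x)))"
      using M p pf \<phi> by (intro mult_mono pint_triangle) (auto simp: test pint_nonneg)
    also have "\<dots> \<le> (M + 1) * (2 powr p * (tol k + tol k))"
      using M le'[of k] order_trans[OF le'[of "Suc k"] toldec]
      by (intro mult_left_mono add_mono) (auto simp: pint_diff_commute)
    also have "\<dots> = (1/2) ^ k * ((1/2) ^ k) powr p"
    proof -
      have "(M + 1) * (c * (x / (c * (M + 1) * 2) + x / (c * (M + 1) * 2))) = x" if "c > 0" for c x
        using that M by (simp add: divide_simps)
      from this[of "2 powr p"] show ?thesis unfolding tol_def by simp
    qed
    finally show ?thesis .
  qed
  then obtain h where h: "pintegrable p h" "(\<lambda>k. pint p (\<lambda>x. h x - T (\<phi> k) x)) \<longlonglongrightarrow> 0"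
    using pint_complete[OF p, of "\<lambda>k. T (\<phi> k)"] Lp[OF \<phi>] by blast
  have "(\<lambda>k. pint p (\<lambda>x. f x - \<phi> k x)) \<longlonglongrightarrow> 0"
  proof (rule tendsto_sandwich[OF _ _ tendsto_const])
    have 1: "(\<lambda>k. (1/2) ^ k :: real) \<longlonglongrightarrow> 0" by (intro LIMSEQ_realpow_zero) auto
    moreover have "(\<lambda>k. ((1/2) ^ k :: real) powr p) \<longlonglongrightarrow> 0"
      using p by (intro tendsto_zero_powrI[where b=p] 1) auto
    ultimately show "tol \<longlonglongrightarrow> 0" unfolding tol_def
      by (intro tendsto_divide_zero tendsto_mult_zero)
  qed (use le in \<open>auto simp: pint_nonneg less_imp_le\<close>)
  then show ?thesis using h \<phi> pf unfolding converges_to_def by blast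
qed

lemma graph_closure_extension:
  assumes "pintegrable p f"
  shows "graph_closure f (extension f)"
proof -
  have "\<forall>k. \<exists>\<phi>. \<phi> \<in> test_functions \<and>
      pint p (\<lambda>x. f x - \<phi> x) < tol k"
  proof
    fix k :: nat
    have "0 < tol k" using M by (simp add: tol_def)
    then show "\<exists>\<phi>. \<phi> \<in> test_functions \<and>
        pint p (\<lambda>x. f x - \<phi> x) < tol k"
      using Lp_approx_test_function[of f p] assms p by (metis Lp_iff)
  qed
  then obtain \<phi> where "\<And>k. \<phi> k \<in> test_functions"
      "\<And>k. pint p (\<lambda>x. f x - \<phi> k x) < tol k"
    by metis
  then have "\<exists>g. graph_closure f g"
    using graph_closure_total assms unfolding graph_closure_def by blast
  then show ?thesis unfolding extension_def by (rule someI_ex)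
qed

lemma extension_in_Lp: "f \<in> Lp p \<Longrightarrow> extension f \<in> Lp p"
  using graph_closure_extension unfolding graph_closure_def converges_to_def Lp_iff by blast

lemma extension_add:
  "f \<in> Lp p \<Longrightarrow> g \<in> Lp p \<Longrightarrow> AE x in lebesgue. extension (\<lambda>x. f x + g x) x = extension f x + extension g x"
  using p unfolding Lp_iff
  by (intro graph_closure_unique[OF graph_closure_extension graph_closure_add] graph_closure_extension
      pintegrable_add) auto

lemma extension_cmult:
  "f \<in> Lp p \<Longrightarrow> AE x in lebesgue. extension (\<lambda>x. c * f x) x = c * extension f x"
  unfolding Lp_iff
  by (intro graph_closure_unique[OF graph_closure_extension graph_closure_cmult] graph_closure_extension
      pintegrable_cmult)

lemma extension_test:
  assumes "f \<in> test_functions" shows "AE x in lebesgue. extension f x = T f x"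
proof (rule graph_closure_unique[OF graph_closure_extension])
  have "converges_to (\<lambda>k. f) f (T f)"
    using assms Lp test by (auto simp: converges_to_def pint_def)
  then show "graph_closure f (T f)" by (auto simp: graph_closure_def)
qed (use assms test in auto)

text \<open>The image selected by \<open>extension\<close> may come from an arbitrary approximating
  sequence; uniqueness identifies it almost everywhere with the image along nonnegative
  approximants.\<close>

lemma extension_pos:
  assumes "f \<in> Lp p" "AE x in lebesgue. f x \<in> \<real>\<^sub>\<ge>\<^sub>0"
  shows "AE x in lebesgue. extension f x \<in> \<real>\<^sub>\<ge>\<^sub>0"
proof -
  have "\<forall>k. \<exists>\<phi>. \<phi> \<in> test_functions \<and> (\<forall>x. \<phi> x \<in> \<real>\<^sub>\<ge>\<^sub>0) \<and>
      pint p (\<lambda>x. f x - \<phi> x) < tol k"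
  proof
    fix k :: nat
    have "0 < tol k" using M by (simp add: tol_def)
    from Lp_approx_test_function_nonneg[OF assms p this]
    show "\<exists>\<phi>. \<phi> \<in> test_functions \<and> (\<forall>x. \<phi> x \<in> \<real>\<^sub>\<ge>\<^sub>0) \<and>
        pint p (\<lambda>x. f x - \<phi> x) < tol k"
      by metis
  qed
  then obtain \<phi> where \<phi>: "\<And>k. \<phi> k \<in> test_functions" "\<And>k x. \<phi> k x \<in> \<real>\<^sub>\<ge>\<^sub>0"
      "\<And>k. pint p (\<lambda>x. f x - \<phi> k x) < tol k"
    by metis
  have pf: "pintegrable p f" using assms(1) by (simp add: Lp_iff)
  obtain g where g: "converges_to \<phi> f g"
    using graph_closure_total[OF \<phi>(1) pf \<phi>(3)] by blast
  then have "AE x in lebesgue. extension f x = g x"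
    by (intro graph_closure_unique[OF graph_closure_extension[OF pf]]) (auto simp: graph_closure_def)
  then show ?thesis
    using graph_closure_pos[OF g \<phi>(2)] by eventually_elim simp
qed

lemma extension_bounded: "\<exists>C\<ge>0. \<forall>f \<in> Lp p. Lp_norm p (extension f) \<le> C * Lp_norm p f"
proof (intro exI conjI ballI)
  fix f :: "real^'n \<Rightarrow> complex" assume "f \<in> Lp p"
  then have "pint p (extension f) \<le> (2 powr p * M * 2 powr p) * pint p f"
    using graph_closure_bound[OF graph_closure_extension] by (simp add: Lp_iff mult.assoc)
  then have "pint p (extension f) powr (1/p) \<le> ((2 powr p * M * 2 powr p) * pint p f) powr (1/p)"
    using p by (intro powr_mono2) (auto simp: pint_nonneg)
  also have "\<dots> = (2 powr p * M * 2 powr p) powr (1/p) * pint p f powr (1/p)"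
    using M by (simp add: powr_mult pint_nonneg)
  finally show "Lp_norm p (extension f) \<le> (2 powr p * M * 2 powr p) powr (1/p) * Lp_norm p f"
    by (simp add: Lp_norm_pint)
qed simp

end

section \<open>Fourier integrals\<close>

lemma
  fixes f :: "'a::euclidean_space \<Rightarrow> 'b::{banach, second_countable_topology}"
  shows lborel_integral_plus: "(LINT x|lborel. f (c + x)) = (LINT x|lborel. f x)"
    and lborel_integrable_plus: "integrable lborel f \<Longrightarrow> integrable lborel (\<lambda>x. f (c + x))"
proof -
  have i: "integrable lborel (\<lambda>x. g (c' + x))" if "integrable lborel g" for g :: "'a \<Rightarrow> 'b" and c'
  proof -
    have "integrable (distr lborel borel ((+) c')) g"
      using that by (simp add: lborel_distr_plus)
    then show ?thesis by (rule integrable_distr[rotated]) simp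
  qed
  then show "integrable lborel f \<Longrightarrow> integrable lborel (\<lambda>x. f (c + x))" .
  show "(LINT x|lborel. f (c + x)) = (LINT x|lborel. f x)"
  \<comment> \<open>If \<open>f\<close> is not integrable then neither is its translate, and both
    integrals take the default value 0.\<close>
  proof (cases "integrable lborel f")
    case True
    then have "f \<in> borel_measurable borel" by simp
    then have "(LINT x|distr lborel borel ((+) c). f x) = (LINT x|lborel. f (c + x))"
      by (intro integral_distr) auto
    then show ?thesis by (simp add: lborel_distr_plus)
  next
    case False
    then have "\<not> integrable lborel (\<lambda>x. f (c + x))"
      using i[of "\<lambda>x. f (c + x)" "- c"] by auto
    with False show ?thesis by (simp add: not_integrable_integral_eq)
  qed
qed

lemma
  fixes f :: "'a::euclidean_space \<Rightarrow> 'b::{banach, second_countable_topology}"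
  assumes "f \<in> borel_measurable borel" "c \<noteq> 0"
  shows lborel_integral_scale: "(LINT x|lborel. f x) = \<bar>c\<bar> ^ DIM('a) *\<^sub>R (LINT x|lborel. f (c *\<^sub>R x))"
proof -
  have "(LINT x|lborel. f x) = (LINT x|density (distr lborel borel (\<lambda>x. 0 + c *\<^sub>R x)) (\<lambda>_. \<bar>c\<bar> ^ DIM('a)). f x)"
    using lborel_affine[OF assms(2), of "0::'a"] by simp
  also have "\<dots> = (LINT x|distr lborel borel (\<lambda>x. 0 + c *\<^sub>R x). (\<bar>c\<bar> ^ DIM('a)) *\<^sub>R f x)"
    using assms(1) by (intro integral_density) auto
  also have "\<dots> = (LINT x|lborel. (\<bar>c\<bar> ^ DIM('a)) *\<^sub>R f (c *\<^sub>R x))"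
    using assms(1) by (subst integral_distr) auto
  finally show ?thesis by simp
qed

lemma lborel_integral_minus:
  fixes f :: "'a::euclidean_space \<Rightarrow> 'b::{banach, second_countable_topology}"
  assumes "f \<in> borel_measurable borel"
  shows "(LINT x|lborel. f (- x)) = (LINT x|lborel. f x)"
  using lborel_integral_scale[OF assms, of "-1"] by simp

lemma lborel_integrable_scale:
  fixes f :: "'a::euclidean_space \<Rightarrow> 'b::{banach, second_countable_topology}"
  assumes "integrable lborel f" "c \<noteq> 0"
  shows "integrable lborel (\<lambda>x. f (c *\<^sub>R x))"
proof -
  have fm [measurable]: "f \<in> borel_measurable borel" using assms(1) by simp
  have "integrable (density (distr lborel borel (\<lambda>x. 0 + c *\<^sub>R x)) (\<lambda>_. \<bar>c\<bar> ^ DIM('a))) f"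
    using lborel_affine[OF assms(2), of "0::'a"] assms(1) by simp
  then have "integrable (distr lborel borel (\<lambda>x. 0 + c *\<^sub>R x)) (\<lambda>x. (\<bar>c\<bar> ^ DIM('a)) *\<^sub>R f x)"
    by (subst (asm) integrable_density) auto
  then have "integrable (distr lborel borel (\<lambda>x. 0 + c *\<^sub>R x)) (\<lambda>x. (1 / \<bar>c\<bar> ^ DIM('a)) *\<^sub>R (\<bar>c\<bar> ^ DIM('a)) *\<^sub>R f x)"
    by (rule integrable_scaleR_right)
  then have "integrable (distr lborel borel (\<lambda>x. 0 + c *\<^sub>R x)) f"
    using assms(2) by simp
  then show ?thesis by (subst (asm) integrable_distr_eq) auto
qed

lemma lborel_integrable_minus:
  fixes f :: "'a::euclidean_space \<Rightarrow> 'b::{banach, second_countable_topology}"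
  shows "integrable lborel f \<Longrightarrow> integrable lborel (\<lambda>x. f (- x))"
  using lborel_integrable_scale[of f "-1"] by simp

text \<open>Lebesgue measure is the image of the product of its one-dimensional versions, so
  products over coordinates factor. This serves the Gaussians and the weights that measure
  decay.\<close>

lemma
  fixes f :: "'a::euclidean_space \<Rightarrow> real \<Rightarrow> 'b::{real_normed_field, banach, second_countable_topology}"
  assumes "\<And>b. b \<in> Basis \<Longrightarrow> integrable lborel (f b)"
  shows lborel_integrable_prod: "integrable lborel (\<lambda>x. \<Prod>b\<in>Basis. f b (x \<bullet> b))"
    and lborel_integral_prod: "(LINT x|lborel. (\<Prod>b\<in>Basis. f b (x \<bullet> b))) = (\<Prod>b\<in>Basis. LINT t|lborel. f b t)"
proof -
  interpret product_sigma_finite "\<lambda>b::'a. lborel :: real measure" ..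
  have [measurable]: "f b \<in> borel_measurable borel" if "b \<in> Basis" for b
    using assms[OF that] by simp
  have m: "(\<lambda>x. \<Prod>b\<in>Basis. f b (x \<bullet> b)) \<in> borel_measurable borel" by measurable
  have m2: "(\<lambda>f. \<Sum>b\<in>Basis. f b *\<^sub>R b) \<in> measurable (\<Pi>\<^sub>M b\<in>(Basis::'a set). lborel) borel" by measurable
  show "integrable lborel (\<lambda>x. \<Prod>b\<in>Basis. f b (x \<bullet> b))"
    by (subst lborel_eq, subst integrable_distr_eq[OF m2 m])
      (simp add: product_integrable_prod assms cong: prod.cong)
  have "(LINT x|lborel. (\<Prod>b\<in>Basis. f b (x \<bullet> b))) =
      (LINT x|(\<Pi>\<^sub>M b\<in>Basis. lborel). (\<Prod>b\<in>Basis. f b (x b)))"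
    by (subst lborel_eq, subst integral_distr[OF m2 m]) (simp cong: prod.cong)
  then show "(LINT x|lborel. (\<Prod>b\<in>Basis. f b (x \<bullet> b))) = (\<Prod>b\<in>Basis. LINT t|lborel. f b t)"
    using product_integral_prod[OF finite_Basis assms] by simp
qed

text \<open>The Fourier transform without its normalizing constant. The inverse transform is the
  same integral at the reflected point, so one function covers both directions.\<close>

definition ft :: "('a::euclidean_space \<Rightarrow> complex) \<Rightarrow> 'a \<Rightarrow> complex" where
  "ft f y = (LINT x|lborel. cis (- (y \<bullet> x)) * f x)"

lemma cis_measurable [measurable]: "cis \<in> borel_measurable borel"
  by (intro borel_measurable_continuous_onI continuous_intros)

lemma integrable_cis_mult:
  assumes "integrable lborel f"
  shows "integrable lborel (\<lambda>x. cis (y \<bullet> x) * f x)"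
proof (rule Bochner_Integration.integrable_bound[OF assms])
  have "f \<in> borel_measurable borel" using assms by simp
  then show "(\<lambda>x. cis (y \<bullet> x) * f x) \<in> borel_measurable lborel" by measurable
qed (simp add: norm_mult)

lemma integrable_cis_mult':
  "integrable lborel f \<Longrightarrow> integrable lborel (\<lambda>x. cis (- (y \<bullet> x)) * f x)"
  using integrable_cis_mult[of f "- y"] by simp

lemma ft_add: "integrable lborel f \<Longrightarrow> integrable lborel g \<Longrightarrow> ft (\<lambda>x. f x + g x) y = ft f y + ft g y"
  by (simp add: ft_def distrib_left integrable_cis_mult')

lemma ft_cmult: "ft (\<lambda>x. c * f x) y = c * ft f y"
  by (simp add: ft_def mult.left_commute)

lemma norm_ft_le: "norm (ft f y) \<le> (LINT x|lborel. norm (f x))"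
proof -
  have "norm (ft f y) \<le> (LINT x|lborel. norm (cis (- (y \<bullet> x)) * f x))"
    unfolding ft_def by (rule integral_norm_bound)
  then show ?thesis by (simp add: norm_mult)
qed

lemma continuous_on_ft:
  assumes "integrable lborel f"
  shows "continuous_on UNIV (ft f)"
  unfolding continuous_on_sequentially
proof (intro allI ballI impI, unfold comp_def)
  fix X :: "nat \<Rightarrow> 'a" and a assume *: "(\<forall>n. X n \<in> UNIV) \<and> X \<longlonglongrightarrow> a"
  have [measurable]: "f \<in> borel_measurable borel" using assms by simp
  show "(\<lambda>n. ft f (X n)) \<longlonglongrightarrow> ft f a"
    unfolding ft_def
  proof (rule integral_dominated_convergence[where w="\<lambda>x. norm (f x)"])
    show "AE x in lborel. (\<lambda>i. cis (- (X i \<bullet> x)) * f x) \<longlonglongrightarrow> cis (- (a \<bullet> x)) * f x"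
      using * by (auto intro!: tendsto_intros)
  qed (use assms in \<open>auto simp: norm_mult\<close>)
qed

section \<open>Comparison with the normalized transforms\<close>

lemma fourier_eq_ft:
  fixes f :: "real ^ 'n \<Rightarrow> complex"
  assumes "f \<in> borel_measurable borel"
  shows "fourier f y = of_real ((2 * pi) powr (- real CARD('n) / 2)) * ft f y"
proof -
  have "(LINT x|lebesgue. exp (- \<i> * of_real (y \<bullet> x)) * f x) = (LINT x|lborel. exp (- \<i> * of_real (y \<bullet> x)) * f x)"
    using assms by (intro integral_completion) measurable
  then show ?thesis by (simp add: fourier_def ft_def cis_conv_exp)
qed

lemma inverse_fourier_eq_ft:
  fixes g :: "real ^ 'n \<Rightarrow> complex"
  assumes "g \<in> borel_measurable borel"
  shows "inverse_fourier g x = of_real ((2 * pi) powr (- real CARD('n) / 2)) * ft g (- x)"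
proof -
  have "(LINT y|lebesgue. exp (\<i> * of_real (x \<bullet> y)) * g y) = (LINT y|lborel. exp (\<i> * of_real (x \<bullet> y)) * g y)"
    using assms by (intro integral_completion) measurable
  then show ?thesis by (simp add: inverse_fourier_def ft_def cis_conv_exp)
qed

lemma Lp_1_imp_integrable:
  fixes f :: "real ^ 'n \<Rightarrow> complex"
  assumes "pintegrable 1 f" "f \<in> borel_measurable borel"
  shows "integrable lborel f"
proof -
  have "integrable lebesgue (\<lambda>x. norm (f x))" using assms(1) by (simp add: pintegrable_def)
  then have "integrable lebesgue f"
    using assms(1) by (simp add: integrable_norm_iff pintegrable_def)
  then show ?thesis using assms(2) by (simp add: integrable_completion)
qed

lemma integrable_test_function: "f \<in> test_functions \<Longrightarrow> integrable lborel f"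
  by (intro Lp_1_imp_integrable pintegrable_test_function borel_measurable_continuous_onI test_functionsD) auto

section \<open>Decay of the transforms of test functions\<close>

lemma has_vector_derivative_imp_tendsto:
  assumes "(f has_vector_derivative D) (at t)"
  shows "((\<lambda>s. (f s - f t) /\<^sub>R (s - t)) \<longlongrightarrow> D) (at t)"
proof -
  have "((\<lambda>s. norm (((f s - f t) - (s - t) *\<^sub>R D) /\<^sub>R norm (s - t))) \<longlongrightarrow> 0) (at t)"
    using assms unfolding has_vector_derivative_def has_derivative_at_within
    by (intro tendsto_norm_zero) (simp add: has_derivative_def)
  then have "((\<lambda>s. norm ((f s - f t) /\<^sub>R (s - t) - D)) \<longlongrightarrow> 0) (at t)"
  proof (rule Lim_transform_eventually)
    have "norm (((f s - f t) - (s - t) *\<^sub>R D) /\<^sub>R norm (s - t)) = norm ((f s - f t) /\<^sub>R (s - t) - D)"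
      if "s \<noteq> t" for s
    proof -
      have "(f s - f t) /\<^sub>R (s - t) - D = ((f s - f t) - (s - t) *\<^sub>R D) /\<^sub>R (s - t)"
        using that by (simp add: scaleR_diff_right)
      then show ?thesis by simp
    qed
    then show "\<forall>\<^sub>F s in at t. norm (((f s - f t) - (s - t) *\<^sub>R D) /\<^sub>R norm (s - t)) =
        norm ((f s - f t) /\<^sub>R (s - t) - D)"
      by (auto simp: eventually_at_filter)
  qed
  then show ?thesis by (simp add: tendsto_norm_zero_iff LIM_zero_iff)
qed

text \<open>Translation by \<open>h k\<close> along the i-th axis multiplies the transform by
  \<open>cis (h k * y $ i)\<close>. The difference quotients of \<open>f\<close> converge to the
  partial derivative under the integral, those of the phase to \<open>\<i> * y $ i\<close>.\<close>

lemma ft_partial: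
  fixes f :: "real ^ 'n \<Rightarrow> complex"
  assumes f: "f \<in> test_functions"
  shows "ft (\<lambda>x. frechet_derivative f (at x) (axis i 1)) y = \<i> * y $ i * ft f y"
proof -
  define e :: "real^'n" where "e = axis i 1"
  define Df where "Df x = frechet_derivative f (at x) e" for x
  have Dt: "Df \<in> test_functions" unfolding Df_def e_def by (rule test_functions_partial[OF f])
  obtain B where B: "\<And>x. norm (Df x) \<le> B" "0 \<le> B" using test_functions_bounded[OF Dt] by blast
  obtain R where R: "{x. f x \<noteq> 0} \<subseteq> cball 0 R"
    using test_functionsD(2)[OF f] bounded_subset_ballD ball_subset_cball by (meson order_trans)
  have line: "((\<lambda>t. f (x + t *\<^sub>R e)) has_vector_derivative Df (x + t *\<^sub>R e)) (at t)" for x t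
  proof -
    have d: "(f has_derivative frechet_derivative f (at (x + t *\<^sub>R e))) (at (x + t *\<^sub>R e))"
      using test_functionsD(4)[OF f] by (simp add: frechet_derivative_works[symmetric])
    have "((\<lambda>t. f (x + t *\<^sub>R e)) has_derivative (\<lambda>h. frechet_derivative f (at (x + t *\<^sub>R e)) (h *\<^sub>R e))) (at t)"
      by (rule has_derivative_compose[where f="\<lambda>t. x + t *\<^sub>R e", OF _ d]) (auto intro!: derivative_eq_intros)
    then show ?thesis
      unfolding has_vector_derivative_def Df_def
      using linear_scale[OF has_derivative_linear[OF d]] by simp
  qed
  define h where "h k = 1 / real (Suc k)" for k
  have h: "0 < h k" "h k \<le> 1" for k by (auto simp: h_def)
  have hlim: "h \<longlonglongrightarrow> 0" unfolding h_def using LIMSEQ_inverse_real_of_nat by (simp add: inverse_eq_divide)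
  have h0: "filterlim h (at 0) sequentially"
    using hlim h by (auto simp: filterlim_at intro!: always_eventually) (metis less_irrefl)
  define D where "D k x = (f (h k *\<^sub>R e + x) - f x) / h k" for k x
  have ne: "norm e = 1" by (simp add: e_def)
  \<comment> \<open>The mean value inequality bounds the quotients by \<open>B\<close>; steps of
    length at most 1 keep all their supports in one ball of radius \<open>R + 1\<close>.\<close>
  have Dbound: "norm (D k x) \<le> B * indicator (cball 0 (R + 1)) x" for k x
  proof -
    have "continuous_on {0..h k} (\<lambda>t. f (x + t *\<^sub>R e))"
      using has_vector_derivative_continuous[OF line] by (intro continuous_at_imp_continuous_on) auto
    then obtain t where t: "norm (f (x + h k *\<^sub>R e) - f (x + 0 *\<^sub>R e)) \<le> norm ((h k - 0) *\<^sub>R Df (x + t *\<^sub>R e))"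
      using mvt_general[OF h(1)[of k], of "\<lambda>t. f (x + t *\<^sub>R e)" "\<lambda>t h. h *\<^sub>R Df (x + t *\<^sub>R e)"] line[of x]
      by (auto simp: has_vector_derivative_def)
    then have 1: "norm (D k x) \<le> B"
    proof -
      have "norm (f (h k *\<^sub>R e + x) - f x) \<le> h k * norm (Df (x + t *\<^sub>R e))"
        using t h(1)[of k] by (simp add: add.commute)
      also have "\<dots> \<le> h k * B" using B(1) h(1)[of k] by (intro mult_left_mono) auto
      finally show ?thesis using h(1)[of k] by (simp add: D_def norm_divide field_simps)
    qed
    have 2: "D k x = 0" if "x \<notin> cball 0 (R + 1)"
    proof -
      have "norm (h k *\<^sub>R e + x) \<ge> norm x - norm (h k *\<^sub>R e)"
        using norm_triangle_ineq4[of "h k *\<^sub>R e + x" "h k *\<^sub>R e"] by simp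
      then have "h k *\<^sub>R e + x \<notin> cball 0 R" "x \<notin> cball 0 R"
        using that h[of k] ne by auto
      then have "f (h k *\<^sub>R e + x) = 0" "f x = 0" using R by blast+
      then show ?thesis by (simp add: D_def)
    qed
    show ?thesis using 1 2 by (cases "x \<in> cball 0 (R + 1)") auto
  qed
  have [measurable]: "f \<in> borel_measurable borel" "Df \<in> borel_measurable borel"
    using test_functionsD(3) f Dt by (auto intro: borel_measurable_continuous_onI)
  have lim: "(\<lambda>k. ft (D k) y) \<longlonglongrightarrow> ft Df y"
    unfolding ft_def
  proof (rule integral_dominated_convergence[where w="\<lambda>x. B * indicator (cball 0 (R + 1)) x"])
    have "emeasure lborel (cball (0::real^'n) (R + 1)) < \<infinity>"
      by (rule emeasure_lborel_cball_finite)
    then show "integrable lborel (\<lambda>x::real^'n. B * indicator (cball 0 (R + 1)) x)"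
      by (intro integrable_mult_right) (simp add: integrable_indicator_iff)
    show "AE x in lborel. norm (cis (- (y \<bullet> x)) * D k x) \<le> B * indicator (cball 0 (R + 1)) x" for k
      using Dbound by (simp add: norm_mult)
    show "AE x in lborel. (\<lambda>k. cis (- (y \<bullet> x)) * D k x) \<longlonglongrightarrow> cis (- (y \<bullet> x)) * Df x"
    proof (rule AE_I2)
      fix x
      have "((\<lambda>t. (f (x + t *\<^sub>R e) - f (x + 0 *\<^sub>R e)) /\<^sub>R (t - 0)) \<longlongrightarrow> Df (x + 0 *\<^sub>R e)) (at 0)"
        by (rule has_vector_derivative_imp_tendsto[OF line])
      from filterlim_compose[OF this h0]
      have "(\<lambda>k. D k x) \<longlonglongrightarrow> Df x"
        by (simp add: D_def scaleR_conv_of_real divide_inverse mult.commute add.commute)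
      then show "(\<lambda>k. cis (- (y \<bullet> x)) * D k x) \<longlonglongrightarrow> cis (- (y \<bullet> x)) * Df x"
        by (intro tendsto_intros)
    qed
  qed (simp_all add: D_def)
  have fi: "integrable lborel f" by (rule integrable_test_function[OF f])
  have eq: "ft (D k) y = (cis (h k * y $ i) - 1) / h k * ft f y" for k
  proof -
    have "ft (\<lambda>x. f (h k *\<^sub>R e + x)) y = (LINT x|lborel. cis (h k * y $ i) * (cis (- (y \<bullet> (h k *\<^sub>R e + x))) * f (h k *\<^sub>R e + x)))"
      unfolding ft_def
      by (rule Bochner_Integration.integral_cong)
        (auto simp: mult.assoc[symmetric] cis_mult inner_add_right e_def cart_eq_inner_axis)
    also have "\<dots> = cis (h k * y $ i) * ft f y"
      using lborel_integral_plus[of "\<lambda>x. cis (- (y \<bullet> x)) * f x" "h k *\<^sub>R e"] by (simp add: ft_def)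
    finally have 1: "ft (\<lambda>x. f (h k *\<^sub>R e + x)) y = cis (h k * y $ i) * ft f y" .
    have "D k = (\<lambda>x. (1 / h k) * (f (h k *\<^sub>R e + x) + (-1) * f x))"
      by (simp add: D_def fun_eq_iff)
    then have "ft (D k) y = (1 / h k) * (ft (\<lambda>x. f (h k *\<^sub>R e + x)) y + (-1) * ft f y)"
      using fi by (simp only: ft_cmult) (subst ft_add, auto intro: lborel_integrable_plus simp: ft_cmult[of "-1", simplified])
    then show ?thesis unfolding 1 by (simp add: algebra_simps diff_divide_distrib)
  qed
  have "((\<lambda>t. (cis (t * y $ i) - cis (0 * y $ i)) /\<^sub>R (t - 0)) \<longlongrightarrow> (y $ i) *\<^sub>R (\<i> * cis (0 * y $ i))) (at 0)"
  proof -
    have "((\<lambda>t. cis (t * y $ i)) has_vector_derivative (y $ i) *\<^sub>R (\<i> * cis (0 * y $ i))) (at 0)"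
      unfolding has_vector_derivative_def by (auto intro!: derivative_eq_intros)
    then show ?thesis by (rule has_vector_derivative_imp_tendsto)
  qed
  from filterlim_compose[OF this h0]
  have "(\<lambda>k. (cis (h k * y $ i) - 1) / h k) \<longlonglongrightarrow> \<i> * y $ i"
    by (simp add: scaleR_conv_of_real divide_inverse mult.commute)
  then have "(\<lambda>k. ft (D k) y) \<longlonglongrightarrow> \<i> * y $ i * ft f y"
    unfolding eq by (intro tendsto_intros)
  with lim have "ft Df y = \<i> * y $ i * ft f y" by (rule LIMSEQ_unique)
  then show ?thesis by (simp add: Df_def[abs_def] e_def)
qed

lemma prod_Basis_cart:
  fixes y :: "real ^ 'n"
  shows "(\<Prod>b\<in>Basis. h (y \<bullet> b)) = (\<Prod>i\<in>UNIV. h (y $ i))"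
proof -
  have B: "(Basis :: (real^'n) set) = range (\<lambda>i. axis i 1)" by (auto simp: Basis_vec_def)
  have "inj (\<lambda>i::'n. axis i (1::real))" by (auto simp: inj_def axis_eq_axis)
  then show ?thesis unfolding B by (subst prod.reindex) (auto simp: cart_eq_inner_axis o_def)
qed

lemma prod_inverse_fun: "(\<Prod>i\<in>A. inverse (h i :: real)) = inverse (\<Prod>i\<in>A. h i)"
  using prod_inversef[of h A] by (simp add: o_def)

lemma one_plus_sum_le_prod:
  fixes a :: "'i \<Rightarrow> real"
  assumes "finite A" "\<And>i. i \<in> A \<Longrightarrow> 0 \<le> a i"
  shows "1 + (\<Sum>i\<in>A. a i) \<le> (\<Prod>i\<in>A. 1 + a i)"
  using assms
proof (induction A rule: finite_induct)
  case (insert j A)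
  have "1 + (\<Sum>i\<in>insert j A. a i) \<le> (1 + a j) * (1 + (\<Sum>i\<in>A. a i))"
    using insert by (simp add: algebra_simps sum_nonneg)
  also have "\<dots> \<le> (1 + a j) * (\<Prod>i\<in>A. 1 + a i)"
    using insert by (intro mult_left_mono) auto
  finally show ?case using insert by simp
qed simp

text \<open>The weight \<open>1 + (y $ j)\<^sup>2\<close> corresponds to subtracting the second
  partial derivative along axis j, an operation that stays within the test functions. Coordinates
  are treated one at a time.\<close>

lemma ft_weight_test_function:
  fixes f :: "real ^ 'n \<Rightarrow> complex"
  assumes "f \<in> test_functions" "finite A"
  shows "\<exists>g\<in>test_functions. \<forall>y. ft g y = of_real (\<Prod>i\<in>A. 1 + (y $ i)\<^sup>2) * ft f y"
  using assms(2)
proof (induction A rule: finite_induct)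
  case empty
  then show ?case using assms(1) by auto
next
  case (insert j A)
  obtain g where g: "g \<in> test_functions" "\<And>y. ft g y = of_real (\<Prod>i\<in>A. 1 + (y $ i)\<^sup>2) * ft f y"
    using insert by blast
  define d where "d f = (\<lambda>x::real^'n. frechet_derivative f (at x) (axis j 1))" for f :: "real^'n \<Rightarrow> complex"
  have d: "d f \<in> test_functions" "ft (d f) y = \<i> * y $ j * ft f y" if "f \<in> test_functions" for f y
    unfolding d_def using ft_partial[OF that, of j y] test_functions_partial[OF that, of j] by auto
  define h where "h x = g x + (-1) * d (d g) x" for x
  have dd: "(\<lambda>x. (-1) * d (d g) x) \<in> test_functions" by (intro test_functions_cmult d g)
  have ht: "h \<in> test_functions"
    unfolding h_def by (rule test_functions_add[OF g(1) dd])
  have "ft h y = ft g y + (-1) * ft (d (d g)) y" for y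
    unfolding h_def
    by (simp only: ft_add[OF integrable_test_function[OF g(1)] integrable_test_function[OF dd]] ft_cmult)
  also have "ft g y + (-1) * ft (d (d g)) y = of_real (1 + (y $ j)\<^sup>2) * ft g y" for y
    by (simp add: d g(1) algebra_simps power2_eq_square)
  also have "of_real (1 + (y $ j)\<^sup>2) * ft g y = of_real (\<Prod>i\<in>insert j A. 1 + (y $ i)\<^sup>2) * ft f y" for y
    using insert(1,2) by (simp add: g(2) mult.assoc)
  finally show ?case using ht by blast
qed

text \<open>The transform multiplied by the weight is again the transform of a test function, hence
  bounded. A product weight is chosen because its reciprocal factors into integrable functions of
  one variable.\<close>

lemma ft_test_function_decay:
  fixes f :: "real ^ 'n \<Rightarrow> complex"
  assumes "f \<in> test_functions"
  obtains C where "C \<ge> 0" "\<And>y. norm (ft f y) \<le> C * (\<Prod>i\<in>UNIV. inverse (1 + (y $ i)\<^sup>2))"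
proof -
  obtain g where g: "g \<in> test_functions" "\<And>y. ft g y = of_real (\<Prod>i\<in>UNIV. 1 + (y $ i)\<^sup>2) * ft f y"
    using ft_weight_test_function[OF assms, of UNIV] by auto
  define C where "C = (LINT x|lborel. norm (g x))"
  have pos: "0 < (\<Prod>i\<in>UNIV. 1 + (y $ i)\<^sup>2)" for y :: "real^'n"
    by (intro prod_pos) (auto intro: add_pos_nonneg)
  have "norm (ft f y) \<le> C * (\<Prod>i\<in>UNIV. inverse (1 + (y $ i)\<^sup>2))" for y
  proof -
    have "(\<Prod>i\<in>UNIV. 1 + (y $ i)\<^sup>2) * norm (ft f y) \<le> C"
      using norm_ft_le[of g y] pos[of y] by (simp add: g(2) norm_mult C_def abs_of_pos del: of_real_prod)
    then show ?thesis
      using pos[of y] by (simp add: prod_inverse_fun pos_le_divide_eq mult.commute flip: divide_inverse)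
  qed
  moreover have "C \<ge> 0" by (simp add: C_def)
  ultimately show thesis using that by blast
qed

lemma integrable_ft_test_function:
  fixes f :: "real ^ 'n \<Rightarrow> complex"
  assumes "f \<in> test_functions"
  shows "integrable lborel (ft f)"
proof -
  obtain C where C: "C \<ge> 0" "\<And>y. norm (ft f y) \<le> C * (\<Prod>i\<in>UNIV. inverse (1 + (y $ i)\<^sup>2))"
    using ft_test_function_decay[OF assms] by blast
  have "integrable lborel (\<lambda>x::real. inverse (1 + x\<^sup>2))"
    using integrable_inverse_1_plus_square by (simp add: set_integrable_def einterval_def)
  then have "integrable lborel (\<lambda>y::real^'n. \<Prod>b\<in>Basis. inverse (1 + (y \<bullet> b)\<^sup>2))"
    by (intro lborel_integrable_prod)
  then have "integrable lborel (\<lambda>y::real^'n. C * (\<Prod>i\<in>UNIV. inverse (1 + (y $ i)\<^sup>2)))"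
    by (subst (asm) prod_Basis_cart) simp
  then show ?thesis
  proof (rule Bochner_Integration.integrable_bound)
    show "ft f \<in> borel_measurable lborel"
      using borel_measurable_continuous_onI[OF continuous_on_ft[OF integrable_test_function[OF assms]]] by simp
    show "AE y in lborel. norm (ft f y) \<le> norm (C * (\<Prod>i\<in>UNIV. inverse (1 + (y $ i)\<^sup>2)))"
      using order_trans[OF C(2) abs_ge_self] by simp
  qed
qed

lemma ft_test_function_vanishes:
  fixes f :: "real ^ 'n \<Rightarrow> complex"
  assumes "f \<in> test_functions"
  shows "(ft f \<longlongrightarrow> 0) at_infinity"
proof -
  obtain C where C: "C \<ge> 0" "\<And>y. norm (ft f y) \<le> C * (\<Prod>i\<in>UNIV. inverse (1 + (y $ i)\<^sup>2))"
    using ft_test_function_decay[OF assms] by blast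
  \<comment> \<open>Expanding the product of the factors \<open>1 + (y $ i)\<^sup>2\<close> already
    produces 1 and the sum of the squares.\<close>
  have le: "norm (ft f y) \<le> C * inverse (1 + (norm y)\<^sup>2)" for y
  proof -
    have "(norm y)\<^sup>2 = (\<Sum>i\<in>UNIV. (y $ i)\<^sup>2)"
      by (simp add: norm_vec_def L2_set_def sum_nonneg)
    then have "1 + (norm y)\<^sup>2 \<le> (\<Prod>i\<in>UNIV. 1 + (y $ i)\<^sup>2)"
      using one_plus_sum_le_prod[of UNIV "\<lambda>i. (y $ i)\<^sup>2"] by simp
    then have "inverse (\<Prod>i\<in>UNIV. 1 + (y $ i)\<^sup>2) \<le> inverse (1 + (norm y)\<^sup>2)"
      by (intro le_imp_inverse_le) (auto intro: add_pos_nonneg)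
    then show ?thesis
      unfolding prod_inverse_fun[symmetric] using order_trans[OF C(2) mult_left_mono[OF _ C(1)]] by blast
  qed
  have "((\<lambda>y::real^'n. C * inverse (1 + (norm y)\<^sup>2)) \<longlongrightarrow> 0) at_infinity"
  proof (intro tendsto_mult_right_zero tendsto_inverse_0_at_top)
    show "filterlim (\<lambda>y::real^'n. 1 + (norm y)\<^sup>2) at_top at_infinity"
      by (intro filterlim_tendsto_add_at_top[OF tendsto_const] filterlim_pow_at_top filterlim_norm_at_top) auto
  qed
  then show ?thesis
    by (rule Lim_null_comparison[rotated]) (simp add: le)
qed

text \<open>Transforms of test functions vanish at infinity by their decay; the uniform bound of
  \<open>ft\<close> by the L^1 norm carries this over by density.\<close>

lemma riemann_lebesgue:
  fixes f :: "real ^ 'n \<Rightarrow> complex"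
  assumes f: "integrable lborel f"
  shows "(ft f \<longlongrightarrow> 0) at_infinity"
proof (rule tendstoI)
  fix e :: real assume "e > 0"
  have fm [measurable]: "f \<in> borel_measurable borel" using f by simp
  have "f \<in> Lp 1"
    using f by (simp add: Lp_def measurable_completion integrable_completion)
  then obtain \<phi> where \<phi>: "\<phi> \<in> test_functions" "pint 1 (\<lambda>x. f x - \<phi> x) < e / 2"
    using Lp_approx_test_function[of f 1 "e / 2"] \<open>e > 0\<close> by auto
  have \<phi>i: "integrable lborel \<phi>" by (rule integrable_test_function[OF \<phi>(1)])
  then have [measurable]: "\<phi> \<in> borel_measurable borel" by simp
  have "pint 1 (\<lambda>x. f x - \<phi> x) = (LINT x|lborel. norm (f x - \<phi> x))"
    unfolding pint_def by (simp add: integral_completion)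
  then have small: "norm (ft f y - ft \<phi> y) < e / 2" for y
    using norm_ft_le[of "\<lambda>x. f x - \<phi> x" y] \<phi>(2) ft_add[OF f, of "\<lambda>x. (-1) * \<phi> x" y] \<phi>i
    by (simp add: ft_cmult[of "-1", simplified])
  have "\<forall>\<^sub>F y in at_infinity. dist (ft \<phi> y) 0 < e / 2"
    using tendstoD[OF ft_test_function_vanishes[OF \<phi>(1)], of "e / 2"] \<open>e > 0\<close> by simp
  then show "\<forall>\<^sub>F y in at_infinity. dist (ft f y) 0 < e"
  proof eventually_elim
    case (elim y)
    then show ?case using small[of y] norm_triangle_ineq[of "ft f y - ft \<phi> y" "ft \<phi> y"] by simp
  qed
qed

section \<open>Scalar multipliers\<close>

text \<open>The multiplier operator for a single entry, with the two constants
  \<open>(2 * pi) powr (- n / 2)\<close> merged and the inverse transform written as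
  \<open>ft\<close> at \<open>- x\<close>.\<close>

definition scalar_mult :: "(real ^ 'n \<Rightarrow> complex) \<Rightarrow> (real ^ 'n \<Rightarrow> complex) \<Rightarrow> real ^ 'n \<Rightarrow> complex" where
  "scalar_mult F f x = of_real ((2 * pi) powr (- real CARD('n))) * ft (\<lambda>y. F y * ft f y) (- x)"

lemma integrable_bounded_mult:
  fixes F g :: "'a::euclidean_space \<Rightarrow> complex"
  assumes "bounded (range F)" "F \<in> borel_measurable borel" "integrable lborel g"
  shows "integrable lborel (\<lambda>y. F y * g y)"
proof -
  obtain B where B: "\<And>y. norm (F y) \<le> B" using assms(1) by (auto simp: bounded_iff)
  have B0: "0 \<le> B" using order_trans[OF norm_ge_zero B] .
  show ?thesis
  proof (rule Bochner_Integration.integrable_bound)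
    show "integrable lborel (\<lambda>y. B * norm (g y))" using assms(3) by simp
    show "AE y in lborel. norm (F y * g y) \<le> norm (B * norm (g y))"
      using B B0 by (intro AE_I2) (auto simp: norm_mult intro!: mult_right_mono)
    have "g \<in> borel_measurable borel" using assms(3) by simp
    then show "(\<lambda>y. F y * g y) \<in> borel_measurable lborel" using assms(2) by measurable
  qed
qed

context
  fixes F :: "real ^ 'n \<Rightarrow> complex"
  assumes bF: "bounded (range F)" and cF: "continuous_on UNIV F"
begin

lemma integrable_mult_ft:
  "f \<in> test_functions \<Longrightarrow> integrable lborel (\<lambda>y. F y * ft f y)"
  by (intro integrable_bounded_mult bF borel_measurable_continuous_onI[OF cF] integrable_ft_test_function)

lemma scalar_mult_C_vanishing:
  assumes "f \<in> test_functions"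
  shows "scalar_mult F f \<in> C_vanishing"
proof -
  note i = integrable_mult_ft[OF assms]
  have "continuous_on UNIV (\<lambda>x. ft (\<lambda>y. F y * ft f y) (- x))"
    by (rule continuous_on_compose2[OF continuous_on_ft[OF i]]) (auto intro: continuous_intros)
  then have 1: "continuous_on UNIV (scalar_mult F f)"
    unfolding scalar_mult_def by (intro continuous_intros)
  have "((\<lambda>x. ft (\<lambda>y. F y * ft f y) (- x)) \<longlongrightarrow> 0) at_infinity"
    by (rule filterlim_compose[OF riemann_lebesgue[OF i]])
      (simp add: filterlim_at_infinity_conv_norm_at_top filterlim_norm_at_top)
  then have "(scalar_mult F f \<longlongrightarrow> 0) at_infinity"
    unfolding scalar_mult_def by (rule tendsto_mult_right_zero)
  with 1 show ?thesis by (simp add: C_vanishing_def)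
qed

lemma scalar_mult_add:
  assumes "f \<in> test_functions" "g \<in> test_functions"
  shows "scalar_mult F (\<lambda>x. f x + g x) = (\<lambda>x. scalar_mult F f x + scalar_mult F g x)"
proof
  fix x
  have "ft (\<lambda>x. f x + g x) = (\<lambda>y. ft f y + ft g y)"
    by (intro ext ft_add integrable_test_function assms)
  then have "(\<lambda>y. F y * ft (\<lambda>x. f x + g x) y) = (\<lambda>y. F y * ft f y + F y * ft g y)"
    by (simp add: distrib_left)
  then show "scalar_mult F (\<lambda>x. f x + g x) x = scalar_mult F f x + scalar_mult F g x"
    unfolding scalar_mult_def
    by (simp add: ft_add[OF integrable_mult_ft[OF assms(1)] integrable_mult_ft[OF assms(2)]] distrib_left)
qed

lemma scalar_mult_cmult:
  "scalar_mult F (\<lambda>x. c * f x) = (\<lambda>x. c * scalar_mult F f x)"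
proof
  fix x
  have "(\<lambda>y. F y * ft (\<lambda>x. c * f x) y) = (\<lambda>y. c * (F y * ft f y))"
    by (simp add: ft_cmult mult_ac)
  then show "scalar_mult F (\<lambda>x. c * f x) x = c * scalar_mult F f x"
    by (simp add: scalar_mult_def ft_cmult mult_ac)
qed

end

section \<open>From the matrix multiplier to its entries\<close>

lemma ft_sum:
  assumes "finite A" "\<And>k. k \<in> A \<Longrightarrow> integrable lborel (g k)"
  shows "ft (\<lambda>x. \<Sum>k\<in>A. g k x) y = (\<Sum>k\<in>A. ft (g k) y)"
  using assms
proof (induction A rule: finite_induct)
  case (insert j A)
  then show ?case by (simp add: ft_add)
qed (simp add: ft_def)

lemma bounded_entry:
  fixes G :: "'a \<Rightarrow> complex ^ 'm ^ 'n"
  assumes "bounded (range G)"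
  shows "bounded (range (\<lambda>y. G y $ j $ k))"
proof -
  obtain B where "\<And>y. norm (G y) \<le> B" using assms by (auto simp: bounded_iff)
  then have "norm (G y $ j $ k) \<le> B" for y
    using Finite_Cartesian_Product.norm_nth_le[of "G y $ j" k] Finite_Cartesian_Product.norm_nth_le[of "G y" j]
    by (meson order_trans)
  then show ?thesis by (auto simp: bounded_iff)
qed

lemma continuous_entry: "continuous_on UNIV G \<Longrightarrow> continuous_on UNIV (\<lambda>y. G y $ j $ k)"
  by (intro continuous_on_component)

text \<open>A row of the matrix product is a finite sum of integrable terms, so the inverse
  transform may be taken term by term. All later arguments work with the scalar summands.\<close>

lemma multiplier_op_component:
  fixes G :: "real ^ 'n \<Rightarrow> complex ^ 'm ^ 'm"
  assumes G: "bounded (range G)" "continuous_on UNIV G" and f: "f \<in> column_vectors test_functions"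
  shows "multiplier_op G f x $ j = (\<Sum>k\<in>UNIV. scalar_mult (\<lambda>y. G y $ j $ k) (\<lambda>x. f x $ k) x)"
proof -
  define c :: real where "c = (2 * pi) powr (- real CARD('n) / 2)"
  have c2: "c * c = (2 * pi) powr (- real CARD('n))"
    unfolding c_def by (subst powr_add[symmetric]) simp
  have fk: "(\<lambda>x. f x $ k) \<in> test_functions" for k using f by (simp add: column_vectors_def)
  have fm: "(\<lambda>x. f x $ k) \<in> borel_measurable borel" for k
    using integrable_test_function[OF fk[of k]] by simp
  have i: "integrable lborel (\<lambda>y. c * (G y $ j $ k * ft (\<lambda>x. f x $ k) y))" for k
    using integrable_mult_ft[OF bounded_entry[OF G(1)] continuous_entry[OF G(2)] fk] by simp
  have e: "(G y *v fourier_vec f y) $ j = (\<Sum>k\<in>UNIV. c * (G y $ j $ k * ft (\<lambda>x. f x $ k) y))" for y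
    by (simp add: matrix_vector_mult_def fourier_vec_def fourier_eq_ft[OF fm] c_def mult_ac)
  have "multiplier_op G f x $ j = inverse_fourier (\<lambda>y. \<Sum>k\<in>UNIV. c * (G y $ j $ k * ft (\<lambda>x. f x $ k) y)) x"
    by (simp add: multiplier_op_def inverse_fourier_vec_def e)
  also have "\<dots> = c * ft (\<lambda>y. \<Sum>k\<in>UNIV. c * (G y $ j $ k * ft (\<lambda>x. f x $ k) y)) (- x)"
    unfolding c_def
  proof (rule inverse_fourier_eq_ft)
    have "(\<lambda>y. c * (G y $ j $ k * ft (\<lambda>x. f x $ k) y)) \<in> borel_measurable borel" for k
      using borel_measurable_integrable[OF i[of k]] by simp
    then show "(\<lambda>y. \<Sum>k\<in>UNIV. complex_of_real ((2 * pi) powr (- real CARD('n) / 2)) *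
        (G y $ j $ k * ft (\<lambda>x. f x $ k) y)) \<in> borel_measurable borel"
      unfolding c_def by (intro borel_measurable_sum)
  qed
  also have "\<dots> = c * (\<Sum>k\<in>UNIV. c * ft (\<lambda>y. G y $ j $ k * ft (\<lambda>x. f x $ k) y) (- x))"
    by (simp only: ft_sum[OF finite i] ft_cmult)
  also have "\<dots> = (\<Sum>k\<in>UNIV. of_real (c * c) * ft (\<lambda>y. G y $ j $ k * ft (\<lambda>x. f x $ k) y) (- x))"
    by (simp add: sum_distrib_left mult_ac)
  finally show ?thesis by (simp add: scalar_mult_def c2)
qed

section \<open>Gaussians\<close>

text \<open>\<open>s\<close> is an inverse variance: \<open>s\<close> tending to 0 widens the
  Gaussian towards the constant 1, and the transform has parameter \<open>1 / s\<close>.\<close>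

definition gauss :: "real \<Rightarrow> 'a::euclidean_space \<Rightarrow> real" where
  "gauss s x = exp (- (s * (norm x)\<^sup>2 / 2))"

lemma gauss_pos: "0 < gauss s x" and gauss_minus: "gauss s (- x) = gauss s x"
  by (simp_all add: gauss_def)

lemma gauss_le_1: "0 \<le> s \<Longrightarrow> gauss s x \<le> 1"
  by (simp add: gauss_def)

lemma gauss_measurable [measurable]: "gauss s \<in> borel_measurable borel"
  unfolding gauss_def[abs_def] by measurable

lemma gauss_prod: "gauss s x = (\<Prod>b\<in>Basis. exp (- (s * (x \<bullet> b)\<^sup>2 / 2)))"
proof -
  have "(norm x)\<^sup>2 = (\<Sum>b\<in>Basis. (x \<bullet> b)\<^sup>2)"
    unfolding power2_norm_eq_inner by (subst euclidean_inner) (simp add: power2_eq_square)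
  then have "- (s * (norm x)\<^sup>2 / 2) = (\<Sum>b\<in>Basis. - (s * (x \<bullet> b)\<^sup>2 / 2))"
    by (simp add: sum_distrib_left sum_divide_distrib sum_negf)
  then show ?thesis by (simp add: gauss_def exp_sum)
qed

text \<open>For \<open>s = 1\<close> this is the characteristic function of the standard normal
  distribution; the substitution of \<open>sqrt s * x\<close> for \<open>x\<close>, with frequency
  \<open>t / sqrt s\<close>, gives the general case.\<close>

lemma
  assumes "0 < s"
  shows integrable_cis_gauss_1: "integrable lborel (\<lambda>x::real. cis (- (t * x)) * exp (- (s * x\<^sup>2 / 2)))"
    and integral_cis_gauss_1: "(LINT x|lborel. cis (- (t * x)) * exp (- (s * x\<^sup>2 / 2))) =
      sqrt (2 * pi / s) * exp (- (t\<^sup>2 / s / 2))"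
proof -
  have i0: "integrable lborel (\<lambda>x::real. complex_of_real (exp (- (x\<^sup>2 / 2))))"
  proof -
    have "integrable lborel (\<lambda>x. sqrt (2 * pi) * std_normal_density x)"
      by (intro integrable_mult_right integrable_normal_density) simp
    then show ?thesis by (simp add: std_normal_density_def)
  qed
  have i1: "integrable lborel (\<lambda>x. cis (- (u * x)) * exp (- (x\<^sup>2 / 2)))" for u :: real
    using integrable_cis_mult'[OF i0, of u] by simp
  have I1: "(LINT x|lborel. cis (- (u * x)) * exp (- (x\<^sup>2 / 2))) = sqrt (2 * pi) * exp (- (u\<^sup>2 / 2))" for u
  proof -
    have "char std_normal_distribution (- u) = (LINT x|lborel. std_normal_density x *\<^sub>R cis (- (u * x)))"
      unfolding char_def by (subst integral_density) (auto simp: cis_conv_exp)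
    also have "\<dots> = (LINT x|lborel. of_real (1 / sqrt (2 * pi)) * (cis (- (u * x)) * exp (- (x\<^sup>2 / 2))))"
      by (intro Bochner_Integration.integral_cong) (auto simp: std_normal_density_def scaleR_conv_of_real)
    also have "\<dots> = of_real (1 / sqrt (2 * pi)) * (LINT x|lborel. (cis (- (u * x)) * exp (- (x\<^sup>2 / 2))))"
      by (rule integral_mult_right_zero)
    finally show ?thesis
      by (simp add: char_std_normal_distribution field_simps flip: of_real_mult)
  qed
  have r: "cis (- (t / sqrt s * (0 + sqrt s * x))) * exp (- ((0 + sqrt s * x)\<^sup>2 / 2)) =
      cis (- (t * x)) * exp (- (s * x\<^sup>2 / 2))" for x
    using assms by (simp add: power_mult_distrib)
  have "sqrt s \<noteq> 0" using assms by simp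
  note aff = lborel_integrable_real_affine[OF i1[of "t / sqrt s"] this, of 0]
    lborel_integral_real_affine[OF this, of "\<lambda>x. cis (- (t / sqrt s * x)) * exp (- (x\<^sup>2 / 2))" 0]
  show "integrable lborel (\<lambda>x::real. cis (- (t * x)) * exp (- (s * x\<^sup>2 / 2)))"
    using aff(1) unfolding r .
  have "sqrt (2 * pi) * exp (- ((t / sqrt s)\<^sup>2 / 2)) =
      sqrt s *\<^sub>R (LINT x|lborel. cis (- (t * x)) * exp (- (s * x\<^sup>2 / 2)))"
    using aff(2) assms unfolding r I1 by simp
  then show "(LINT x|lborel. cis (- (t * x)) * exp (- (s * x\<^sup>2 / 2))) =
      sqrt (2 * pi / s) * exp (- (t\<^sup>2 / s / 2))"
    using assms by (simp add: real_sqrt_divide scaleR_conv_of_real field_simps power_divide)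
qed

lemma
  fixes y :: "'a::euclidean_space"
  assumes "0 < s"
  shows integrable_gauss: "integrable lborel (gauss s :: 'a \<Rightarrow> real)"
    and ft_gauss: "ft (\<lambda>x. of_real (gauss s x)) y = of_real (sqrt (2 * pi / s) ^ DIM('a) * gauss (1 / s) y)"
proof -
  have e: "cis (- (y \<bullet> x)) * of_real (gauss s x) =
      (\<Prod>b\<in>Basis. cis (- ((y \<bullet> b) * (x \<bullet> b))) * exp (- (s * (x \<bullet> b)\<^sup>2 / 2)))" for x y :: 'a
  proof -
    have "cis (- (y \<bullet> x)) = (\<Prod>b\<in>Basis. cis (- ((y \<bullet> b) * (x \<bullet> b))))"
      by (simp add: euclidean_inner[of y x] cis_conv_exp sum_negf[symmetric] sum_distrib_left exp_sum flip: of_real_minus)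
    then show ?thesis by (simp add: gauss_prod prod.distrib)
  qed
  have i: "integrable lborel (\<lambda>x. cis (- (y \<bullet> x)) * of_real (gauss s x))" for y :: 'a
    unfolding e by (intro lborel_integrable_prod integrable_cis_gauss_1 assms)
  from i[of 0] show "integrable lborel (gauss s :: 'a \<Rightarrow> real)"
    using integrable_Re[of lborel "\<lambda>x. of_real (gauss s x)"] by simp
  have "ft (\<lambda>x. of_real (gauss s x)) y = (\<Prod>b\<in>Basis. of_real (sqrt (2 * pi / s)) * exp (- ((y \<bullet> b)\<^sup>2 / s / 2)))"
    unfolding ft_def e
    by (subst lborel_integral_prod) (auto intro: integrable_cis_gauss_1 assms simp: integral_cis_gauss_1 assms)
  then show "ft (\<lambda>x. of_real (gauss s x)) y = of_real (sqrt (2 * pi / s) ^ DIM('a) * gauss (1 / s) y)"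
    by (simp add: gauss_prod prod.distrib)
qed

lemma integral_gauss:
  "0 < s \<Longrightarrow> (LINT x|lborel. gauss s (x::'a::euclidean_space)) = sqrt (2 * pi / s) ^ DIM('a)"
  using ft_gauss[of s "0::'a"] by (simp add: ft_def gauss_def flip: of_real_mult of_real_power)

section \<open>Positive semidefinite functions and Gaussian regularization\<close>

text \<open>The inner majorant may depend on \<open>x\<close> because translates such as
  \<open>K (x - z)\<close> occur, whose mass does not change with the translation.\<close>

lemma lborel_pair_integrable_dominated:
  fixes f :: "'a::euclidean_space \<times> 'b::euclidean_space \<Rightarrow> 'c::{banach, second_countable_topology}"
  assumes fm [measurable]: "f \<in> borel_measurable (lborel \<Otimes>\<^sub>M lborel)"
    and u: "integrable lborel u" "\<And>x. 0 \<le> u x"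
    and V: "\<And>x. integrable lborel (V x)" "\<And>x. (LINT y|lborel. V x y) \<le> C"
    and le: "\<And>x y. norm (f (x, y)) \<le> u x * V x y"
  shows "integrable (lborel \<Otimes>\<^sub>M lborel) f"
proof (rule lborel_pair.Fubini_integrable[OF fm])
  have i: "integrable lborel (\<lambda>y. f (x, y))" for x
  proof (rule Bochner_Integration.integrable_bound)
    show "integrable lborel (\<lambda>y. u x * V x y)" using V(1) by simp
    show "AE y in lborel. norm (f (x, y)) \<le> norm (u x * V x y)"
      using order_trans[OF le abs_ge_self] by simp
  qed measurable
  then show "AE x in lborel. integrable lborel (\<lambda>y. f (x, y))" by simp
  show "integrable lborel (\<lambda>x. LINT y|lborel. norm (f (x, y)))"
  proof (rule Bochner_Integration.integrable_bound)
    show "integrable lborel (\<lambda>x. u x * C)" using u(1) by simp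
    show "(\<lambda>x. LINT y|lborel. norm (f (x, y))) \<in> borel_measurable lborel" by measurable
    show "AE x in lborel. norm (LINT y|lborel. norm (f (x, y))) \<le> norm (u x * C)"
    proof (rule AE_I2)
      fix x
      have "(LINT y|lborel. norm (f (x, y))) \<le> (LINT y|lborel. u x * V x y)"
        using i V(1) le by (intro integral_mono) auto
      also have "\<dots> = u x * (LINT y|lborel. V x y)" by simp
      also have "\<dots> \<le> u x * C" using V(2) u(2) by (intro mult_left_mono)
      finally show "norm (LINT y|lborel. norm (f (x, y))) \<le> norm (u x * C)" by simp
    qed
  qed
qed

text \<open>For \<open>k x y = cis (x \<bullet> y)\<close> this is the multiplication formula, which
  moves a Fourier transform from one factor to the other.\<close>

lemma Fubini_bounded_kernel:
  fixes u :: "'a::euclidean_space \<Rightarrow> complex" and v :: "'b::euclidean_space \<Rightarrow> complex"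
  assumes u: "integrable lborel u" and v: "integrable lborel v"
    and k [measurable]: "case_prod k \<in> borel_measurable (borel \<Otimes>\<^sub>M borel)" and k1: "\<And>x y. norm (k x y) \<le> 1"
  shows "(LINT x|lborel. u x * (LINT y|lborel. v y * k x y)) = (LINT y|lborel. v y * (LINT x|lborel. u x * k x y))"
proof -
  have [measurable]: "u \<in> borel_measurable borel" "v \<in> borel_measurable borel" using u v by simp_all
  have [measurable_cong]: "sets (lborel \<Otimes>\<^sub>M lborel :: ('a \<times> 'b) measure) = sets (borel \<Otimes>\<^sub>M borel)"
    by (intro sets_pair_measure_cong) auto
  have "integrable (lborel \<Otimes>\<^sub>M lborel) (\<lambda>(x, y). u x * (v y * k x y))"
  proof (rule lborel_pair_integrable_dominated[where u="\<lambda>x. norm (u x)" and V="\<lambda>_ y. norm (v y)" and C="LINT y|lborel. norm (v y)"])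
    show "norm (case (x, y) of (x, y) \<Rightarrow> u x * (v y * k x y)) \<le> norm (u x) * norm (v y)" for x y
      using mult_left_mono[OF k1[of x y], of "norm (u x) * norm (v y)"] by (simp add: norm_mult mult_ac)
  qed (use u v in auto)
  from lborel_pair.Fubini_integral[OF this]
  have "(LINT y|lborel. LINT x|lborel. u x * (v y * k x y)) = (LINT x|lborel. LINT y|lborel. u x * (v y * k x y))" .
  moreover have "(LINT x|lborel. u x * (v y * k x y)) = v y * (LINT x|lborel. u x * k x y)" for y
    unfolding mult.left_commute[of "u _" "v y"] by (rule integral_mult_right_zero)
  ultimately show ?thesis by simp
qed

text \<open>Fatou's lemma for the case where a uniform bound on the integrals is available but no
  dominating function; integrability of the limit is part of the conclusion.\<close>

lemma fatou_bound:
  fixes f :: "nat \<Rightarrow> 'a \<Rightarrow> real"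
  assumes f: "\<And>k. integrable M (f k)" "\<And>k x. 0 \<le> f k x" "\<And>k. (LINT x|M. f k x) \<le> C"
    and lim: "\<And>x. (\<lambda>k. f k x) \<longlonglongrightarrow> g x"
  shows "integrable M g" "(LINT x|M. g x) \<le> C"
proof -
  have C: "0 \<le> C" using order_trans[OF Bochner_Integration.integral_nonneg f(3)[of 0]] f(2) by simp
  have g0: "0 \<le> g x" for x by (rule LIMSEQ_le_const[OF lim]) (use f(2) in auto)
  have gm [measurable]: "g \<in> borel_measurable M"
    using f(1) by (intro borel_measurable_LIMSEQ_real[OF lim]) auto
  have "(\<integral>\<^sup>+x. ennreal (g x) \<partial>M) = (\<integral>\<^sup>+x. liminf (\<lambda>k. ennreal (f k x)) \<partial>M)"
    by (intro nn_integral_cong lim_imp_Liminf[OF trivial_limit_sequentially tendsto_ennrealI[OF lim], symmetric])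
  also have "\<dots> \<le> liminf (\<lambda>k. \<integral>\<^sup>+x. ennreal (f k x) \<partial>M)"
    using f(1) by (intro nn_integral_liminf) auto
  also have "\<dots> \<le> liminf (\<lambda>k. ennreal C)"
    using f by (intro Liminf_mono always_eventually allI) (simp add: nn_integral_eq_integral ennreal_leI)
  also have "\<dots> = ennreal C" by (simp add: Liminf_const)
  finally have le: "(\<integral>\<^sup>+x. ennreal (g x) \<partial>M) \<le> ennreal C" .
  show gi: "integrable M g"
    using le g0 by (intro integrableI_nonneg) (auto simp: le_less_trans)
  show "(LINT x|M. g x) \<le> C"
    using le C g0 by (simp add: nn_integral_eq_integral[OF gi])
qed

section \<open>The cone of nonnegative reals inside the complex numbers\<close>

lemma nonneg_Reals_iff: "z \<in> \<real>\<^sub>\<ge>\<^sub>0 \<longleftrightarrow> 0 \<le> Re z \<and> Im z = 0"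
  by (auto simp: nonneg_Reals_def complex_eq_iff intro: exI[of _ "Re z"])

lemma nonneg_Reals_of_real_mult_iff: "0 < r \<Longrightarrow> of_real r * z \<in> \<real>\<^sub>\<ge>\<^sub>0 \<longleftrightarrow> (z :: complex) \<in> \<real>\<^sub>\<ge>\<^sub>0"
  by (auto simp: nonneg_Reals_iff zero_le_mult_iff)

lemma nonneg_Reals_sum: "(\<And>i. i \<in> A \<Longrightarrow> f i \<in> \<real>\<^sub>\<ge>\<^sub>0) \<Longrightarrow> (\<Sum>i\<in>A. f i) \<in> (\<real>\<^sub>\<ge>\<^sub>0 :: complex set)"
  by (auto simp: nonneg_Reals_iff intro: sum_nonneg)

lemma nonneg_Reals_closed_lim:
  assumes "f \<longlonglongrightarrow> l" "\<And>k. f k \<in> (\<real>\<^sub>\<ge>\<^sub>0 :: complex set)"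
  shows "l \<in> \<real>\<^sub>\<ge>\<^sub>0"
proof -
  have "0 \<le> Re l"
    using tendsto_Re[OF assms(1)] assms(2) by (intro LIMSEQ_le_const) (auto simp: nonneg_Reals_iff)
  moreover have "(\<lambda>k. Im (f k)) = (\<lambda>k. 0)" using assms(2) by (auto simp: nonneg_Reals_iff)
  then have "Im l = 0" using LIMSEQ_unique[OF tendsto_Im[OF assms(1)]] by simp
  ultimately show ?thesis by (simp add: nonneg_Reals_iff)
qed

lemma nonneg_Reals_integral:
  fixes f :: "'a \<Rightarrow> complex"
  assumes "\<And>x. f x \<in> \<real>\<^sub>\<ge>\<^sub>0"
  shows "(LINT x|M. f x) \<in> \<real>\<^sub>\<ge>\<^sub>0"
proof -
  have f: "f = (\<lambda>x. of_real (Re (f x)))"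
    using assms by (auto simp: nonneg_Reals_iff complex_eq_iff)
  have "(LINT x|M. f x) = of_real (LINT x|M. Re (f x))"
    by (subst f) simp
  also have "\<dots> \<in> \<real>\<^sub>\<ge>\<^sub>0"
    using assms by (auto simp: nonneg_Reals_iff)
  finally show ?thesis .
qed

lemma nonneg_Reals_eq_of_real_norm: "z \<in> \<real>\<^sub>\<ge>\<^sub>0 \<Longrightarrow> z = of_real (norm (z::complex))"
  by (auto simp: nonneg_Reals_def)

lemma psd_functionD:
  fixes N :: nat
  shows "psd_function F \<Longrightarrow> (\<Sum>p<N. \<Sum>q<N. cnj (c p) * F (y p - y q) * c q) \<in> \<real>\<^sub>\<ge>\<^sub>0"
  by (simp add: psd_function_def psd_matrix_def)

text \<open>The character \<open>cis (x \<bullet> (y p - y q))\<close> factors and is absorbed into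
  the coefficients. Thus nonnegativity of an integral of \<open>F\<close> yields nonnegativity of
  the transform at every frequency.\<close>

lemma psd_function_modulate:
  assumes "psd_function F"
  shows "psd_function (\<lambda>w. cis (x \<bullet> w) * F w)"
  unfolding psd_function_def psd_matrix_def
proof (intro allI)
  fix N y and c :: "nat \<Rightarrow> complex"
  have "(\<Sum>p<N. \<Sum>q<N. cnj (c p * cis (- (x \<bullet> y p))) * F (y p - y q) * (c q * cis (- (x \<bullet> y q)))) \<in> \<real>\<^sub>\<ge>\<^sub>0"
    by (rule psd_functionD[OF assms])
  also have "(\<Sum>p<N. \<Sum>q<N. cnj (c p * cis (- (x \<bullet> y p))) * F (y p - y q) * (c q * cis (- (x \<bullet> y q)))) =
      (\<Sum>p<N. \<Sum>q<N. cnj (c p) * (cis (x \<bullet> (y p - y q)) * F (y p - y q)) * c q)"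
  proof (intro sum.cong refl)
    fix p q
    have "cis (x \<bullet> (y p - y q)) = cis (x \<bullet> y p) * cis (- (x \<bullet> y q))"
      by (simp add: cis_mult inner_diff_right)
    then show "cnj (c p * cis (- (x \<bullet> y p))) * F (y p - y q) * (c q * cis (- (x \<bullet> y q))) =
        cnj (c p) * (cis (x \<bullet> (y p - y q)) * F (y p - y q)) * c q"
      by (simp add: cis_cnj)
  qed
  finally show "(\<Sum>p<N. \<Sum>q<N. cnj (c p) * (cis (x \<bullet> (y p - y q)) * F (y p - y q)) * c q) \<in> \<real>\<^sub>\<ge>\<^sub>0" .
qed

lemma psd_function_sum_nonneg:
  fixes N :: nat
  assumes "psd_function F"
  shows "(\<Sum>p<N. \<Sum>q<N. F (y p - y q)) \<in> \<real>\<^sub>\<ge>\<^sub>0"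
  using psd_functionD[OF assms, where c="\<lambda>_. 1"] by simp

text \<open>Independence of two distinct coordinates, checked on rectangles: the preimage of
  \<open>A \<times> B\<close> is a cylinder over \<open>{p, q}\<close>.\<close>

lemma distr_PiM_pair:
  assumes P: "prob_space P" and pq: "p \<in> I" "q \<in> I" "p \<noteq> q"
  shows "distr (PiM I (\<lambda>_. P)) (P \<Otimes>\<^sub>M P) (\<lambda>\<omega>. (\<omega> p, \<omega> q)) = P \<Otimes>\<^sub>M P"
proof -
  interpret P: prob_space P by fact
  interpret Q: product_prob_space "\<lambda>_. P" I ..
  have m [measurable]: "(\<lambda>\<omega>. (\<omega> p, \<omega> q)) \<in> PiM I (\<lambda>_. P) \<rightarrow>\<^sub>M P \<Otimes>\<^sub>M P"
    using pq by measurable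
  show ?thesis
  proof (rule pair_measure_eqI[symmetric])
    fix A B assume AB [measurable]: "A \<in> sets P" "B \<in> sets P"
    define X where "X i = (if i = p then A else B)" for i
    have "emeasure (distr (PiM I (\<lambda>_. P)) (P \<Otimes>\<^sub>M P) (\<lambda>\<omega>. (\<omega> p, \<omega> q))) (A \<times> B) =
        emeasure (PiM I (\<lambda>_. P)) ((\<lambda>\<omega>. (\<omega> p, \<omega> q)) -` (A \<times> B) \<inter> space (PiM I (\<lambda>_. P)))"
      by (intro emeasure_distr) auto
    also have "(\<lambda>\<omega>. (\<omega> p, \<omega> q)) -` (A \<times> B) \<inter> space (PiM I (\<lambda>_. P)) =
        prod_emb I (\<lambda>_. P) {p, q} (PiE {p, q} X)"
      using pq by (auto simp: prod_emb_def space_PiM X_def PiE_iff)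
    also have "emeasure (PiM I (\<lambda>_. P)) \<dots> = (\<Prod>i\<in>{p, q}. emeasure P (X i))"
      using pq by (intro Q.emeasure_PiM_emb) (auto simp: X_def)
    also have "\<dots> = emeasure P A * emeasure P B" using pq by (simp add: X_def)
    finally show "emeasure P A * emeasure P B =
        emeasure (distr (PiM I (\<lambda>_. P)) (P \<Otimes>\<^sub>M P) (\<lambda>\<omega>. (\<omega> p, \<omega> q))) (A \<times> B)" by simp
  qed (auto intro: P.sigma_finite_measure_axioms)
qed

text \<open>Averaging the sums in the definition of positive semidefiniteness over \<open>N\<close> independent
  samples of \<open>P\<close> gives \<open>N F(0) + N (N - 1) I \<ge> 0\<close>, and then \<open>N \<rightarrow> \<infinity>\<close>.\<close>

lemma psd_function_double_integral_nonneg: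
  fixes F :: "real ^ 'n \<Rightarrow> complex"
  assumes F: "psd_function F" "bounded (range F)" and Fm [measurable]: "F \<in> borel_measurable borel"
    and P: "prob_space P" and Ps [measurable_cong]: "sets P = sets borel"
  shows "(LINT w|(P \<Otimes>\<^sub>M P). F (fst w - snd w)) \<in> \<real>\<^sub>\<ge>\<^sub>0" (is "?I \<in> _")
proof -
  interpret P: prob_space P by fact
  obtain B where B: "\<And>x. norm (F x) \<le> B" using F(2) by (auto simp: bounded_iff)
  have *: "of_nat N * F 0 + of_nat (N * (N - 1)) * ?I \<in> \<real>\<^sub>\<ge>\<^sub>0" for N
  proof -
    define Q where "Q = PiM {..<N} (\<lambda>_. P)"
    interpret PP: product_prob_space "\<lambda>_. P" "{..<N}" ..
    interpret Q: prob_space Q unfolding Q_def by (rule PP.prob_space_axioms)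
    have [measurable]: "(\<lambda>\<omega>. \<omega> p) \<in> borel_measurable Q" if "p < N" for p
      using measurable_component_singleton[of p "{..<N}" "\<lambda>_. P"] that
      unfolding Q_def measurable_cong_sets[OF refl Ps] by simp
    have mm: "(\<lambda>\<omega>. F (\<omega> p - \<omega> q)) \<in> borel_measurable Q" if "p < N" "q < N" for p q
      using that by measurable
    have i: "integrable Q (\<lambda>\<omega>. F (\<omega> p - \<omega> q))" if "p < N" "q < N" for p q
      by (rule Q.integrable_const_bound[where B=B]) (use B mm[OF that] in auto)
    have off: "(LINT \<omega>|Q. F (\<omega> p - \<omega> q)) = ?I" if "p < N" "q < N" "p \<noteq> q" for p q
    proof -
      have m: "(\<lambda>\<omega>. (\<omega> p, \<omega> q)) \<in> Q \<rightarrow>\<^sub>M P \<Otimes>\<^sub>M P"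
        using that measurable_component_singleton[of _ "{..<N}" "\<lambda>_. P"]
        unfolding Q_def by (intro measurable_Pair) auto
      have "?I = (LINT w|distr Q (P \<Otimes>\<^sub>M P) (\<lambda>\<omega>. (\<omega> p, \<omega> q)). F (fst w - snd w))"
        unfolding Q_def using that by (subst distr_PiM_pair[OF P]) auto
      also have "\<dots> = (LINT \<omega>|Q. F (fst (\<omega> p, \<omega> q) - snd (\<omega> p, \<omega> q)))"
        by (rule integral_distr[OF m]) measurable
      finally show ?thesis by simp
    qed
    have "(LINT \<omega>|Q. (\<Sum>p<N. \<Sum>q<N. F (\<omega> p - \<omega> q))) \<in> \<real>\<^sub>\<ge>\<^sub>0"
      by (intro nonneg_Reals_integral psd_function_sum_nonneg F)
    also have "(LINT \<omega>|Q. (\<Sum>p<N. \<Sum>q<N. F (\<omega> p - \<omega> q))) = (\<Sum>p<N. \<Sum>q<N. LINT \<omega>|Q. F (\<omega> p - \<omega> q))"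
      using i by (subst Bochner_Integration.integral_sum) (auto intro!: sum.cong Bochner_Integration.integral_sum)
    \<comment> \<open>On the diagonal the argument of \<open>F\<close> vanishes; each of the other
      \<open>N - 1\<close> terms depends only on the joint law of two independent samples.\<close>
    also have "\<dots> = (\<Sum>p<N. F 0 + of_nat (N - 1) * ?I)"
    proof (intro sum.cong refl)
      fix p assume p: "p \<in> {..<N}"
      have "(\<Sum>q<N. LINT \<omega>|Q. F (\<omega> p - \<omega> q)) = (LINT \<omega>|Q. F (\<omega> p - \<omega> p)) + (\<Sum>q\<in>{..<N}-{p}. LINT \<omega>|Q. F (\<omega> p - \<omega> q))"
        using p by (intro sum.remove) auto
      also have "(\<Sum>q\<in>{..<N}-{p}. LINT \<omega>|Q. F (\<omega> p - \<omega> q)) = (\<Sum>q\<in>{..<N}-{p}. ?I)"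
        using p by (intro sum.cong refl off) auto
      finally show "(\<Sum>q<N. LINT \<omega>|Q. F (\<omega> p - \<omega> q)) = F 0 + of_nat (N - 1) * ?I"
        using p by (simp add: Q.prob_space)
    qed
    also have "\<dots> = of_nat N * F 0 + of_nat (N * (N - 1)) * ?I"
      by (simp add: algebra_simps)
    finally show ?thesis .
  qed
  \<comment> \<open>One sample shows that \<open>F 0\<close> is real and nonnegative, two samples
    that the double integral is real; only its sign calls for many samples.\<close>
  have F0: "0 \<le> Re (F 0)" "Im (F 0) = 0" using *[of 1] by (auto simp: nonneg_Reals_iff)
  have "Im ?I = 0" using *[of 2] F0 by (auto simp: nonneg_Reals_iff)
  moreover have "0 \<le> Re ?I"
  proof (rule ccontr)
    assume neg: "\<not> 0 \<le> Re ?I"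
    \<comment> \<open>With \<open>N = k + 1\<close> samples, division by \<open>N\<close> leaves
      \<open>Re (F 0) + k * Re ?I \<ge> 0\<close>, which fails for large \<open>k\<close> if
      \<open>Re ?I\<close> is negative.\<close>
    obtain k :: nat where k: "Re (F 0) < real k * (- Re ?I)"
      using reals_Archimedean3[of "- Re ?I"] neg by force
    have "0 \<le> real (Suc k) * Re (F 0) + real (Suc k * k) * Re ?I"
      using *[of "Suc k"] by (simp add: nonneg_Reals_iff del: of_nat_Suc of_nat_mult)
    also have "\<dots> = real (Suc k) * (Re (F 0) + real k * Re ?I)"
      by (simp add: algebra_simps)
    finally have "0 \<le> Re (F 0) + real k * Re ?I"
      by (simp add: zero_le_mult_iff)
    with k show False by simp
  qed
  ultimately show ?thesis by (simp add: nonneg_Reals_iff)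
qed

text \<open>Completing the square in \<open>z\<close>: the joint density of two samples separates
  into a Gaussian in their difference \<open>w\<close> and one in their midpoint
  \<open>z + w /\<^sub>R 2\<close>.\<close>

lemma gauss_mult_shift:
  "gauss a z * gauss a (w + z) = gauss (a / 2) w * gauss (2 * a) (z + w /\<^sub>R 2)"
proof -
  have "(norm z)\<^sup>2 + (norm (w + z))\<^sup>2 = (norm w)\<^sup>2 / 2 + 2 * (norm (z + w /\<^sub>R 2))\<^sup>2"
    unfolding power2_norm_eq_inner by (simp add: algebra_simps inner_commute)
  then have "a * ((norm z)\<^sup>2 + (norm (w + z))\<^sup>2) = a * ((norm w)\<^sup>2 / 2 + 2 * (norm (z + w /\<^sub>R 2))\<^sup>2)"
    by simp
  then have "- (a * (norm z)\<^sup>2 / 2) + - (a * (norm (w + z))\<^sup>2 / 2) =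
     - (a / 2 * (norm w)\<^sup>2 / 2) + - (2 * a * (norm (z + w /\<^sub>R 2))\<^sup>2 / 2)"
    unfolding distrib_left by linarith
  then show ?thesis unfolding gauss_def exp_add[symmetric] by simp
qed

text \<open>The difference of two independent Gaussian vectors is Gaussian, so the nonnegative
  double integral over samples is a positive multiple of this single integral.\<close>

lemma psd_function_gauss_integral_nonneg:
  fixes F :: "real ^ 'n \<Rightarrow> complex"
  assumes F: "psd_function F" "bounded (range F)" "continuous_on UNIV F" and "0 < s"
  shows "(LINT w|lborel. F w * of_real (gauss s w)) \<in> \<real>\<^sub>\<ge>\<^sub>0"
proof -
  \<comment> \<open>Taking differences halves the parameter, so samples of parameter
    \<open>2 * s\<close> produce the weight \<open>gauss s\<close>.\<close>
  define a where "a = 2 * s"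
  have a: "0 < a" using assms(4) by (simp add: a_def)
  have Fm [measurable]: "F \<in> borel_measurable borel" by (rule borel_measurable_continuous_onI[OF F(3)])
  obtain B where B: "\<And>x. norm (F x) \<le> B" using F(2) by (auto simp: bounded_iff)
  have B0: "0 \<le> B" using order_trans[OF norm_ge_zero B] .
  define C where "C = (LINT x|lborel. gauss a (x::real^'n))"
  have C: "0 < C" unfolding C_def integral_gauss[OF a] using a by simp
  define D where "D = (LINT x|lborel. gauss (2 * a) (x::real^'n))"
  have D: "0 < D" unfolding D_def using integral_gauss[of "2 * a", where 'a="real^'n"] a by simp
  define P where "P = density lborel (\<lambda>x::real^'n. ennreal (gauss a x / C))"
  have Ps [measurable_cong]: "sets P = sets borel" by (simp add: P_def)
  have gi: "integrable lborel (gauss a :: real^'n \<Rightarrow> real)" by (rule integrable_gauss[OF a])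
  have "prob_space P"
  proof
    have "emeasure P (space P) = (\<integral>\<^sup>+x. ennreal (gauss a (x::real^'n) / C) \<partial>lborel)"
      unfolding P_def by (subst emeasure_density) auto
    also have "\<dots> = ennreal (LINT x|lborel. gauss a (x::real^'n) / C)"
      using gi C by (intro nn_integral_eq_integral) (auto simp: gauss_pos less_imp_le)
    also have "\<dots> = 1" using C by (simp add: C_def)
    finally show "emeasure P (space P) = 1" .
  qed
  then interpret P: prob_space P .
  interpret PP: pair_prob_space P P ..
  have I: "(LINT w|(P \<Otimes>\<^sub>M P). F (fst w - snd w)) \<in> \<real>\<^sub>\<ge>\<^sub>0"
    by (rule psd_function_double_integral_nonneg[OF F(1,2) Fm \<open>prob_space P\<close> Ps])
  have int: "integrable (P \<Otimes>\<^sub>M P) (\<lambda>(y, z). F (y - z))"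
    by (rule PP.integrable_const_bound[where B=B]) (use B in auto)
  have "(LINT w|(P \<Otimes>\<^sub>M P). F (fst w - snd w)) = (LINT z|P. LINT y|P. F (y - z))"
    using PP.integral_snd[OF int] by (simp add: case_prod_unfold)
  also have "\<dots> = (LINT z|lborel. (gauss a z / C) *\<^sub>R (LINT y|lborel. (gauss a y / C) *\<^sub>R F (y - z)))"
  proof -
    have dens: "(LINT z|P. J z) = (LINT z|lborel. (gauss a z / C) *\<^sub>R J z)"
      if "J \<in> borel_measurable borel" for J :: "real^'n \<Rightarrow> complex"
      unfolding P_def using C that by (intro integral_density) (auto simp: gauss_pos less_imp_le)
    have inner: "(LINT y|P. F (y - z)) = (LINT y|lborel. (gauss a y / C) *\<^sub>R F (y - z))" for z
      by (rule dens) measurable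
    have "(\<lambda>z. LINT y|lborel. (gauss a y / C) *\<^sub>R F (y - z)) \<in> borel_measurable borel" by measurable
    then show ?thesis unfolding inner by (rule dens)
  qed
  also have "\<dots> = (LINT z|lborel. of_real (gauss a z / C) * (LINT w|lborel. of_real (gauss a (w + z) / C) * F w))"
  proof (intro Bochner_Integration.integral_cong refl)
    fix z :: "real^'n"
    have "(LINT y|lborel. (gauss a y / C) *\<^sub>R F (y - z)) = (LINT w|lborel. (gauss a (z + w) / C) *\<^sub>R F (z + w - z))"
      using lborel_integral_plus[of "\<lambda>y. (gauss a y / C) *\<^sub>R F (y - z)" z] by simp
    then show "(gauss a z / C) *\<^sub>R (LINT y|lborel. (gauss a y / C) *\<^sub>R F (y - z)) =
       of_real (gauss a z / C) * (LINT w|lborel. of_real (gauss a (w + z) / C) * F w)"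
      by (auto simp: scaleR_conv_of_real add.commute)
  qed
  also have "\<dots> = (LINT z|lborel. LINT w|lborel. of_real (gauss a z * gauss a (w + z) / C\<^sup>2) * F w)"
    by (simp add: power2_eq_square mult_ac flip: integral_mult_right_zero)
  also have "\<dots> = (LINT w|lborel. LINT z|lborel. of_real (gauss a z * gauss a (w + z) / C\<^sup>2) * F w)"
  proof (rule lborel_pair.Fubini_integral[symmetric, OF lborel_pair_integrable_dominated])
    show "norm (case (z, w) of (z, w) \<Rightarrow> of_real (gauss a z * gauss a (w + z) / C\<^sup>2) * F w)
        \<le> gauss a z * (B / C\<^sup>2 * gauss a (z + w))" for z w
    proof -
      have "norm (of_real (gauss a z * gauss a (w + z) / C\<^sup>2) * F w) =
          gauss a z * (norm (F w) / C\<^sup>2 * gauss a (z + w))"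
        using gauss_pos[of a z] gauss_pos[of a "w + z"] by (simp add: norm_mult norm_divide norm_power abs_of_pos add.commute)
      also have "\<dots> \<le> gauss a z * (B / C\<^sup>2 * gauss a (z + w))"
        using gauss_pos[of a z] gauss_pos[of a "z + w"] by (intro mult_left_mono mult_right_mono divide_right_mono B) (auto simp: less_imp_le)
      finally show ?thesis by simp
    qed
    show "integrable lborel (\<lambda>w. B / C\<^sup>2 * gauss a (z + w))" for z :: "real^'n"
      by (intro integrable_mult_right lborel_integrable_plus gi)
    show "(LINT w|lborel. B / C\<^sup>2 * gauss a (z + w)) \<le> B / C\<^sup>2 * C" for z :: "real^'n"
      by (simp add: lborel_integral_plus C_def)
  qed (use gi in \<open>auto simp: gauss_pos less_imp_le\<close>)
  \<comment> \<open>For fixed \<open>w\<close> the Gaussian in the midpoint integrates to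
    \<open>D\<close>, whatever the shift, which leaves only a positive constant.\<close>
  also have "\<dots> = (LINT w|lborel. of_real (D / C\<^sup>2) * (F w * of_real (gauss s w)))"
  proof (intro Bochner_Integration.integral_cong refl)
    fix w :: "real^'n"
    have e: "gauss a z * gauss a (w + z) = gauss s w * gauss (2 * a) (w /\<^sub>R 2 + z)" for z
      using gauss_mult_shift[of a z w] by (simp add: a_def add.commute)
    have "(LINT z|lborel. of_real (gauss a z * gauss a (w + z) / C\<^sup>2) * F w) =
        (LINT z|lborel. (of_real (gauss s w / C\<^sup>2) * F w) * of_real (gauss (2 * a) (w /\<^sub>R 2 + z)))"
      unfolding e by (intro Bochner_Integration.integral_cong) auto
    also have "\<dots> = (of_real (gauss s w / C\<^sup>2) * F w) * of_real D"
      using lborel_integral_plus[of "gauss (2 * a)" "w /\<^sub>R 2"] by (simp add: D_def)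
    finally show "(LINT z|lborel. of_real (gauss a z * gauss a (w + z) / C\<^sup>2) * F w) =
       of_real (D / C\<^sup>2) * (F w * of_real (gauss s w))" by (simp add: mult_ac)
  qed
  also have "\<dots> = of_real (D / C\<^sup>2) * (LINT w|lborel. F w * of_real (gauss s w))"
    by simp
  finally have "of_real (D / C\<^sup>2) * (LINT w|lborel. F w * of_real (gauss s w)) \<in> \<real>\<^sub>\<ge>\<^sub>0"
    using I by simp
  moreover have "0 < D / C\<^sup>2" using C D by simp
  ultimately show ?thesis
    using nonneg_Reals_of_real_mult_iff by blast
qed

text \<open>Young's inequality for \<open>t\<close> and \<open>s powr (p - 1)\<close> with the
  conjugate exponents p and \<open>p / (p - 1)\<close>. The degenerate values \<open>p = 1\<close>
  and \<open>s = 0\<close> are treated directly.\<close>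

lemma powr_above_tangent:
  fixes s t p :: real
  assumes "0 \<le> s" "0 \<le> t" "1 \<le> p"
  shows "s powr p + p * s powr (p - 1) * (t - s) \<le> t powr p"
proof (cases "p = 1 \<or> s = 0")
  case True
  then show ?thesis using assms by (cases "s = 0") auto
next
  case False
  then have p: "1 < p" and s: "0 < s" using assms by auto
  define q where "q = p / (p - 1)"
  have "t * s powr (p - 1) \<le> t powr p / p + (s powr (p - 1)) powr q / q"
    using p assms(2) by (intro Youngs_inequality) (auto simp: q_def field_simps)
  also have "(s powr (p - 1)) powr q = s powr p"
    using p by (simp add: powr_powr q_def)
  finally have "p * (t * s powr (p - 1)) \<le> t powr p + (p - 1) * s powr p"
    using p by (simp add: q_def field_simps)
  moreover have "s powr p = s powr (p - 1) * s"
    using s by (metis add.commute diff_add_cancel powr_mult_base mult.commute less_imp_le)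
  ultimately show ?thesis by (simp add: algebra_simps)
qed

text \<open>Convexity in the form of the tangent inequality replaces Hoelder's and Minkowski's
  inequalities.\<close>

lemma pint_convolution_le:
  fixes \<phi> :: "real ^ 'n \<Rightarrow> complex" and K :: "real ^ 'n \<Rightarrow> real"
  assumes \<phi>: "\<phi> \<in> test_functions" and K: "integrable lborel K" "\<And>x. 0 \<le> K x"
    and M: "(LINT x|lborel. K x) \<le> M" "0 < M" and p: "1 \<le> p"
  shows "integrable lborel (\<lambda>x. norm (LINT z|lborel. \<phi> z * of_real (K (x - z))) powr p)"
    and "(LINT x|lborel. norm (LINT z|lborel. \<phi> z * of_real (K (x - z))) powr p) \<le>
      M powr p * (LINT z|lborel. norm (\<phi> z) powr p)"
proof -
  have [measurable]: "\<phi> \<in> borel_measurable borel"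
    using integrable_test_function[OF \<phi>] by simp
  have [measurable]: "K \<in> borel_measurable borel" using K(1) by simp
  obtain B where B: "\<And>x. norm (\<phi> x) \<le> B" using test_functions_bounded[OF \<phi>] by metis
  define W where "W = (LINT x|lborel. K x)"
  have Ki: "integrable lborel (\<lambda>z. K (x - z))" for x
    using lborel_integrable_minus[OF lborel_integrable_plus[OF K(1)], of x] by simp
  have KW: "(LINT z|lborel. K (x - z)) = W" for x
    using lborel_integral_minus[of "\<lambda>z. K (x + z)"] lborel_integral_plus[of K x] by (simp add: W_def)
  have \<phi>K: "integrable lborel (\<lambda>z. norm (\<phi> z) powr r * K (x - z))" if "0 \<le> r" for r x
  proof (rule Bochner_Integration.integrable_bound)
    show "integrable lborel (\<lambda>z. B powr r * K (x - z))" using Ki by simp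
    show "AE z in lborel. norm (norm (\<phi> z) powr r * K (x - z)) \<le> norm (B powr r * K (x - z))"
      using B K(2) that by (intro AE_I2) (auto simp: abs_mult intro!: mult_right_mono powr_mono2)
  qed measurable
  have \<phi>K1: "integrable lborel (\<lambda>z. norm (\<phi> z) * K (x - z))" for x
    using \<phi>K[of 1 x] by simp
  define A where "A x = (LINT z|lborel. norm (\<phi> z) * K (x - z))" for x
  define J where "J x = (LINT z|lborel. norm (\<phi> z) powr p * K (x - z))" for x
  have A0: "0 \<le> A x" for x unfolding A_def using K(2) by simp
  have J0: "0 \<le> J x" for x unfolding J_def using K(2) by simp
  define g where "g x = (LINT z|lborel. \<phi> z * of_real (K (x - z)))" for x
  have gm [measurable]: "g \<in> borel_measurable borel" unfolding g_def by measurable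
  have gA: "norm (g x) \<le> A x" for x
  proof -
    have "norm (g x) \<le> (LINT z|lborel. norm (\<phi> z * of_real (K (x - z))))"
      unfolding g_def by (rule integral_norm_bound)
    then show ?thesis using K(2) by (simp add: A_def norm_mult)
  qed
  have AJ: "A x powr p \<le> M powr (p - 1) * J x" for x
  proof -
    \<comment> \<open>The point of tangency is the integral of \<open>norm (\<phi> z)\<close>
      against \<open>K (x - z) / M\<close>. The mass \<open>W\<close> may be smaller than
      \<open>M\<close>; this goes in the right direction because \<open>W\<close> carries the
      nonpositive coefficient \<open>(1 - p) * s powr p\<close>.\<close>
    define s where "s = A x / M"
    have s: "0 \<le> s" "A x = M * s" using A0 M(2) by (auto simp: s_def)
    have sp: "s * s powr (p - 1) = s powr p"
      using s(1) by (cases "s = 0") (auto simp: powr_diff)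
    have "M * s powr p \<le> (1 - p) * s powr p * W + p * s powr (p - 1) * A x"
    proof -
      have "(p - 1) * s powr p * W \<le> (p - 1) * s powr p * M"
        using p M(1) by (intro mult_left_mono) (auto simp: W_def)
      moreover have "p * s powr (p - 1) * A x = p * M * s powr p"
        unfolding s(2) sp[symmetric] by simp
      moreover have "(1 - p) * s powr p * W = - ((p - 1) * s powr p * W)"
        "(p - 1) * s powr p * M = p * M * s powr p - M * s powr p"
        by (simp_all add: algebra_simps)
      ultimately show ?thesis by linarith
    qed
    also have "\<dots> = (LINT z|lborel. (1 - p) * s powr p * K (x - z) + p * s powr (p - 1) * (norm (\<phi> z) * K (x - z)))"
      using Ki \<phi>K1 by (simp add: KW A_def)
    also have "\<dots> \<le> J x"
      unfolding J_def
    proof (rule integral_mono)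
      show "integrable lborel (\<lambda>z. (1 - p) * s powr p * K (x - z) + p * s powr (p - 1) * (norm (\<phi> z) * K (x - z)))"
        using Ki \<phi>K1 by simp
      show "integrable lborel (\<lambda>z. norm (\<phi> z) powr p * K (x - z))" using \<phi>K p by simp
      show "(1 - p) * s powr p * K (x - z) + p * s powr (p - 1) * (norm (\<phi> z) * K (x - z)) \<le>
          norm (\<phi> z) powr p * K (x - z)" for z
      proof -
        have "(1 - p) * s powr p + p * s powr (p - 1) * norm (\<phi> z) \<le> norm (\<phi> z) powr p"
          using powr_above_tangent[OF s(1) norm_ge_zero[of "\<phi> z"] p] sp by (simp add: algebra_simps)
        from mult_right_mono[OF this K(2)[of "x - z"]] show ?thesis by (simp add: algebra_simps)
      qed
    qed
    finally have "M powr (p - 1) * (M * s powr p) \<le> M powr (p - 1) * J x"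
      using M(2) by (intro mult_left_mono) auto
    moreover have "A x powr p = M powr (p - 1) * (M * s powr p)"
      using M(2) s by (simp add: powr_mult powr_diff)
    ultimately show ?thesis by simp
  qed
  have \<phi>p: "integrable lborel (\<lambda>z. norm (\<phi> z) powr p)"
  proof -
    have "integrable lebesgue (\<lambda>z. norm (\<phi> z) powr p)"
      using pintegrable_test_function[OF \<phi>, of p] p by (simp add: pintegrable_def)
    then show ?thesis by (subst (asm) integrable_completion) auto
  qed
  have Ki': "integrable lborel (\<lambda>x. K (x - z))" "(LINT x|lborel. K (x - z)) = W" for z
    using lborel_integrable_plus[OF K(1), of "- z"] lborel_integral_plus[of K "- z"] by (simp_all add: W_def)
  have pair: "integrable (lborel \<Otimes>\<^sub>M lborel) (\<lambda>(z, x). norm (\<phi> z) powr p * K (x - z))"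
    by (rule lborel_pair_integrable_dominated[where u="\<lambda>z. norm (\<phi> z) powr p" and V="\<lambda>z x. K (x - z)" and C=W])
      (use \<phi>p Ki' K(2) in \<open>auto simp: abs_mult\<close>)
  have Ji: "integrable lborel J"
    unfolding J_def by (rule lborel_pair.integrable_snd[OF pair])
  \<comment> \<open>Integrating over \<open>x\<close> first, every translate of \<open>K\<close>
    contributes the same mass \<open>W\<close>.\<close>
  have "(LINT x|lborel. J x) = (LINT z|lborel. LINT x|lborel. norm (\<phi> z) powr p * K (x - z))"
    unfolding J_def by (rule lborel_pair.Fubini_integral[OF pair])
  also have "\<dots> = W * (LINT z|lborel. norm (\<phi> z) powr p)"
    by (simp add: Ki' mult.commute)
  also have "\<dots> \<le> M * (LINT z|lborel. norm (\<phi> z) powr p)"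
    using M(1) by (intro mult_right_mono) (auto simp: W_def)
  finally have JM: "(LINT x|lborel. J x) \<le> M * (LINT z|lborel. norm (\<phi> z) powr p)" .
  have gJ: "norm (g x) powr p \<le> M powr (p - 1) * J x" for x
    using AJ[of x] gA[of x] p by (meson norm_ge_zero order_trans powr_mono2 zero_le_one)
  have gi: "integrable lborel (\<lambda>x. norm (g x) powr p)"
  proof (rule Bochner_Integration.integrable_bound)
    show "integrable lborel (\<lambda>x. M powr (p - 1) * J x)" using Ji by simp
    show "AE x in lborel. norm (norm (g x) powr p) \<le> norm (M powr (p - 1) * J x)"
      using order_trans[OF gJ abs_ge_self] by simp
  qed measurable
  have "(LINT x|lborel. norm (g x) powr p) \<le> (LINT x|lborel. M powr (p - 1) * J x)"
    using gi Ji gJ by (intro integral_mono) auto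
  also have "\<dots> \<le> M powr (p - 1) * (M * (LINT z|lborel. norm (\<phi> z) powr p))"
    using JM by (simp add: mult_left_mono)
  also have "\<dots> = M powr p * (LINT z|lborel. norm (\<phi> z) powr p)"
    using M(2) by (simp add: powr_diff)
  finally show "(LINT x|lborel. norm (LINT z|lborel. \<phi> z * of_real (K (x - z))) powr p) \<le>
      M powr p * (LINT z|lborel. norm (\<phi> z) powr p)" by (simp add: g_def)
  show "integrable lborel (\<lambda>x. norm (LINT z|lborel. \<phi> z * of_real (K (x - z))) powr p)"
    using gi by (simp add: g_def)
qed

section \<open>The regularized kernels and the passage to the limit\<close>

lemma ft_minus: "ft F (- x) = (LINT w|lborel. F w * cis (x \<bullet> w))"
  by (simp add: ft_def mult.commute)

context
  fixes F :: "real ^ 'n \<Rightarrow> complex" and B :: real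
  assumes psd: "psd_function F" and B: "\<And>x. norm (F x) \<le> B" and B_pos: "0 < B"
    and cF: "continuous_on UNIV F"
begin

text \<open>Up to normalization, the convolution kernel of the multiplier \<open>F\<close> damped by
  a Gaussian; the damping makes the defining integral absolutely convergent.\<close>

definition kernel :: "real \<Rightarrow> real ^ 'n \<Rightarrow> complex" where
  "kernel s x = ft (\<lambda>w. F w * of_real (gauss s w)) (- x)"

lemma kernel_integral: "kernel s x = (LINT w|lborel. (F w * of_real (gauss s w)) * cis (x \<bullet> w))"
  by (simp only: kernel_def ft_minus)

lemma bounded_F: "bounded (range F)"
  using B by (auto simp: bounded_iff)

lemma F_measurable [measurable]: "F \<in> borel_measurable borel"
  by (rule borel_measurable_continuous_onI[OF cF])

lemma integrable_F_gauss: "0 < s \<Longrightarrow> integrable lborel (\<lambda>w. F w * of_real (gauss s w))"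
  using integrable_gauss[of s, where 'a="real^'n"]
  by (intro integrable_bounded_mult bounded_F) auto

text \<open>The value at \<open>x\<close> is the Gaussian integral of \<open>F\<close> modulated by
  a character, and modulation preserves positive semidefiniteness.\<close>

lemma kernel_nonneg: "0 < s \<Longrightarrow> kernel s x \<in> \<real>\<^sub>\<ge>\<^sub>0"
proof -
  assume s: "0 < s"
  have "(LINT w|lborel. (cis (x \<bullet> w) * F w) * of_real (gauss s w)) \<in> \<real>\<^sub>\<ge>\<^sub>0"
  proof (rule psd_function_gauss_integral_nonneg[OF psd_function_modulate[OF psd] _ _ s])
    show "bounded (range (\<lambda>w. cis (x \<bullet> w) * F w))"
      using B by (auto simp: bounded_iff norm_mult)
    show "continuous_on UNIV (\<lambda>w. cis (x \<bullet> w) * F w)"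
      by (intro continuous_intros cF)
  qed
  then show ?thesis by (simp add: kernel_def ft_def mult.assoc)
qed

text \<open>Writing the complex kernel through its norm supplies the real nonnegative kernel that
  the convolution estimate expects.\<close>

lemma kernel_eq: "0 < s \<Longrightarrow> kernel s x = of_real (norm (kernel s x))"
  by (rule nonneg_Reals_eq_of_real_norm[OF kernel_nonneg])

lemma continuous_kernel: "0 < s \<Longrightarrow> continuous_on UNIV (kernel s)"
  unfolding kernel_def
  by (rule continuous_on_compose2[OF continuous_on_ft[OF integrable_F_gauss]]) (auto intro: continuous_intros)

text \<open>Pairing the kernel with a wide Gaussian moves the Fourier transform onto that Gaussian,
  whose transform has total mass \<open>(2\<pi>)\<^sup>n\<close> independently of its width.\<close>

lemma kernel_gauss_le:
  assumes s: "0 < s" and t: "0 < t"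
  shows "(LINT x|lborel. norm (kernel s x) * gauss t x) \<le> B * (2 * pi) ^ CARD('n)"
proof -
  let ?g = "\<lambda>w::real^'n. sqrt (2 * pi / t) ^ CARD('n) * gauss (1 / t) w"
  have gt: "integrable lborel (\<lambda>x::real^'n. complex_of_real (gauss t x))"
    using integrable_gauss[OF t, where 'a="real^'n"] by simp
  have "of_real (LINT x|lborel. norm (kernel s x) * gauss t x) =
      (LINT x|lborel. complex_of_real (norm (kernel s x) * gauss t x))"
    by (rule integral_complex_of_real[symmetric])
  also have "\<dots> = (LINT x|lborel. of_real (gauss t x) * (LINT w|lborel. (F w * of_real (gauss s w)) * cis (x \<bullet> w)))"
    by (intro Bochner_Integration.integral_cong refl)
      (simp only: of_real_mult kernel_eq[OF s, symmetric] kernel_integral[symmetric], rule mult.commute)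
  also have "\<dots> = (LINT w|lborel. (F w * of_real (gauss s w)) * (LINT x|lborel. of_real (gauss t x) * cis (x \<bullet> w)))"
    by (rule Fubini_bounded_kernel[OF gt integrable_F_gauss[OF s]]) auto
  also have "\<dots> = (LINT w|lborel. (F w * of_real (gauss s w)) * ft (\<lambda>x. of_real (gauss t x)) (- w))"
    unfolding ft_minus by (simp add: inner_commute)
  also have "\<dots> = (LINT w|lborel. (F w * of_real (gauss s w)) * of_real (?g w))"
    by (simp add: ft_gauss[OF t] gauss_minus)
  finally have eq: "of_real (LINT x|lborel. norm (kernel s x) * gauss t x) =
     (LINT w|lborel. (F w * of_real (gauss s w)) * of_real (?g w))" .
  have gt': "integrable lborel (gauss (1 / t) :: real^'n \<Rightarrow> real)"
    using t by (intro integrable_gauss) simp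
  have "norm (complex_of_real (LINT x|lborel. norm (kernel s x) * gauss t x)) \<le>
      (LINT w::real^'n|lborel. B * sqrt (2 * pi / t) ^ CARD('n) * gauss (1 / t) w)"
    unfolding eq
  proof (rule Bochner_Integration.integral_norm_bound_integral)
    have "integrable lborel (\<lambda>w. F w * (of_real (gauss s w) * of_real (?g w)))"
    proof (rule integrable_bounded_mult[OF bounded_F F_measurable], rule Bochner_Integration.integrable_bound)
      show "integrable lborel ?g" using gt' by simp
      show "AE w in lborel. norm (complex_of_real (gauss s w) * of_real (?g w))
          \<le> norm (?g w)"
        unfolding norm_mult norm_of_real real_norm_def[symmetric]
        using gauss_le_1[of s] gauss_pos[of s] s
        by (intro AE_I2 mult_left_le_one_le) (auto simp: gauss_le_1 gauss_pos less_imp_le abs_of_pos)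
    qed measurable
    then show "integrable lborel (\<lambda>w. (F w * of_real (gauss s w)) * of_real (?g w))"
      by (simp add: mult.assoc)
    show "integrable lborel (\<lambda>w::real^'n. B * sqrt (2 * pi / t) ^ CARD('n) * gauss (1 / t) w)" using gt' by simp
    fix w :: "real^'n"
    have "norm ((F w * of_real (gauss s w)) * of_real (?g w)) =
        (norm (F w) * gauss s w) * ?g w"
      using t gauss_pos[of s w] gauss_pos[of "1/t" w] by (simp add: norm_mult norm_power abs_of_pos)
    also have "\<dots> \<le> (B * 1) * ?g w"
      using t s B B_pos gauss_pos[of s w] gauss_pos[of "1/t" w] gauss_le_1[of s w]
      by (intro mult_right_mono mult_mono) (auto simp: less_imp_le)
    finally show "norm ((F w * of_real (gauss s w)) * of_real (?g w))
        \<le> B * sqrt (2 * pi / t) ^ CARD('n) * gauss (1 / t) w" by simp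
  qed
  also have "\<dots> = B * (sqrt (2 * pi / t) * sqrt (2 * pi / (1 / t))) ^ CARD('n)"
    using t integral_gauss[of "1 / t", where 'a="real^'n"] by (simp add: power_mult_distrib)
  also have "sqrt (2 * pi / t) * sqrt (2 * pi / (1 / t)) = 2 * pi"
  proof -
    have "(2 * pi / t) * (2 * pi / (1 / t)) = (2 * pi)\<^sup>2" using t by (simp add: power2_eq_square)
    then have "sqrt (2 * pi / t) * sqrt (2 * pi / (1 / t)) = \<bar>2 * pi\<bar>"
      by (simp only: real_sqrt_mult[symmetric] real_sqrt_abs)
    then show ?thesis by simp
  qed
  finally show ?thesis by simp
qed

text \<open>Beforehand the kernel is known only to be continuous and bounded, which suffices against
  each Gaussian weight. The bound there does not depend on the weight, so letting the weight
  increase to 1 yields integrability and the mass bound together.\<close>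

lemma
  assumes s: "0 < s"
  shows integrable_kernel: "integrable lborel (\<lambda>x. norm (kernel s x))"
    and integral_kernel_le: "(LINT x|lborel. norm (kernel s x)) \<le> B * (2 * pi) ^ CARD('n)"
proof -
  define t where "t k = 1 / real (Suc k)" for k
  have t: "0 < t k" for k by (simp add: t_def)
  have tl: "t \<longlonglongrightarrow> 0" unfolding t_def using LIMSEQ_inverse_real_of_nat by (simp add: inverse_eq_divide)
  have [measurable]: "kernel s \<in> borel_measurable borel"
    by (rule borel_measurable_continuous_onI[OF continuous_kernel[OF s]])
  define C where "C = (LINT w|lborel. norm (F w * of_real (gauss s w)))"
  have C: "norm (kernel s x) \<le> C" for x unfolding kernel_def C_def by (rule norm_ft_le)
  have 1: "integrable lborel (\<lambda>x. norm (kernel s x) * gauss (t k) x)" for k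
  proof (rule Bochner_Integration.integrable_bound)
    show "integrable lborel (\<lambda>x::real^'n. C * gauss (t k) x)" using integrable_gauss[OF t, where 'a="real^'n"] by simp
    show "AE x in lborel. norm (norm (kernel s x) * gauss (t k) x) \<le> norm (C * gauss (t k) x)"
      using C by (intro AE_I2) (auto simp: abs_mult intro!: mult_right_mono order_trans[OF C abs_ge_self])
  qed measurable
  have 2: "(\<lambda>k. norm (kernel s x) * gauss (t k) x) \<longlonglongrightarrow> norm (kernel s x)" for x
  proof -
    have "(\<lambda>k. norm (kernel s x) * gauss (t k) x) \<longlonglongrightarrow> norm (kernel s x) * exp (- (0 * (norm x)\<^sup>2 / 2))"
      unfolding gauss_def by (intro tendsto_intros tl) simp
    then show ?thesis by simp
  qed
  have 3: "0 \<le> norm (kernel s x) * gauss (t k) x" for k x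
    using gauss_pos[of "t k" x] by simp
  show "integrable lborel (\<lambda>x. norm (kernel s x))" "(LINT x|lborel. norm (kernel s x)) \<le> B * (2 * pi) ^ CARD('n)"
    by (rule fatou_bound[OF 1 3 kernel_gauss_le[OF s t] 2])+
qed

text \<open>Once \<open>ft \<phi>\<close> is expanded and the integrals are interchanged, the two
  phases merge into \<open>cis ((x - z) \<bullet> w)\<close>, and the integral over \<open>w\<close>
  is the kernel at \<open>x - z\<close>.\<close>

lemma ft_regularized_eq_convolution:
  assumes s: "0 < s" and \<phi>: "\<phi> \<in> test_functions"
  shows "ft (\<lambda>w. (F w * of_real (gauss s w)) * ft \<phi> w) (- x) =
    (LINT z|lborel. \<phi> z * of_real (norm (kernel s (x - z))))"
proof -
  have "ft (\<lambda>w. (F w * of_real (gauss s w)) * ft \<phi> w) (- x) =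
      (LINT w|lborel. (F w * of_real (gauss s w)) * (cis (x \<bullet> w) * (LINT z|lborel. cis (- (w \<bullet> z)) * \<phi> z)))"
    unfolding ft_minus by (simp add: ft_def mult_ac)
  also have "\<dots> = (LINT w|lborel. (F w * of_real (gauss s w)) * (LINT z|lborel. \<phi> z * cis ((x - z) \<bullet> w)))"
  proof (intro Bochner_Integration.integral_cong refl arg_cong2[where f=times])
    fix w :: "real^'n"
    have "cis (x \<bullet> w) * cis (- (w \<bullet> z)) = cis ((x - z) \<bullet> w)" for z
      by (simp add: cis_mult inner_diff_left inner_commute[of w z])
    then have e: "cis (x \<bullet> w) * (cis (- (w \<bullet> z)) * \<phi> z) = \<phi> z * cis ((x - z) \<bullet> w)" for z
      by (metis mult.assoc mult.commute)
    have "cis (x \<bullet> w) * (LINT z|lborel. cis (- (w \<bullet> z)) * \<phi> z) =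
        (LINT z|lborel. cis (x \<bullet> w) * (cis (- (w \<bullet> z)) * \<phi> z))"
      by (rule integral_mult_right_zero[symmetric])
    then show "cis (x \<bullet> w) * (LINT z|lborel. cis (- (w \<bullet> z)) * \<phi> z) = (LINT z|lborel. \<phi> z * cis ((x - z) \<bullet> w))"
      by (simp only: e)
  qed
  also have "\<dots> = (LINT z|lborel. \<phi> z * (LINT w|lborel. (F w * of_real (gauss s w)) * cis ((x - z) \<bullet> w)))"
    by (rule Fubini_bounded_kernel[OF integrable_F_gauss[OF s] integrable_test_function[OF \<phi>]]) auto
  also have "\<dots> = (LINT z|lborel. \<phi> z * kernel s (x - z))"
    by (simp only: kernel_integral)
  finally show ?thesis unfolding kernel_eq[OF s, symmetric] .
qed

lemma ft_regularized_tendsto: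
  assumes \<phi>: "\<phi> \<in> test_functions"
  shows "(\<lambda>k. ft (\<lambda>w. (F w * of_real (gauss (1 / real (Suc k)) w)) * ft \<phi> w) x) \<longlonglongrightarrow> ft (\<lambda>w. F w * ft \<phi> w) x"
  unfolding ft_def[of _ x]
proof (rule integral_dominated_convergence[where w="\<lambda>w. norm (F w * ft \<phi> w)"])
  have [measurable]: "ft \<phi> \<in> borel_measurable borel"
    using integrable_ft_test_function[OF \<phi>] by simp
  show "(\<lambda>w. cis (- (x \<bullet> w)) * (F w * ft \<phi> w)) \<in> borel_measurable lborel"
    "(\<lambda>w. cis (- (x \<bullet> w)) * (F w * of_real (gauss (1 / real (Suc k)) w) * ft \<phi> w)) \<in> borel_measurable lborel" for k
    by measurable
  show "integrable lborel (\<lambda>w. norm (F w * ft \<phi> w))"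
    by (intro integrable_norm integrable_mult_ft bounded_F cF \<phi>)
  have tl: "(\<lambda>k. 1 / real (Suc k)) \<longlonglongrightarrow> 0" using LIMSEQ_inverse_real_of_nat by (simp add: inverse_eq_divide)
  show "AE w in lborel. (\<lambda>k. cis (- (x \<bullet> w)) * (F w * of_real (gauss (1 / real (Suc k)) w) * ft \<phi> w)) \<longlonglongrightarrow>
      cis (- (x \<bullet> w)) * (F w * ft \<phi> w)"
  proof (rule AE_I2)
    fix w
    have "(\<lambda>k. cis (- (x \<bullet> w)) * (F w * of_real (gauss (1 / real (Suc k)) w) * ft \<phi> w)) \<longlonglongrightarrow>
      cis (- (x \<bullet> w)) * (F w * of_real (exp (- (0 * (norm w)\<^sup>2 / 2))) * ft \<phi> w)"
      unfolding gauss_def by (intro tendsto_intros tl) simp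
    then show "(\<lambda>k. cis (- (x \<bullet> w)) * (F w * of_real (gauss (1 / real (Suc k)) w) * ft \<phi> w)) \<longlonglongrightarrow>
      cis (- (x \<bullet> w)) * (F w * ft \<phi> w)" by simp
  qed
  show "AE w in lborel. norm (cis (- (x \<bullet> w)) * (F w * of_real (gauss (1 / real (Suc k)) w) * ft \<phi> w))
      \<le> norm (F w * ft \<phi> w)" for k
  proof (rule AE_I2)
    fix w :: "real^'n"
    have "norm (F w) * gauss (1 / real (Suc k)) w * norm (ft \<phi> w) \<le> norm (F w) * 1 * norm (ft \<phi> w)"
      by (intro mult_left_mono mult_right_mono gauss_le_1) auto
    then show "norm (cis (- (x \<bullet> w)) * (F w * of_real (gauss (1 / real (Suc k)) w) * ft \<phi> w)) \<le> norm (F w * ft \<phi> w)"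
      using gauss_pos[of "1 / real (Suc k)" w] by (simp add: norm_mult abs_of_pos)
  qed
qed

lemma psd_scalar_mult_nonneg:
  assumes \<phi>: "\<phi> \<in> test_functions" "\<And>x. \<phi> x \<in> \<real>\<^sub>\<ge>\<^sub>0"
  shows "scalar_mult F \<phi> x \<in> \<real>\<^sub>\<ge>\<^sub>0"
proof -
  have "ft (\<lambda>w. F w * ft \<phi> w) (- x) \<in> \<real>\<^sub>\<ge>\<^sub>0"
  proof (rule nonneg_Reals_closed_lim[OF ft_regularized_tendsto[OF \<phi>(1)]])
    fix k
    have "(LINT z|lborel. \<phi> z * of_real (norm (kernel (1 / real (Suc k)) (x - z)))) \<in> \<real>\<^sub>\<ge>\<^sub>0"
      using \<phi>(2) by (intro nonneg_Reals_integral nonneg_Reals_mult_I) auto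
    then show "ft (\<lambda>w. F w * of_real (gauss (1 / real (Suc k)) w) * ft \<phi> w) (- x) \<in> \<real>\<^sub>\<ge>\<^sub>0"
      by (subst ft_regularized_eq_convolution[OF _ \<phi>(1)]) auto
  qed
  then show ?thesis unfolding scalar_mult_def by (intro nonneg_Reals_mult_I) auto
qed

lemma
  assumes \<phi>: "\<phi> \<in> test_functions" and p: "1 \<le> p"
  shows psd_scalar_mult_pintegrable: "pintegrable p (scalar_mult F \<phi>)"
    and psd_scalar_mult_bound: "pint p (scalar_mult F \<phi>) \<le> B powr p * pint p \<phi>"
proof -
  \<comment> \<open>The normalization \<open>c\<close> cancels the factor
    \<open>(2 * pi) ^ CARD('n)\<close> in the mass of the kernels, so the constant that remains is a
    power of \<open>B\<close>.\<close>
  define c where "c = (2 * pi) powr (- real CARD('n))"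
  have "c * (2 * pi) ^ CARD('n) = 1"
    unfolding c_def by (subst powr_minus, subst powr_realpow, simp, rule left_inverse, simp)
  then have c: "0 < c" "c * (B * (2 * pi) ^ CARD('n)) = B"
    by (simp add: c_def, metis mult.left_commute mult.right_neutral)
  define h where "h k x = c * norm (LINT z|lborel. \<phi> z * of_real (norm (kernel (1 / real (Suc k)) (x - z))))" for k x
  have M: "0 < B * (2 * pi) ^ CARD('n)" using B_pos by simp
  have s: "0 < 1 / real (Suc k)" for k by simp
  note conv = pint_convolution_le[OF \<phi> integrable_kernel[OF s] norm_ge_zero integral_kernel_le[OF s] M p]
  have hp: "h k x powr p = c powr p * norm (LINT z|lborel. \<phi> z * of_real (norm (kernel (1 / real (Suc k)) (x - z)))) powr p" for k x
    using c(1) by (simp add: h_def powr_mult)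
  have i: "integrable lborel (\<lambda>x. h k x powr p)" for k
    unfolding hp by (intro integrable_mult_right conv(1))
  have "(LINT x|lborel. h k x powr p) \<le> c powr p * ((B * (2 * pi) ^ CARD('n)) powr p * (LINT z|lborel. norm (\<phi> z) powr p))" for k
    unfolding hp integral_mult_right_zero by (intro mult_left_mono conv(2)) simp
  also have "c powr p * ((B * (2 * pi) ^ CARD('n)) powr p * (LINT z|lborel. norm (\<phi> z) powr p)) =
      B powr p * (LINT z|lborel. norm (\<phi> z) powr p)"
  proof -
    have "c powr p * (Q powr p * I) = (c * Q) powr p * I" if "0 < Q" for Q I
      using c(1) that by (simp add: powr_mult)
    from this[OF M] show ?thesis by (simp only: c(2))
  qed
  finally have le: "(LINT x|lborel. h k x powr p) \<le> B powr p * (LINT z|lborel. norm (\<phi> z) powr p)" for k .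
  have lim: "(\<lambda>k. h k x powr p) \<longlonglongrightarrow> norm (scalar_mult F \<phi> x) powr p" for x
  proof (intro tendsto_powr' tendsto_const)
    have "(\<lambda>k. c * norm (ft (\<lambda>w. F w * of_real (gauss (1 / real (Suc k)) w) * ft \<phi> w) (- x))) \<longlonglongrightarrow>
       c * norm (ft (\<lambda>w. F w * ft \<phi> w) (- x))"
      by (intro tendsto_intros ft_regularized_tendsto \<phi>)
    moreover have "c * norm (ft (\<lambda>w. F w * of_real (gauss (1 / real (Suc k)) w) * ft \<phi> w) (- x)) = h k x" for k
      by (simp only: ft_regularized_eq_convolution[OF s \<phi>] h_def)
    moreover have "c * norm (ft (\<lambda>w. F w * ft \<phi> w) (- x)) = norm (scalar_mult F \<phi> x)"
      using c(1) by (simp add: scalar_mult_def norm_mult c_def)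
    ultimately show "(\<lambda>k. h k x) \<longlonglongrightarrow> norm (scalar_mult F \<phi> x)" by (simp only:)
    show "norm (scalar_mult F \<phi> x) \<noteq> 0 \<or> 0 < p \<and> (\<forall>\<^sub>F k in sequentially. 0 \<le> h k x)"
      using p c(1) by (auto simp: h_def)
  qed
  note * = fatou_bound[OF i powr_ge_zero le lim]
  have cont: "continuous_on UNIV (scalar_mult F \<phi>)"
    using scalar_mult_C_vanishing[OF bounded_F cF \<phi>] by (simp add: C_vanishing_def)
  have m: "(\<lambda>x. norm (g x) powr p) \<in> lborel \<rightarrow>\<^sub>M borel" if "continuous_on UNIV g" for g :: "real^'n \<Rightarrow> complex"
    using borel_measurable_continuous_onI[OF that] by measurable
  show "pintegrable p (scalar_mult F \<phi>)"
    unfolding pintegrable_def using *(1) m[OF cont] continuous_borel_measurable_lebesgue[OF cont]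
    by (simp add: integrable_completion)
  have "pint p g = (LINT x|lborel. norm (g x) powr p)" if "continuous_on UNIV g" for g :: "real^'n \<Rightarrow> complex"
    unfolding pint_def by (rule integral_completion[OF m[OF that]])
  then show "pint p (scalar_mult F \<phi>) \<le> B powr p * pint p \<phi>"
    using *(2) cont test_functionsD(3)[OF \<phi>] by simp
qed

lemma psd_scalar_mult_operator: "1 \<le> p \<Longrightarrow> positive_test_operator (scalar_mult F) p (B powr p)"
  by (unfold_locales)
    (auto simp: scalar_mult_add[OF bounded_F cF] scalar_mult_cmult[OF bounded_F cF] psd_scalar_mult_pintegrable
      intro: psd_scalar_mult_bound psd_scalar_mult_nonneg)

end

section \<open>Positivity of the multiplier implies positive semidefiniteness\<close>

lemma open_AE_notin_imp_empty:
  fixes U :: "(real ^ 'n) set"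
  assumes "open U" "AE x in lebesgue. x \<notin> U"
  shows "U = {}"
proof (rule ccontr)
  assume "U \<noteq> {}"
  have "U \<in> sets lebesgue" using assms(1) by auto
  then have "negligible U"
    using assms(2) by (simp add: AE_iff_null_sets negligible_iff_null_sets)
  with open_not_negligible[OF assms(1) \<open>U \<noteq> {}\<close>] show False by simp
qed

text \<open>The points where a continuous function leaves a closed set form an open set, and an open
  null set is empty. The operator determines the multiplier's values only almost everywhere; this
  recovers all of them.\<close>

lemma AE_nonneg_imp_nonneg:
  fixes h :: "real ^ 'n \<Rightarrow> complex"
  assumes "continuous_on UNIV h" "AE x in lebesgue. h x \<in> \<real>\<^sub>\<ge>\<^sub>0"
  shows "h x \<in> \<real>\<^sub>\<ge>\<^sub>0"
proof -
  have "closed (h -` \<real>\<^sub>\<ge>\<^sub>0)"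
    using assms(1) closed_nonneg_Reals_complex by (simp add: continuous_on_closed_vimage)
  then have "open (- (h -` \<real>\<^sub>\<ge>\<^sub>0))" by (rule open_Compl)
  then have "- (h -` \<real>\<^sub>\<ge>\<^sub>0) = {}"
    using assms(2) by (intro open_AE_notin_imp_empty) auto
  then show ?thesis by auto
qed

section \<open>Constructing positive semidefinite functions\<close>

lemma psd_function_tendsto:
  assumes "\<And>k. psd_function (F k)" "\<And>y. (\<lambda>k. F k y) \<longlonglongrightarrow> G y"
  shows "psd_function G"
  unfolding psd_function_def psd_matrix_def
proof (intro allI)
  fix N x and c :: "nat \<Rightarrow> complex"
  show "(\<Sum>p<N. \<Sum>q<N. cnj (c p) * G (x p - x q) * c q) \<in> \<real>\<^sub>\<ge>\<^sub>0"
    by (rule nonneg_Reals_closed_lim[where f="\<lambda>k. \<Sum>p<N. \<Sum>q<N. cnj (c p) * F k (x p - x q) * c q"])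
      (auto intro!: tendsto_intros assms(2) psd_functionD[OF assms(1)])
qed

lemma psd_function_cmult:
  assumes "psd_function F" "0 \<le> r"
  shows "psd_function (\<lambda>y. of_real r * F y)"
  unfolding psd_function_def psd_matrix_def
proof (intro allI)
  fix N x and c :: "nat \<Rightarrow> complex"
  have "of_real r * (\<Sum>p<N. \<Sum>q<N. cnj (c p) * F (x p - x q) * c q) \<in> \<real>\<^sub>\<ge>\<^sub>0"
    using assms(2) by (intro nonneg_Reals_mult_I psd_functionD assms) auto
  then show "(\<Sum>p<N. \<Sum>q<N. cnj (c p) * (of_real r * F (x p - x q)) * c q) \<in> \<real>\<^sub>\<ge>\<^sub>0"
    by (simp add: sum_distrib_left mult_ac)
qed

text \<open>The easy half of Bochner's theorem: the quadratic form is the integral of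
  \<open>g\<close> against the squared modulus of the trigonometric polynomial
  \<open>D\<close>.\<close>

lemma psd_function_ft:
  fixes g :: "real ^ 'n \<Rightarrow> complex"
  assumes g: "integrable lborel g" "\<And>x. g x \<in> \<real>\<^sub>\<ge>\<^sub>0"
  shows "psd_function (ft g)"
  unfolding psd_function_def psd_matrix_def
proof (intro allI)
  fix N and x :: "nat \<Rightarrow> real ^ 'n" and c :: "nat \<Rightarrow> complex"
  define D where "D w = (\<Sum>q<N. c q * cis (x q \<bullet> w))" for w
  have e: "(\<Sum>p<N. \<Sum>q<N. cnj (c p) * (cis (- ((x p - x q) \<bullet> w)) * g w) * c q) = g w * (cnj (D w) * D w)" for w
  proof -
    have "cnj (c p) * (cis (- ((x p - x q) \<bullet> w)) * g w) * c q =
        g w * (cnj (c p * cis (x p \<bullet> w)) * (c q * cis (x q \<bullet> w)))" for p q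
    proof -
      have "cis (- ((x p - x q) \<bullet> w)) = cis (- (x p \<bullet> w)) * cis (x q \<bullet> w)"
        by (simp add: cis_mult inner_diff_left)
      then show ?thesis by (simp add: cis_cnj)
    qed
    moreover have "cnj (D w) * D w = (\<Sum>p<N. \<Sum>q<N. cnj (c p * cis (x p \<bullet> w)) * (c q * cis (x q \<bullet> w)))"
      by (simp only: D_def cnj_sum sum_product)
    ultimately show ?thesis by (simp only: sum_distrib_left)
  qed
  have "(\<Sum>p<N. \<Sum>q<N. cnj (c p) * ft g (x p - x q) * c q) =
      (\<Sum>p<N. \<Sum>q<N. LINT w|lborel. cnj (c p) * (cis (- ((x p - x q) \<bullet> w)) * g w) * c q)"
    by (simp add: ft_def)
  also have "\<dots> = (LINT w|lborel. (\<Sum>p<N. \<Sum>q<N. cnj (c p) * (cis (- ((x p - x q) \<bullet> w)) * g w) * c q))"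
    using integrable_cis_mult'[OF g(1)]
    by (subst Bochner_Integration.integral_sum) (auto intro!: sum.cong Bochner_Integration.integral_sum[symmetric])
  also have "\<dots> \<in> \<real>\<^sub>\<ge>\<^sub>0"
    unfolding e
  proof (rule nonneg_Reals_integral, rule nonneg_Reals_mult_I[OF g(2)])
    show "cnj (D w) * D w \<in> \<real>\<^sub>\<ge>\<^sub>0" for w
      by (simp add: nonneg_Reals_iff)
  qed
  finally show "(\<Sum>p<N. \<Sum>q<N. cnj (c p) * ft g (x p - x q) * c q) \<in> \<real>\<^sub>\<ge>\<^sub>0" .
qed

text \<open>Gaussian summability of the Fourier integral recovers \<open>H\<close> from its transform.\<close>

lemma ft_gauss_ft:
  fixes H :: "real ^ 'n \<Rightarrow> complex"
  assumes H: "integrable lborel H" and s: "0 < s"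
  shows "ft (\<lambda>x. of_real (gauss s x) * ft H (- x)) y =
    of_real (sqrt (2 * pi) ^ CARD('n)) * (LINT u|lborel. H (y + sqrt s *\<^sub>R u) * of_real (gauss 1 u))"
proof -
  have [measurable]: "H \<in> borel_measurable borel" using H by simp
  have gi: "integrable lborel (\<lambda>x::real^'n. complex_of_real (gauss s x))"
    using integrable_gauss[OF s, where 'a="real^'n"] by simp
  have "ft (\<lambda>x. of_real (gauss s x) * ft H (- x)) y =
      (LINT x|lborel. of_real (gauss s x) * (LINT w|lborel. H w * cis ((w - y) \<bullet> x)))"
    unfolding ft_def[of _ y]
  proof (intro Bochner_Integration.integral_cong refl)
    fix x :: "real^'n"
    have "cis (- (y \<bullet> x)) * cis (x \<bullet> w) = cis ((w - y) \<bullet> x)" for w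
      by (simp add: cis_mult inner_diff_left inner_commute[of x w])
    then have e: "cis (- (y \<bullet> x)) * (H w * cis (x \<bullet> w)) = H w * cis ((w - y) \<bullet> x)" for w
      by (metis mult.left_commute)
    have "cis (- (y \<bullet> x)) * ft H (- x) = (LINT w|lborel. cis (- (y \<bullet> x)) * (H w * cis (x \<bullet> w)))"
      unfolding ft_minus by (rule integral_mult_right_zero[symmetric])
    then have "cis (- (y \<bullet> x)) * ft H (- x) = (LINT w|lborel. H w * cis ((w - y) \<bullet> x))"
      by (simp only: e)
    then show "cis (- (y \<bullet> x)) * (of_real (gauss s x) * ft H (- x)) =
        of_real (gauss s x) * (LINT w|lborel. H w * cis ((w - y) \<bullet> x))"
      by (metis mult.left_commute)
  qed
  also have "\<dots> = (LINT w|lborel. H w * (LINT x|lborel. of_real (gauss s x) * cis ((w - y) \<bullet> x)))"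
    by (rule Fubini_bounded_kernel[OF gi H]) auto
  also have "\<dots> = (LINT w|lborel. H w * of_real (sqrt (2 * pi / s) ^ CARD('n) * gauss (1 / s) (w - y)))"
  proof (intro Bochner_Integration.integral_cong refl arg_cong2[where f=times])
    fix w
    show "(LINT x|lborel. of_real (gauss s x) * cis ((w - y) \<bullet> x)) =
        of_real (sqrt (2 * pi / s) ^ CARD('n) * gauss (1 / s) (w - y))"
      using ft_gauss[OF s, of "- (w - y)"] by (simp only: ft_minus gauss_minus DIM_cart DIM_real mult_1_right)
  qed
  also have "\<dots> = (LINT v|lborel. H (y + v) * of_real (sqrt (2 * pi / s) ^ CARD('n) * gauss (1 / s) v))"
    using lborel_integral_plus[of "\<lambda>w. H w * of_real (sqrt (2 * pi / s) ^ CARD('n) * gauss (1 / s) (w - y))" y]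
    by simp
  \<comment> \<open>Rescaling by \<open>sqrt s\<close> moves the parameter from the Gaussian into
    the argument of \<open>H\<close>; the weight is then fixed, as dominated convergence
    requires.\<close>
  also have "\<dots> = sqrt s ^ CARD('n) *\<^sub>R (LINT u|lborel. H (y + sqrt s *\<^sub>R u) *
      of_real (sqrt (2 * pi / s) ^ CARD('n) * gauss (1 / s) (sqrt s *\<^sub>R u)))"
    using lborel_integral_scale[of "\<lambda>v. H (y + v) * of_real (sqrt (2 * pi / s) ^ CARD('n) * gauss (1 / s) v)" "sqrt s"] s
    by simp
  also have "(LINT u|lborel. H (y + sqrt s *\<^sub>R u) * of_real (sqrt (2 * pi / s) ^ CARD('n) * gauss (1 / s) (sqrt s *\<^sub>R u))) =
      (LINT u|lborel. of_real (sqrt (2 * pi / s) ^ CARD('n)) * (H (y + sqrt s *\<^sub>R u) * of_real (gauss 1 u)))"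
    using s by (intro Bochner_Integration.integral_cong) (auto simp: gauss_def power_mult_distrib)
  also have "\<dots> = of_real (sqrt (2 * pi / s) ^ CARD('n)) * (LINT u|lborel. H (y + sqrt s *\<^sub>R u) * of_real (gauss 1 u))"
    by (rule integral_mult_right_zero)
  also have "sqrt s ^ CARD('n) *\<^sub>R (of_real (sqrt (2 * pi / s) ^ CARD('n)) * (LINT u|lborel. H (y + sqrt s *\<^sub>R u) * of_real (gauss 1 u))) =
      of_real ((sqrt s * sqrt (2 * pi / s)) ^ CARD('n)) * (LINT u|lborel. H (y + sqrt s *\<^sub>R u) * of_real (gauss 1 u))"
    by (simp add: scaleR_conv_of_real power_mult_distrib)
  also have "sqrt s * sqrt (2 * pi / s) = sqrt (2 * pi)"
    using s by (simp add: real_sqrt_divide)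
  finally show ?thesis .
qed

text \<open>Multiplied by a Gaussian, the bounded transform of \<open>H\<close> becomes integrable
  and stays nonnegative, so its transform is positive semidefinite. Widening the Gaussian recovers
  \<open>H\<close> pointwise, and the class is closed under pointwise limits.\<close>

lemma psd_function_of_ft_nonneg:
  fixes H :: "real ^ 'n \<Rightarrow> complex"
  assumes H: "integrable lborel H" "continuous_on UNIV H" "bounded (range H)"
    and pos: "\<And>x. ft H x \<in> \<real>\<^sub>\<ge>\<^sub>0"
  shows "psd_function H"
proof -
  define t where "t k = 1 / real (Suc k)" for k
  have t: "0 < t k" for k by (simp add: t_def)
  have tl: "t \<longlonglongrightarrow> 0" unfolding t_def using LIMSEQ_inverse_real_of_nat by (simp add: inverse_eq_divide)
  have [measurable]: "H \<in> borel_measurable borel" using H by simp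
  obtain B where B: "\<And>x. norm (H x) \<le> B" using H(3) by (auto simp: bounded_iff)
  define c where "c = sqrt (2 * pi) ^ CARD('n)"
  have c: "0 < c" by (simp add: c_def)
  \<comment> \<open>One factor \<open>c\<close> comes from the inversion formula
    \<open>ft_gauss_ft\<close>, the other is the mass of the standard Gaussian
    \<open>gauss 1\<close>.\<close>
  define L where "L k y = of_real (1 / (c * c)) * ft (\<lambda>x. of_real (gauss (t k) x) * ft H (- x)) y" for k y
  have gi: "integrable lborel (\<lambda>x::real^'n. complex_of_real (gauss s x))" if "0 < s" for s
    using integrable_gauss[OF that, where 'a="real^'n"] by simp
  have cft: "continuous_on UNIV (\<lambda>x. ft H (- x))"
    by (rule continuous_on_compose2[OF continuous_on_ft[OF H(1)]]) (auto intro: continuous_intros)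
  have i: "integrable lborel (\<lambda>x. of_real (gauss (t k) x) * ft H (- x))" for k
  proof -
    have "integrable lborel (\<lambda>x. ft H (- x) * of_real (gauss (t k) x))"
      using norm_ft_le[of H] gi[OF t]
      by (intro integrable_bounded_mult borel_measurable_continuous_onI[OF cft]) (auto simp: bounded_iff)
    then show ?thesis by (simp add: mult.commute)
  qed
  have "psd_function (L k)" for k
    unfolding L_def using pos c
    by (intro psd_function_cmult psd_function_ft i nonneg_Reals_mult_I) (auto simp: gauss_pos less_imp_le)
  moreover have "(\<lambda>k. L k y) \<longlonglongrightarrow> H y" for y
  proof -
    have "(\<lambda>k. LINT u|lborel. H (y + sqrt (t k) *\<^sub>R u) * of_real (gauss 1 u)) \<longlonglongrightarrow>
        (LINT u|lborel. H y * of_real (gauss 1 (u::real^'n)))"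
    proof (rule integral_dominated_convergence[where w="\<lambda>u. B * gauss 1 u"])
      show "integrable lborel (\<lambda>u::real^'n. B * gauss 1 u)" by (intro integrable_mult_right integrable_gauss) simp
      show "AE u in lborel. (\<lambda>k. H (y + sqrt (t k) *\<^sub>R u) * of_real (gauss 1 u)) \<longlonglongrightarrow> H y * of_real (gauss 1 u)"
      proof (rule AE_I2)
        fix u :: "real^'n"
        have "(\<lambda>k. y + sqrt (t k) *\<^sub>R u) \<longlonglongrightarrow> y + sqrt 0 *\<^sub>R u"
          by (intro tendsto_intros tl)
        then have "(\<lambda>k. H (y + sqrt (t k) *\<^sub>R u)) \<longlonglongrightarrow> H y"
          using H(2) by (intro continuous_on_tendsto_compose[of UNIV H]) auto
        then show "(\<lambda>k. H (y + sqrt (t k) *\<^sub>R u) * of_real (gauss 1 u)) \<longlonglongrightarrow> H y * of_real (gauss 1 u)"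
          by (intro tendsto_intros)
      qed
      show "AE u in lborel. norm (H (y + sqrt (t k) *\<^sub>R u) * of_real (gauss 1 u)) \<le> B * gauss 1 u" for k
        using B by (intro AE_I2) (auto simp: norm_mult gauss_pos abs_of_pos less_imp_le intro!: mult_right_mono)
    qed measurable
    moreover have "(LINT u|lborel. H y * of_real (gauss 1 (u::real^'n))) = H y * of_real c"
      using integral_gauss[of 1, where 'a="real^'n"] by (simp add: c_def)
    ultimately have "(\<lambda>k. of_real (1 / c) * (LINT u|lborel. H (y + sqrt (t k) *\<^sub>R u) * of_real (gauss 1 u)))
        \<longlonglongrightarrow> of_real (1 / c) * (H y * of_real c)"
      by (intro tendsto_mult tendsto_const) (simp only:)
    moreover have "L k y = of_real (1 / c) * (LINT u|lborel. H (y + sqrt (t k) *\<^sub>R u) * of_real (gauss 1 u))" for k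
      using c by (simp add: L_def ft_gauss_ft[OF H(1) t] c_def[symmetric])
    ultimately show ?thesis using c by simp
  qed
  ultimately show ?thesis by (rule psd_function_tendsto)
qed

section \<open>Bumps shrinking to the origin\<close>

lemma norm_cis_minus_1_le: "norm (cis t - 1) \<le> \<bar>t\<bar>"
  using iexp_approx1[of t 0] by (simp add: cis_conv_exp)

text \<open>The value of the transform at 0 is the mass. On the shrinking support
  \<open>cis (- (y \<bullet> x))\<close> is uniformly close to 1, so the transform divided by the
  mass tends to 1.\<close>

lemma ft_box_bump_tendsto:
  fixes y :: "real ^ 'n"
  defines "f k \<equiv> \<lambda>x::real^'n. complex_of_real (box_bump (\<chi> i. - (1 / real (Suc k))) (\<chi> i. 1 / real (Suc k)) x)"
  shows "(\<lambda>k. of_real (1 / Re (ft (f k) 0)) * ft (f k) y) \<longlonglongrightarrow> 1" "0 < Re (ft (f k) 0)"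
proof -
  define b where "b k = box_bump (\<chi> i. - (1 / real (Suc k))) (\<chi> i::'n. 1 / real (Suc k))" for k
  have f: "f k = (\<lambda>x. of_real (b k x))" for k by (simp add: f_def b_def)
  have ft: "f k \<in> test_functions" for k unfolding f_def by (rule box_bump_test_function)
  have fi: "integrable lborel (f k)" for k by (rule integrable_test_function[OF ft])
  have bi: "integrable lborel (b k)" for k
    using integrable_Re[OF fi[of k]] by (simp add: f)
  have b0: "0 \<le> b k x" for k x by (simp add: b_def box_bump_nonneg)
  have m: "ft (f k) 0 = of_real (LINT x|lborel. b k x)" for k by (simp add: ft_def f)
  \<comment> \<open>A bump of mass zero would vanish almost everywhere, although it is positive on
    an open box around the origin.\<close>
  have pos: "0 < (LINT x|lborel. b k x)" for k
  proof (rule ccontr)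
    assume "\<not> 0 < (LINT x|lborel. b k x)"
    then have "(LINT x|lborel. b k x) = 0" using b0 by (simp add: antisym not_less)
    then have "AE x in lborel. b k x = 0"
      using bi b0 by (subst (asm) integral_nonneg_eq_0_iff_AE) auto
    then have "AE x in lebesgue. b k x = 0" by (rule AE_completion)
    then have "AE x in lebesgue. x \<notin> box (\<chi> i. - (1 / real (Suc k))) (\<chi> i::'n. 1 / real (Suc k))"
      by eventually_elim (auto simp: b_def box_bump_pos_iff[symmetric])
    from open_AE_notin_imp_empty[OF open_box this]
    have "(0::real^'n) \<notin> box (\<chi> i. - (1 / real (Suc k))) (\<chi> i. 1 / real (Suc k))" by simp
    then show False by (simp add: mem_box_cart)
  qed
  then show "0 < Re (ft (f k) 0)" by (simp add: m)
  \<comment> \<open>\<open>norm y\<close> comes from the Cauchy-Schwarz inequality, and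
    \<open>CARD('n)\<close> from bounding \<open>norm x\<close> by the sum of the absolute
    coordinates.\<close>
  define C where "C = norm y * real CARD('n)"
  have le: "norm (of_real (1 / Re (ft (f k) 0)) * ft (f k) y - 1) \<le> C * (1 / real (Suc k))" for k
  proof -
    have "ft (f k) y - ft (f k) 0 = (LINT x|lborel. (cis (- (y \<bullet> x)) - 1) * f k x)"
      unfolding ft_def using integrable_cis_mult'[OF fi] fi by (simp add: left_diff_distrib)
    also have "norm \<dots> \<le> (LINT x|lborel. C * (1 / real (Suc k)) * b k x)"
    proof (rule Bochner_Integration.integral_norm_bound_integral)
      show "integrable lborel (\<lambda>x. (cis (- (y \<bullet> x)) - 1) * f k x)"
        using integrable_cis_mult'[OF fi, of y k] fi by (simp add: left_diff_distrib)
      show "integrable lborel (\<lambda>x. C * (1 / real (Suc k)) * b k x)" using bi by simp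
      fix x
      show "norm ((cis (- (y \<bullet> x)) - 1) * f k x) \<le> C * (1 / real (Suc k)) * b k x"
      proof (cases "b k x = 0")
        case False
        then have "x \<in> box (\<chi> i. - (1 / real (Suc k))) (\<chi> i::'n. 1 / real (Suc k))"
          using b0[of k x] by (simp add: b_def box_bump_pos_iff[symmetric])
        then have "\<bar>x $ i\<bar> \<le> 1 / real (Suc k)" for i
          unfolding mem_box_cart by (simp add: abs_le_iff less_imp_le) (metis less_imp_le minus_le_iff)
        then have "(\<Sum>i\<in>UNIV. \<bar>x $ i\<bar>) \<le> real CARD('n) * (1 / real (Suc k))"
          by (intro sum_bounded_above)
        then have "norm x \<le> real CARD('n) * (1 / real (Suc k))"
          using norm_le_l1_cart[of x] by linarith
        then have "norm y * norm x \<le> norm y * (real CARD('n) * (1 / real (Suc k)))"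
          by (intro mult_left_mono) auto
        then have "norm (cis (- (y \<bullet> x)) - 1) \<le> C * (1 / real (Suc k))"
          using norm_cis_minus_1_le[of "- (y \<bullet> x)"] Cauchy_Schwarz_ineq2[of y x] by (simp add: C_def)
        from mult_right_mono[OF this b0[of k x]] show ?thesis
          using b0[of k x] by (simp add: norm_mult f)
      qed (simp add: f)
    qed
    also have "\<dots> = C * (1 / real (Suc k)) * Re (ft (f k) 0)" by (simp add: m)
    finally have "norm (ft (f k) y - ft (f k) 0) \<le> C * (1 / real (Suc k)) * Re (ft (f k) 0)" .
    moreover have "of_real (1 / Re (ft (f k) 0)) * ft (f k) y - 1 = (ft (f k) y - ft (f k) 0) / of_real (Re (ft (f k) 0))"
      using pos[of k] by (simp add: m field_simps)
    ultimately show ?thesis using pos[of k] by (simp add: m norm_divide pos_divide_le_eq)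
  qed
  have "(\<lambda>k. C * (1 / real (Suc k))) \<longlonglongrightarrow> 0"
    using tendsto_mult_right_zero[OF LIMSEQ_inverse_real_of_nat, of C] by (simp add: inverse_eq_divide)
  then have "(\<lambda>k. of_real (1 / Re (ft (f k) 0)) * ft (f k) y - 1) \<longlonglongrightarrow> 0"
    by (rule Lim_null_comparison[rotated]) (intro always_eventually allI le)
  then show "(\<lambda>k. of_real (1 / Re (ft (f k) 0)) * ft (f k) y) \<longlonglongrightarrow> 1"
    by (simp add: LIM_zero_iff)
qed

text \<open>The inversion argument asks for an integrable function, which \<open>F\<close> itself
  may fail to be, whereas \<open>F * ft f\<close> is integrable, continuous and bounded. Shrinking
  bumps then remove the extra factor.\<close>

lemma scalar_mult_nonneg_imp_psd:
  fixes F :: "real ^ 'n \<Rightarrow> complex"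
  assumes F: "bounded (range F)" "continuous_on UNIV F"
    and pos: "\<And>f x. f \<in> test_functions \<Longrightarrow> (\<And>x. f x \<in> \<real>\<^sub>\<ge>\<^sub>0) \<Longrightarrow> scalar_mult F f x \<in> \<real>\<^sub>\<ge>\<^sub>0"
  shows "psd_function F"
proof -
  have *: "psd_function (\<lambda>y. F y * ft f y)" if f: "f \<in> test_functions" "\<And>x. f x \<in> \<real>\<^sub>\<ge>\<^sub>0" for f
  proof (rule psd_function_of_ft_nonneg)
    show "integrable lborel (\<lambda>y. F y * ft f y)" by (rule integrable_mult_ft[OF F f(1)])
    show "continuous_on UNIV (\<lambda>y. F y * ft f y)"
      by (intro continuous_intros F continuous_on_ft integrable_test_function f)
    obtain B where B: "\<And>x. norm (F x) \<le> B" using F(1) by (auto simp: bounded_iff)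
    have "norm (F y * ft f y) \<le> B * (LINT x|lborel. norm (f x))" for y
      using B[of y] norm_ft_le[of f y] order_trans[OF norm_ge_zero B] by (auto simp: norm_mult intro!: mult_mono)
    then show "bounded (range (\<lambda>y. F y * ft f y))" by (auto simp: bounded_iff)
    show "ft (\<lambda>y. F y * ft f y) x \<in> \<real>\<^sub>\<ge>\<^sub>0" for x
    proof -
      have "0 < (2 * pi) powr (- real CARD('n))" by simp
      from nonneg_Reals_of_real_mult_iff[OF this] pos[OF f, of "- x"] show ?thesis
        by (simp add: scalar_mult_def)
    qed
  qed
  define f where "f k = (\<lambda>x::real^'n. complex_of_real (box_bump (\<chi> i. - (1 / real (Suc k))) (\<chi> i. 1 / real (Suc k)) x))" for k
  have "psd_function (\<lambda>y. of_real (1 / Re (ft (f k) 0)) * (F y * ft (f k) y))" for k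
    using ft_box_bump_tendsto(2)[of k, where 'n='n] unfolding f_def
    by (intro psd_function_cmult * box_bump_test_function) (auto simp: box_bump_nonneg)
  moreover have "(\<lambda>k. of_real (1 / Re (ft (f k) 0)) * (F y * ft (f k) y)) \<longlonglongrightarrow> F y" for y
  proof -
    have "(\<lambda>k. F y * (of_real (1 / Re (ft (f k) 0)) * ft (f k) y)) \<longlonglongrightarrow> F y * 1"
      unfolding f_def by (intro tendsto_mult tendsto_const ft_box_bump_tendsto(1))
    then show ?thesis by (simp add: mult_ac)
  qed
  ultimately show ?thesis by (rule psd_function_tendsto)
qed

section \<open>Matrix-valued multipliers\<close>

lemma Lp_norm_nonneg: "0 \<le> Lp_norm p f"
  by (simp add: Lp_norm_def)

text \<open>A crude quasi-norm inequality. One factor 2 of the constant is the p-th root of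
  \<open>2 powr p\<close>, the other bounds \<open>2 powr (1 / p)\<close> and uses
  \<open>1 \<le> p\<close>.\<close>

lemma Lp_norm_add_le:
  assumes "f \<in> Lp p" "g \<in> Lp p" "1 \<le> p"
  shows "Lp_norm p (\<lambda>x. f x + g x) \<le> 4 * (Lp_norm p f + Lp_norm p g)"
proof -
  have p: "0 < p" using assms(3) by simp
  define a b where "a = pint p f" and "b = pint p g"
  have ab: "0 \<le> a" "0 \<le> b" by (simp_all add: a_def b_def pint_nonneg)
  have "pint p (\<lambda>x. f x + g x) \<le> 2 powr p * (a + b)"
    unfolding a_def b_def using assms p by (intro pint_add_le) (auto simp: Lp_iff)
  also have "\<dots> \<le> 2 powr p * (2 * max a b)"
    by (intro mult_left_mono) auto
  finally have "Lp_norm p (\<lambda>x. f x + g x) \<le> (2 powr p * (2 * max a b)) powr (1 / p)"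
    unfolding Lp_norm_pint using p by (intro powr_mono2) (auto simp: pint_nonneg)
  also have "\<dots> = 2 * (2 powr (1 / p) * max a b powr (1 / p))"
    using p ab by (simp add: powr_mult powr_powr)
  also have "\<dots> \<le> 2 * (2 powr 1 * (a powr (1 / p) + b powr (1 / p)))"
  proof (intro mult_left_mono mult_mono powr_mono)
    show "max a b powr (1 / p) \<le> a powr (1 / p) + b powr (1 / p)"
      by (auto simp: max_def)
  qed (use assms(3) in auto)
  finally show ?thesis by (simp add: Lp_norm_pint a_def b_def)
qed

lemma Lp_sum: "finite A \<Longrightarrow> (\<And>k. k \<in> A \<Longrightarrow> g k \<in> Lp p) \<Longrightarrow> 0 < p \<Longrightarrow> (\<lambda>x. \<Sum>k\<in>A. g k x) \<in> Lp p"
proof (induction A rule: finite_induct)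
  case empty
  then show ?case by (simp add: Lp_def)
next
  case (insert j A)
  then show ?case by (simp add: Lp_iff pintegrable_add)
qed

lemma Lp_norm_sum_le:
  assumes "finite A" "\<And>k. k \<in> A \<Longrightarrow> g k \<in> Lp p" "1 \<le> p"
  shows "Lp_norm p (\<lambda>x. \<Sum>k\<in>A. g k x) \<le> 4 ^ card A * (\<Sum>k\<in>A. Lp_norm p (g k))"
  using assms(1,2)
proof (induction A rule: finite_induct)
  case empty
  then show ?case using assms(3) by (simp add: Lp_norm_def)
next
  case (insert j A)
  have "Lp_norm p (\<lambda>x. g j x + (\<Sum>k\<in>A. g k x)) \<le> 4 * (Lp_norm p (g j) + Lp_norm p (\<lambda>x. \<Sum>k\<in>A. g k x))"
    using insert assms(3) by (intro Lp_norm_add_le Lp_sum) auto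
  also have "\<dots> \<le> 4 * (4 ^ card A * Lp_norm p (g j) + 4 ^ card A * (\<Sum>k\<in>A. Lp_norm p (g k)))"
  proof -
    have "1 * Lp_norm p (g j) \<le> 4 ^ card A * Lp_norm p (g j)"
      by (intro mult_right_mono one_le_power Lp_norm_nonneg) simp
    then show ?thesis using insert by (intro mult_left_mono add_mono) auto
  qed
  finally show ?case using insert by (simp add: distrib_left)
qed

text \<open>Bundles what the matrix construction needs, so that one operator can be chosen for every
  entry at once. Nonnegative constants \<open>C\<close> allow a sum of them to bound each
  one.\<close>

definition positive_extension ::
    "real \<Rightarrow> (real ^ 'n \<Rightarrow> complex) \<Rightarrow> ((real ^ 'n \<Rightarrow> complex) \<Rightarrow> real ^ 'n \<Rightarrow> complex) \<Rightarrow> bool" where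
  "positive_extension p F S \<longleftrightarrow> (\<forall>f\<in>Lp p. S f \<in> Lp p) \<and>
    (\<forall>f\<in>Lp p. \<forall>g\<in>Lp p. AE x in lebesgue. S (\<lambda>x. f x + g x) x = S f x + S g x) \<and>
    (\<forall>a. \<forall>f\<in>Lp p. AE x in lebesgue. S (\<lambda>x. a * f x) x = a * S f x) \<and>
    (\<exists>C\<ge>0. \<forall>f\<in>Lp p. Lp_norm p (S f) \<le> C * Lp_norm p f) \<and>
    (\<forall>f\<in>test_functions. AE x in lebesgue. S f x = scalar_mult F f x) \<and>
    (\<forall>f\<in>Lp p. (AE x in lebesgue. f x \<in> \<real>\<^sub>\<ge>\<^sub>0) \<longrightarrow> (AE x in lebesgue. S f x \<in> \<real>\<^sub>\<ge>\<^sub>0))"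

lemma psd_scalar_extension:
  fixes F :: "real ^ 'n \<Rightarrow> complex"
  assumes "psd_function F" "bounded (range F)" "continuous_on UNIV F" "1 \<le> p"
  shows "\<exists>S. positive_extension p F S"
proof -
  obtain B where B: "\<And>x. norm (F x) \<le> B" "0 < B"
    using assms(2) by (auto simp: bounded_pos)
  interpret positive_test_operator "scalar_mult F" p "B powr p"
    by (rule psd_scalar_mult_operator[OF assms(1) B assms(3,4)])
  show ?thesis
    unfolding positive_extension_def
    by (intro exI[of _ extension] conjI ballI allI impI extension_in_Lp extension_add extension_cmult
        extension_bounded extension_test extension_pos)
qed

section \<open>Assembling and testing the matrix operator\<close>

lemma column_vectorsD: "f \<in> column_vectors Y \<Longrightarrow> (\<lambda>x. f x $ k) \<in> Y"
  by (simp add: column_vectors_def)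

context
  fixes G :: "real ^ 'n \<Rightarrow> complex ^ 'm ^ 'm"
  assumes bG: "bounded (range G)" and cG: "continuous_on UNIV G"
begin

lemma multiplier_op_C_vanishing:
  assumes f: "f \<in> column_vectors test_functions"
  shows "multiplier_op G f \<in> column_vectors C_vanishing"
proof -
  have s: "scalar_mult (\<lambda>y. G y $ j $ k) (\<lambda>x. f x $ k) \<in> C_vanishing" for j k
    by (rule scalar_mult_C_vanishing[OF bounded_entry[OF bG] continuous_entry[OF cG] column_vectorsD[OF f]])
  have "(\<lambda>x. \<Sum>k\<in>UNIV. scalar_mult (\<lambda>y. G y $ j $ k) (\<lambda>x. f x $ k) x) \<in> C_vanishing" for j
    using s by (auto simp: C_vanishing_def intro!: continuous_on_sum tendsto_null_sum)
  then show ?thesis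
    by (simp add: column_vectors_def multiplier_op_component[OF bG cG f])
qed

lemma multiplier_op_linear:
  assumes f: "f \<in> column_vectors test_functions" and g: "g \<in> column_vectors test_functions"
  shows "multiplier_op G (\<lambda>x. a *s f x + b *s g x) = (\<lambda>x. a *s multiplier_op G f x + b *s multiplier_op G g x)"
proof -
  note F = bounded_entry[OF bG] continuous_entry[OF cG]
  have t: "(\<lambda>x. a * f x $ k) \<in> test_functions" "(\<lambda>x. b * g x $ k) \<in> test_functions" for k
    by (intro test_functions_cmult column_vectorsD f g)+
  have fg: "(\<lambda>x. a *s f x + b *s g x) \<in> column_vectors test_functions"
    using t by (simp add: column_vectors_def test_functions_add)
  have "scalar_mult (\<lambda>y. G y $ j $ k) (\<lambda>x. a * f x $ k + b * g x $ k) x =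
     a * scalar_mult (\<lambda>y. G y $ j $ k) (\<lambda>x. f x $ k) x + b * scalar_mult (\<lambda>y. G y $ j $ k) (\<lambda>x. g x $ k) x" for j k x
    by (simp add: scalar_mult_add[OF F t] scalar_mult_cmult[OF F])
  then show ?thesis
    by (auto simp: fun_eq_iff vec_eq_iff multiplier_op_component[OF bG cG f] multiplier_op_component[OF bG cG g]
        multiplier_op_component[OF bG cG fg] sum.distrib sum_distrib_left)
qed

text \<open>A vector supported in component \<open>k\<close> isolates the entry
  \<open>(j, k)\<close> in component \<open>j\<close> of its image, so positivity of the matrix
  operator passes to every scalar multiplier.\<close>

lemma extends_imp_psd:
  assumes p: "1 \<le> p" and ext: "extends_to_positive_Lp_operator p G"
  shows "psd_function (\<lambda>x. G x $ j $ k)"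
proof (rule scalar_mult_nonneg_imp_psd[OF bounded_entry[OF bG] continuous_entry[OF cG]])
  fix f :: "real^'n \<Rightarrow> complex" and x
  assume f: "f \<in> test_functions" "\<And>x. f x \<in> \<real>\<^sub>\<ge>\<^sub>0"
  obtain T where T: "\<And>f. f \<in> column_vectors test_functions \<Longrightarrow> AE x in lebesgue. T f x = multiplier_op G f x"
    "T ` Lp_vec_nonneg p \<subseteq> Lp_vec_nonneg p"
    using ext by (auto simp: extends_to_positive_Lp_operator_def)
  define v :: "real^'n \<Rightarrow> complex^'m" where "v x = axis k (f x)" for x
  have vi: "(\<lambda>x. v x $ i) = (if i = k then f else (\<lambda>x. 0))" for i
    by (auto simp: v_def axis_def)
  have vt: "v \<in> column_vectors test_functions"
    using f(1) test_functions_0 by (auto simp: column_vectors_def vi)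
  have "test_functions \<subseteq> (Lp p :: (real^'n \<Rightarrow> complex) set)"
    using p by (auto simp: Lp_iff intro!: pintegrable_test_function)
  then have "v \<in> column_vectors (Lp p)" using vt by (auto simp: column_vectors_def)
  moreover have "v x $ i \<in> \<real>\<^sub>\<ge>\<^sub>0" for x i using f(2) by (auto simp: v_def axis_def)
  ultimately have "v \<in> Lp_vec_nonneg p" by (simp add: Lp_vec_nonneg_def)
  then have "T v \<in> Lp_vec_nonneg p" using T(2) by blast
  then have 1: "AE x in lebesgue. T v x $ j \<in> \<real>\<^sub>\<ge>\<^sub>0" by (simp add: Lp_vec_nonneg_def)
  have z: "scalar_mult (\<lambda>y. G y $ j $ i) (\<lambda>x. 0) x = 0" for i x
    by (simp add: scalar_mult_def ft_def)
  have "multiplier_op G v x $ j = scalar_mult (\<lambda>y. G y $ j $ k) f x" for x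
  proof -
    have "multiplier_op G v x $ j = (\<Sum>i\<in>UNIV. if i = k then scalar_mult (\<lambda>y. G y $ j $ k) f x else 0)"
      unfolding multiplier_op_component[OF bG cG vt] vi by (intro sum.cong) (auto simp: z)
    then show ?thesis by simp
  qed
  with 1 T(1)[OF vt] have "AE x in lebesgue. scalar_mult (\<lambda>y. G y $ j $ k) f x \<in> \<real>\<^sub>\<ge>\<^sub>0"
    by (auto elim!: eventually_elim2)
  moreover have "continuous_on UNIV (scalar_mult (\<lambda>y. G y $ j $ k) f)"
    using scalar_mult_C_vanishing[OF bounded_entry[OF bG] continuous_entry[OF cG] f(1)] by (simp add: C_vanishing_def)
  ultimately show "scalar_mult (\<lambda>y. G y $ j $ k) f x \<in> \<real>\<^sub>\<ge>\<^sub>0"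
    by (intro AE_nonneg_imp_nonneg)
qed

text \<open>The scalar extensions of the entries act as a matrix of operators; nonnegative entries
  applied to nonnegative components give nonnegative sums.\<close>

lemma psd_imp_extends:
  assumes psd: "\<And>j k. psd_function (\<lambda>x. G x $ j $ k)" and p: "1 \<le> p"
  shows "extends_to_positive_Lp_operator p G"
proof -
  have "\<forall>j k. \<exists>S. positive_extension p (\<lambda>y. G y $ j $ k) S"
    by (intro allI psd_scalar_extension psd bounded_entry[OF bG] continuous_entry[OF cG] p)
  then obtain S where "\<forall>j k. positive_extension p (\<lambda>y. G y $ j $ k) (S j k)"
    unfolding choice_iff by blast
  note S = this[unfolded positive_extension_def]
  have SLp: "S j k f \<in> Lp p" if "f \<in> Lp p" for j k f using S that by blast
  have Sadd: "AE x in lebesgue. S j k (\<lambda>x. f x + g x) x = S j k f x + S j k g x"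
    if "f \<in> Lp p" "g \<in> Lp p" for j k f g using S that by blast
  have Scmult: "AE x in lebesgue. S j k (\<lambda>x. a * f x) x = a * S j k f x" if "f \<in> Lp p" for j k f a
    using S that by blast
  have Stest: "AE x in lebesgue. S j k f x = scalar_mult (\<lambda>y. G y $ j $ k) f x"
    if "f \<in> test_functions" for j k f using S that by blast
  have Spos: "AE x in lebesgue. S j k f x \<in> \<real>\<^sub>\<ge>\<^sub>0"
    if "f \<in> Lp p" "AE x in lebesgue. f x \<in> \<real>\<^sub>\<ge>\<^sub>0" for j k f using S that by blast
  have "\<forall>j k. \<exists>C\<ge>0. \<forall>f\<in>Lp p. Lp_norm p (S j k f) \<le> C * Lp_norm p f" using S by blast
  then obtain C where C0: "\<And>j k. 0 \<le> C j k"
    and C: "\<And>j k f. f \<in> Lp p \<Longrightarrow> Lp_norm p (S j k f) \<le> C j k * Lp_norm p f"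
    unfolding choice_iff by blast
  \<comment> \<open>There are finitely many pairs \<open>(j, k)\<close>, so their exceptional null
    sets can be merged into one before components are summed.\<close>
  have AE_all: "AE x in lebesgue. \<forall>j k. P j k x" if "\<And>j k. AE x in lebesgue. P j k x"
    for P :: "'m \<Rightarrow> 'm \<Rightarrow> real^'n \<Rightarrow> bool"
  proof -
    have "AE x in lebesgue. \<forall>jk\<in>(UNIV :: ('m \<times> 'm) set). P (fst jk) (snd jk) x"
      by (intro AE_finite_allI that) simp
    then show ?thesis by eventually_elim auto
  qed
  define T where "T f x = (\<chi> j. \<Sum>k\<in>UNIV. S j k (\<lambda>x. f x $ k) x)" for f x
  have TLp: "T f \<in> column_vectors (Lp p)" if "f \<in> column_vectors (Lp p)" for f
    using p SLp[OF column_vectorsD[OF that]] by (simp add: column_vectors_def T_def Lp_sum)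
  have "bounded_Lp_operator p T"
    unfolding bounded_Lp_operator_def
  proof (intro conjI ballI allI TLp)
    fix f g :: "real^'n \<Rightarrow> complex^'m" assume f: "f \<in> column_vectors (Lp p)" and g: "g \<in> column_vectors (Lp p)"
    have "AE x in lebesgue. \<forall>j k. S j k (\<lambda>x. f x $ k + g x $ k) x = S j k (\<lambda>x. f x $ k) x + S j k (\<lambda>x. g x $ k) x"
      by (intro AE_all Sadd column_vectorsD f g)
    then show "AE x in lebesgue. T (\<lambda>y. f y + g y) x = T f x + T g x"
      by eventually_elim (simp add: T_def vec_eq_iff sum.distrib)
  next
    fix a and f :: "real^'n \<Rightarrow> complex^'m" assume f: "f \<in> column_vectors (Lp p)"
    have "AE x in lebesgue. \<forall>j k. S j k (\<lambda>x. a * f x $ k) x = a * S j k (\<lambda>x. f x $ k) x"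
      by (intro AE_all Scmult column_vectorsD f)
    then show "AE x in lebesgue. T (\<lambda>y. a *s f y) x = a *s T f x"
      by eventually_elim (simp add: T_def vec_eq_iff sum_distrib_left)
  next
    \<comment> \<open>The sum of all entry bounds is a single constant that dominates each of them,
      because they are nonnegative.\<close>
    define D where "D = (\<Sum>j\<in>UNIV. \<Sum>k\<in>UNIV. C j k)"
    have D: "C j k \<le> D" for j k
    proof -
      have "C j k \<le> (\<Sum>k\<in>UNIV. C j k)" using C0 by (intro member_le_sum) auto
      also have "\<dots> \<le> D" unfolding D_def
        by (rule member_le_sum[where f="\<lambda>j. \<Sum>k\<in>UNIV. C j k"]) (auto intro: sum_nonneg C0)
      finally show ?thesis .
    qed
    show "\<exists>C. \<forall>f\<in>column_vectors (Lp p). Lp_vec_norm p (T f) \<le> C * Lp_vec_norm p f"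
    proof (intro exI ballI)
      fix f :: "real^'n \<Rightarrow> complex^'m" assume f: "f \<in> column_vectors (Lp p)"
      have "Lp_norm p (\<lambda>x. T f x $ j) \<le> 4 ^ CARD('m) * (D * Lp_vec_norm p f)" for j
      proof -
        have "Lp_norm p (\<lambda>x. T f x $ j) \<le> 4 ^ CARD('m) * (\<Sum>k\<in>UNIV. Lp_norm p (S j k (\<lambda>x. f x $ k)))"
          unfolding T_def using p SLp[OF column_vectorsD[OF f]] by (simp add: Lp_norm_sum_le)
        also have "\<dots> \<le> 4 ^ CARD('m) * (\<Sum>k\<in>UNIV. D * Lp_norm p (\<lambda>x. f x $ k))"
        proof (intro mult_left_mono sum_mono)
          fix k
          show "Lp_norm p (S j k (\<lambda>x. f x $ k)) \<le> D * Lp_norm p (\<lambda>x. f x $ k)"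
            using C[OF column_vectorsD[OF f], of j k] mult_right_mono[OF D Lp_norm_nonneg] by (meson order_trans)
        qed simp
        finally show ?thesis by (simp add: Lp_vec_norm_def sum_distrib_left)
      qed
      then have "Lp_vec_norm p (T f) \<le> (\<Sum>j\<in>(UNIV::'m set). 4 ^ CARD('m) * (D * Lp_vec_norm p f))"
        unfolding Lp_vec_norm_def[of p "T f"] by (intro sum_mono)
      then show "Lp_vec_norm p (T f) \<le> (real CARD('m) * 4 ^ CARD('m) * D) * Lp_vec_norm p f"
        by (simp add: mult_ac)
    qed
  qed
  moreover have "AE x in lebesgue. T f x = multiplier_op G f x" if f: "f \<in> column_vectors test_functions" for f
  proof -
    have "AE x in lebesgue. \<forall>j k. S j k (\<lambda>x. f x $ k) x = scalar_mult (\<lambda>y. G y $ j $ k) (\<lambda>x. f x $ k) x"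
      by (intro AE_all Stest column_vectorsD f)
    then show ?thesis
      by eventually_elim (simp add: T_def vec_eq_iff multiplier_op_component[OF bG cG f])
  qed
  moreover have "T ` Lp_vec_nonneg p \<subseteq> Lp_vec_nonneg p"
  proof safe
    fix f :: "real^'n \<Rightarrow> complex^'m" assume "f \<in> Lp_vec_nonneg p"
    then have f: "f \<in> column_vectors (Lp p)" "\<And>k. AE x in lebesgue. f x $ k \<in> \<real>\<^sub>\<ge>\<^sub>0"
      by (auto simp: Lp_vec_nonneg_def)
    have "AE x in lebesgue. \<forall>j k. S j k (\<lambda>x. f x $ k) x \<in> \<real>\<^sub>\<ge>\<^sub>0"
      by (intro AE_all Spos column_vectorsD f)
    then have "AE x in lebesgue. T f x $ j \<in> \<real>\<^sub>\<ge>\<^sub>0" for j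
      by eventually_elim (auto simp: T_def intro: nonneg_Reals_sum)
    then show "T f \<in> Lp_vec_nonneg p" using TLp[OF f(1)] by (simp add: Lp_vec_nonneg_def)
  qed
  ultimately show ?thesis unfolding extends_to_positive_Lp_operator_def by blast
qed

end

theorem theorem1p1:
  fixes G :: "real ^ 'n \<Rightarrow> complex ^ 'm ^ 'm"
  assumes "bounded (range G)"
    and "continuous_on UNIV G"
  shows "(\<forall>f \<in> column_vectors test_functions. multiplier_op G f \<in> column_vectors C_vanishing) \<and>
    (\<forall>f \<in> column_vectors test_functions. \<forall>g \<in> column_vectors test_functions. \<forall>a b.
       multiplier_op G (\<lambda>x. a *s f x + b *s g x) =
         (\<lambda>x. a *s multiplier_op G f x + b *s multiplier_op G g x)) \<and>
    ((\<forall>j k. psd_function (\<lambda>x. G x $ j $ k)) \<longleftrightarrow> extends_to_positive_Lp_operator 1 G) \<and>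
    ((\<forall>j k. psd_function (\<lambda>x. G x $ j $ k)) \<longleftrightarrow>
       (\<exists>p>1. extends_to_positive_Lp_operator p G)) \<and>
    ((\<forall>j k. psd_function (\<lambda>x. G x $ j $ k)) \<longleftrightarrow>
       (\<forall>p>1. extends_to_positive_Lp_operator p G))"
proof -
  note G = assms
  have suff: "extends_to_positive_Lp_operator p G" if "\<forall>j k. psd_function (\<lambda>x. G x $ j $ k)" "1 \<le> p" for p
    using that by (intro psd_imp_extends[OF G]) auto
  have nec: "\<forall>j k. psd_function (\<lambda>x. G x $ j $ k)" if "extends_to_positive_Lp_operator p G" "1 \<le> p" for p
    using extends_imp_psd[OF G that(2,1)] by blast
  show ?thesis
  proof (intro conjI ballI allI)
    show "multiplier_op G f \<in> column_vectors C_vanishing" if "f \<in> column_vectors test_functions" for f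
      by (rule multiplier_op_C_vanishing[OF G that])
    show "multiplier_op G (\<lambda>x. a *s f x + b *s g x) = (\<lambda>x. a *s multiplier_op G f x + b *s multiplier_op G g x)"
      if "f \<in> column_vectors test_functions" "g \<in> column_vectors test_functions" for f g a b
      by (rule multiplier_op_linear[OF G that])
    show "(\<forall>j k. psd_function (\<lambda>x. G x $ j $ k)) \<longleftrightarrow> extends_to_positive_Lp_operator 1 G"
      using suff[of 1] nec[of 1] by auto
    show "(\<forall>j k. psd_function (\<lambda>x. G x $ j $ k)) \<longleftrightarrow> (\<exists>p>1. extends_to_positive_Lp_operator p G)"
    proof
      assume "\<forall>j k. psd_function (\<lambda>x. G x $ j $ k)"
      \<comment> \<open>The implication holds for all p at least 1; 2 is an arbitrary witness above
        1.\<close>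
      then show "\<exists>p>1. extends_to_positive_Lp_operator p G" using suff[of 2] by (intro exI[of _ 2]) auto
    qed (use nec in force)
    show "(\<forall>j k. psd_function (\<lambda>x. G x $ j $ k)) \<longleftrightarrow> (\<forall>p>1. extends_to_positive_Lp_operator p G)"
    proof
      assume "\<forall>p>1. extends_to_positive_Lp_operator p G"
      then show "\<forall>j k. psd_function (\<lambda>x. G x $ j $ k)" using nec[of 2] by auto
    qed (use suff in force)
  qed
qed

end
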